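(* Let $d\ge 2$ be an even integer, $v=\frac d2$, $\theta_1,\dots,\theta_d\in(0,1]$, and $$\Box=\theta_1\partial_{x_1}^2+\dots+\theta_v\partial_{x_v}^2-\theta_{v+1}\partial_{x_{v+1}}^2-\dots-\theta_d\partial_{x_d}^2$$ on $\mathbb T^d=(\mathbb R/2\pi\mathbb Z)^d$. For every $p\ge 2$ there is a constant $C$ (depending only on $d,p,\theta_1,\dots,\theta_d$) such that for every dyadic integer $N=2^n$, $n\in\mathbb N$, and every $\phi\in L^2(\mathbb T^d)$, $$\| P_{\le N}e^{it\Box}\phi\|_{L^p_{t,x}([0,1]\times\mathbb T^d)}\le C\big(N^{\frac d2-\frac{d+2}{p}}+N^{\frac d4-\frac{d}{2p}}\big)\|\phi\|_{L^2_x(\mathbb T^d)}.$$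
   Context: For $f\in L^2(\mathbb T^d)$ write $f(x)=\sum_{k\in\mathbb Z^d}\hat f(k)e^{ik\cdot x}$. The propagator $e^{it\Box}$ is the Fourier multiplier with symbol $e^{ith(k)}$, $h(k)=-\sum_{j\le v}\theta_jk_j^2+\sum_{j>v}\theta_jk_j^2$, i.e. $u=e^{it\Box}\phi$ solves $(i\partial_t+\Box)u=0$, $u(0)=\phi$. $P_{\le N}$ is the Fourier projection onto frequencies $\{k\in\mathbb Z^d: |k|<2N\}$. *)

theory Defs
  imports "HOL-Analysis.Analysis"
begin

definition Lp_space :: "real \<Rightarrow> 'a measure \<Rightarrow> ('a \<Rightarrow> complex) set" where
  "Lp_space p M = {f. f \<in> borel_measurable M \<and> integrable M (\<lambda>x. norm (f x) powr p)}"

text \<open>Only meaningful on \<^const>\<open>Lp_space\<close>: the Bochner integral of a non-integrable function is 0.\<close>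

definition Lp_norm :: "real \<Rightarrow> 'a measure \<Rightarrow> ('a \<Rightarrow> complex) \<Rightarrow> real" where
  "Lp_norm p M f = (LINT x|M. norm (f x) powr p) powr (1 / p)"

text \<open>The torus \<open>(\<real>/2\<pi>\<int>)\<^sup>d\<close>, as a measure space, is represented by the fundamental domain
  \<open>[0,2\<pi>)\<^sup>d\<close> with Lebesgue measure (not normalised). Points, frequencies and the coefficients
  \<open>\<theta>\<close> are indexed by \<open>1, \<dots>, d\<close>.\<close>

definition torus :: "nat \<Rightarrow> (nat \<Rightarrow> real) measure" where
  "torus d = PiM {1..d} (\<lambda>_. restrict_space lborel {0..<2 * pi})"

definition lattice :: "nat \<Rightarrow> (nat \<Rightarrow> int) set" where
  "lattice d = PiE {1..d} (\<lambda>_. UNIV)"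

definition freq_norm :: "nat \<Rightarrow> (nat \<Rightarrow> int) \<Rightarrow> real" where
  "freq_norm d k = sqrt (\<Sum>j\<in>{1..d}. (real_of_int (k j))\<^sup>2)"

definition character :: "nat \<Rightarrow> (nat \<Rightarrow> int) \<Rightarrow> (nat \<Rightarrow> real) \<Rightarrow> complex" where
  "character d k x = exp (\<i> * complex_of_real (\<Sum>j\<in>{1..d}. real_of_int (k j) * x j))"

definition fourier_coeff :: "nat \<Rightarrow> ((nat \<Rightarrow> real) \<Rightarrow> complex) \<Rightarrow> (nat \<Rightarrow> int) \<Rightarrow> complex" where
  "fourier_coeff d f k =
     complex_of_real (1 / (2 * pi) ^ d) * (LINT x|torus d. f x * cnj (character d k x))"

text \<open>The Fourier multiplier with symbol \<open>m\<close> maps \<open>f \<in> L\<^sup>2\<close> to the \<open>L\<^sup>2\<close> function whose Fourier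
  coefficients are those of \<open>f\<close> multiplied by \<open>m\<close>. For bounded \<open>m\<close> such a function exists by the
  Riesz-Fischer theorem and is unique up to null sets; the choice picks a representative.\<close>

definition fourier_multiplier ::
  "nat \<Rightarrow> ((nat \<Rightarrow> int) \<Rightarrow> complex) \<Rightarrow> ((nat \<Rightarrow> real) \<Rightarrow> complex) \<Rightarrow> (nat \<Rightarrow> real) \<Rightarrow> complex" where
  "fourier_multiplier d m f =
     (SOME g. g \<in> Lp_space 2 (torus d) \<and>
        (\<forall>k\<in>lattice d. fourier_coeff d g k = m k * fourier_coeff d f k))"

text \<open>The eigenvalue of the operator \<open>\<box>\<close> on \<open>e\<^bsup>ik\<cdot>x\<^esup>\<close>.\<close>

definition box_symbol :: "nat \<Rightarrow> nat \<Rightarrow> (nat \<Rightarrow> real) \<Rightarrow> (nat \<Rightarrow> int) \<Rightarrow> real" where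
  "box_symbol d v \<theta> k =
     - (\<Sum>j\<in>{1..v}. \<theta> j * (real_of_int (k j))\<^sup>2) + (\<Sum>j\<in>{v<..d}. \<theta> j * (real_of_int (k j))\<^sup>2)"

definition propagator ::
  "nat \<Rightarrow> nat \<Rightarrow> (nat \<Rightarrow> real) \<Rightarrow> real \<Rightarrow> ((nat \<Rightarrow> real) \<Rightarrow> complex) \<Rightarrow> (nat \<Rightarrow> real) \<Rightarrow> complex" where
  "propagator d v \<theta> t =
     fourier_multiplier d (\<lambda>k. exp (\<i> * complex_of_real (t * box_symbol d v \<theta> k)))"

text \<open>The Fourier projection is given by its finite sum rather than by \<^const>\<open>fourier_multiplier\<close>,
  so that it depends only on the null-set class of \<open>f\<close> and composing it with the propagator gives
  a function that is jointly measurable in time and space.\<close>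

definition freq_proj ::
  "nat \<Rightarrow> real \<Rightarrow> ((nat \<Rightarrow> real) \<Rightarrow> complex) \<Rightarrow> (nat \<Rightarrow> real) \<Rightarrow> complex" where
  "freq_proj d N f x =
     (\<Sum>k\<in>{k \<in> lattice d. freq_norm d k < 2 * N}. fourier_coeff d f k * character d k x)"

definition spacetime :: "nat \<Rightarrow> (real \<times> (nat \<Rightarrow> real)) measure" where
  "spacetime d = restrict_space lborel {0..1} \<Otimes>\<^sub>M torus d"

end

theory Submission
  imports Defs
begin

text \<open>Let \<open>p = 2 + 8/d\<close>. At this exponent the two powers of \<open>N\<close> coincide, and the other exponents follow
  by splitting \<open>|u|\<^sup>p\<close> between \<open>L\<^sup>2\<close> (conservation of mass) and \<open>L\<^bsup>2+8/d\<^esup>\<close>, respectively between \<open>L\<^bsup>2+8/d\<^esup>\<close> and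
  the trivial bound in \<open>L\<^sup>\<infinity>\<close>. The endpoint is a \<open>T T\<^sup>*\<close> argument that only sees the dispersive
  bound \<open>G(t)\<close>, the supremum over \<open>x\<close> of a smoothly truncated convolution kernel: the propagator
  maps \<open>L\<^bsup>p'\<^esup>\<close> to \<open>L\<^sup>p\<close> with norm at most a multiple of \<open>G(t)\<^bsup>1-2/p\<^esup>\<close>, and the weak Young (Hardy-Littlewood-Sobolev)
  inequality in time needs \<open>G\<^bsup>1-2/p\<^esup>\<close> in weak \<open>L\<^bsup>p/2\<^esup>\<close>, that is \<open>G\<close> in weak \<open>L\<^bsup>4/d\<^esup>\<close>. Since the kernel is a
  product of \<open>d\<close> one-dimensional quadratic Weyl sums, this reduces to a weak \<open>L\<^sup>4\<close> bound in time for a single Weyl sum,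
  uniform in space, which Weyl differencing and Dirichlet's approximation theorem give without logarithmic loss.
  Each \<open>\<theta>\<^sub>j\<close> enters only through a change of variable in time.\<close>

section \<open>Quadratic Weyl sums\<close>

text \<open>The obstacle is the logarithm. The measure bound for the times at which the majorant of
  one squared Weyl sum exceeds y is of order (L/y)^2, and the majorant reaches order L^2;
  integrating y times this bound over the heights from L to L^2 would cost a factor log L, which the
  claim does not allow at p = 2 + 8/d. So only the weak-type information is kept, in a form that the
  Young inequality in time accepts. The second obstacle is that the \<theta>_j may be
  incommensurable: the times \<theta>_j t approach rationals of small denominator independently of
  each other, so there is no common family of major arcs. A pigeonhole replaces it: a product of d
  factors above \<mu> has one factor above \<mu>^(1/d), and d separate measure bounds are added. The
  exponents close because p - 2 = 8/d turns height \<kappa> of G^(1-2/p) into height \<kappa>^(p/4)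
  of a majorant. The signs in the operator merely reverse time in some factors, and the majorant is
  even in time.\<close>

definition geom_cis :: "nat \<Rightarrow> real \<Rightarrow> complex" where
  "geom_cis H x = (\<Sum>b<H. cis (real b * x))"

lemma norm_geom_cis_le: "norm (geom_cis H x) \<le> real H"
proof -
  have "norm (geom_cis H x) \<le> (\<Sum>b<H. norm (cis (real b * x)))"
    unfolding geom_cis_def by (rule norm_sum)
  then show ?thesis by simp
qed

lemma norm_one_minus_cis: "norm (1 - cis x) = 2 * \<bar>sin (x / 2)\<bar>"
proof -
  have c: "cos x = 1 - 2 * (sin (x/2))\<^sup>2"
    using cos_double_sin[of "x/2"] by simp
  have "(norm (1 - cis x))\<^sup>2 = (1 - cos x)\<^sup>2 + (sin x)\<^sup>2"
    by (simp add: cmod_power2)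
  also have "\<dots> = 2 - 2 * cos x"
    using sin_cos_squared_add[of x] by (simp add: power2_eq_square algebra_simps)
  also have "\<dots> = (2 * \<bar>sin (x/2)\<bar>)\<^sup>2"
    by (simp add: c power2_eq_square)
  finally show ?thesis by (rule power2_eq_imp_eq) auto
qed

text \<open>Kept as a product, so that multiples of 2 pi need no separate treatment. The telescoped
  sum \<open>1 - cis (real H * x)\<close> has norm at most 2, and this 2 cancels against the one in
  \<open>norm_one_minus_cis\<close>.\<close>

lemma norm_geom_cis_sin: "norm (geom_cis H x) * \<bar>sin (x / 2)\<bar> \<le> 1"
proof -
  have "(1 - cis x) * geom_cis H x = 1 - cis (real H * x)"
  proof -
    have "geom_cis H x = (\<Sum>b<H. cis x ^ b)"
      unfolding geom_cis_def by (intro sum.cong refl) (rule Complex.DeMoivre[symmetric])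
    then show ?thesis
      using one_diff_power_eq[of "cis x" H] by (simp add: Complex.DeMoivre)
  qed
  then have "norm (1 - cis x) * norm (geom_cis H x) = norm (1 - cis (real H * x))"
    by (metis norm_mult)
  also have "\<dots> \<le> 2"
    using norm_triangle_ineq4[of 1 "cis (real H * x)"] by simp
  finally show ?thesis unfolding norm_one_minus_cis by (simp add: mult.commute)
qed

text \<open>What Weyl differencing leaves of the square of a quadratic Weyl sum; it no longer depends on the spatial
  variable, and the squares of the inner geometric sums decay fast enough to avoid logarithms.\<close>

definition weyl_majorant :: "nat \<Rightarrow> real \<Rightarrow> real" where
  "weyl_majorant L t = (\<Sum>a\<in>{-2 * int L..2 * int L}. \<Sum>a'\<in>{-2 * int L..2 * int L}.
     (norm (geom_cis L (2 * t * of_int (a - a'))) / L)\<^sup>2)"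

text \<open>A trapezoid, namely the indicator of \<open>[-2L, 2L]\<close> averaged over the shifts \<open>b - c\<close>; averaging
  over both \<open>b\<close> and \<open>c\<close> is what produces the squares in \<^const>\<open>weyl_majorant\<close>.\<close>

definition cutoff :: "nat \<Rightarrow> int \<Rightarrow> real" where
  "cutoff L k = card {(b, c). b < L \<and> c < L \<and> \<bar>k - int b + int c\<bar> \<le> 2 * int L} / (real L)\<^sup>2"

lemma cutoff_nonneg: "0 \<le> cutoff L k"
  by (simp add: cutoff_def)

lemma cutoff_le_1: "cutoff L k \<le> 1"
proof -
  have "card {(b, c). b < L \<and> c < L \<and> \<bar>k - int b + int c\<bar> \<le> 2 * int L} \<le> card ({..<L} \<times> {..<L})"
    by (rule card_mono) auto
  then have "real (card {(b, c). b < L \<and> c < L \<and> \<bar>k - int b + int c\<bar> \<le> 2 * int L}) \<le> real (L * L)"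
    by (simp only: of_nat_le_iff card_cartesian_product card_lessThan)
  then show ?thesis
    unfolding cutoff_def divide_le_eq_1 by (cases "L = 0") (auto simp: power2_eq_square)
qed

lemma cutoff_eq_1:
  assumes "L > 0" "\<bar>k\<bar> \<le> int L"
  shows "cutoff L k = 1"
proof -
  have "{(b, c). b < L \<and> c < L \<and> \<bar>k - int b + int c\<bar> \<le> 2 * int L} = {..<L} \<times> {..<L}"
    using assms(2) by auto
  then show ?thesis using assms(1) by (simp add: cutoff_def power2_eq_square)
qed

text \<open>Unfolding the average turns the weight into shifts: with \<open>k = a + b - c\<close>
  the range of \<open>a\<close> no longer depends on \<open>b\<close> and \<open>c\<close>, as
  differencing requires. Since |b - c| < L, all these \<open>k\<close> lie in [-3L, 3L].\<close>

lemma sum_cutoff: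
  fixes g :: "int \<Rightarrow> complex"
  shows "(\<Sum>k\<in>{-3 * int L..3 * int L}. of_real (cutoff L k) * g k) =
    (\<Sum>b<L. \<Sum>c<L. \<Sum>a\<in>{-2 * int L..2 * int L}. g (a + int b - int c)) / of_real ((real L)\<^sup>2)"
proof -
  let ?P = "\<lambda>k b c. \<bar>k - int b + int c\<bar> \<le> 2 * int L"
  have card: "of_nat (card {(b, c). b < L \<and> c < L \<and> ?P k b c}) =
      (\<Sum>b<L. \<Sum>c<L. if ?P k b c then 1 else (0::complex))" for k
  proof -
    have "(\<Sum>b<L. \<Sum>c<L. if ?P k b c then 1 else (0::complex)) =
      (\<Sum>(b,c)\<in>{..<L} \<times> {..<L}. if ?P k b c then 1 else 0)"
      by (simp add: sum.cartesian_product)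
    also have "\<dots> = (\<Sum>z\<in>{..<L} \<times> {..<L}. if z \<in> {(b, c). ?P k b c} then 1 else 0)"
      by (intro sum.cong) auto
    also have "\<dots> = (\<Sum>z\<in>({..<L} \<times> {..<L}) \<inter> {(b, c). ?P k b c}. 1)"
      by (rule sum.inter_restrict[symmetric]) auto
    also have "({..<L} \<times> {..<L}) \<inter> {(b, c). ?P k b c} = {(b, c). b < L \<and> c < L \<and> ?P k b c}"
      by auto
    finally show ?thesis by simp
  qed
  have inner: "(\<Sum>k\<in>{-3 * int L..3 * int L}. if ?P k b c then g k else 0) =
      (\<Sum>a\<in>{-2 * int L..2 * int L}. g (a + int b - int c))" if "b < L" "c < L" for b c
  proof -
    have "(\<Sum>k\<in>{-3 * int L..3 * int L}. if ?P k b c then g k else 0) =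
        (\<Sum>k\<in>{-3 * int L..3 * int L} \<inter> {k. ?P k b c}. g k)"
      by (subst sum.inter_restrict) auto
    also have "\<dots> = (\<Sum>a\<in>{-2 * int L..2 * int L}. g (a + int b - int c))"
      by (rule sum.reindex_bij_witness[of _ "\<lambda>a. a + int b - int c" "\<lambda>k. k - int b + int c"])
        (use that in auto)
    finally show ?thesis .
  qed
  have "(\<Sum>k\<in>{-3 * int L..3 * int L}. of_real (cutoff L k) * g k) =
    (\<Sum>k\<in>{-3 * int L..3 * int L}. (\<Sum>b<L. \<Sum>c<L. if ?P k b c then g k else 0)) / of_real ((real L)\<^sup>2)"
    unfolding sum_divide_distrib cutoff_def of_real_divide of_real_of_nat_eq card
    by (intro sum.cong refl) (auto simp: sum_distrib_right intro!: sum.cong)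
  also have "(\<Sum>k\<in>{-3 * int L..3 * int L}. (\<Sum>b<L. \<Sum>c<L. if ?P k b c then g k else 0)) =
      (\<Sum>b<L. \<Sum>c<L. \<Sum>k\<in>{-3 * int L..3 * int L}. if ?P k b c then g k else 0)"
    by (subst sum.swap, rule sum.cong[OF refl], rule sum.swap)
  also have "\<dots> = (\<Sum>b<L. \<Sum>c<L. \<Sum>a\<in>{-2 * int L..2 * int L}. g (a + int b - int c))"
    by (intro sum.cong refl inner) auto
  finally show ?thesis .
qed

lemma sum_norm_square:
  fixes z :: "'a \<Rightarrow> complex"
  shows "of_real ((norm (\<Sum>a\<in>A. z a))\<^sup>2) = (\<Sum>a\<in>A. \<Sum>a'\<in>A. z a * cnj (z a'))"
  unfolding complex_norm_square cnj_sum sum_product by (rule refl)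

text \<open>Weyl differencing with two shifts. Moving by h = b - c multiplies the quadratic phase by
  a factor free of \<open>a\<close> and by a linear phase in \<open>a\<close>. The triangle
  inequality over the pairs (b, c) drops the former; Cauchy-Schwarz and opening the square leave
  geometric sums in \<open>b\<close> and \<open>c\<close>, while \<open>x\<close> survives only in
  unimodular coefficients.\<close>

lemma weyl_bound:
  "norm (\<Sum>k\<in>{-3 * int L..3 * int L}. of_real (cutoff L k) * cis (of_int k * x + t * (of_int k)\<^sup>2))
     \<le> sqrt (weyl_majorant L t)"
proof (cases "L = 0")
  case True
  then show ?thesis by (simp add: cutoff_def weyl_majorant_def)
next
  case False
  let ?I = "{-2 * int L..2 * int L}" and ?B = "{..<L} \<times> {..<L}"
  define u where "u b c a = cis (of_int a * x + t * (of_int a)\<^sup>2) * cis (2 * t * of_int a * (real b - real c))"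
    for b c a
  define y where "y b c = norm (\<Sum>a\<in>?I. u b c a)" for b c
  let ?D = "\<Sum>k\<in>{-3 * int L..3 * int L}. of_real (cutoff L k) * cis (of_int k * x + t * (of_int k)\<^sup>2)"
  have fac: "cis (of_int (a + int b - int c) * x + t * (of_int (a + int b - int c))\<^sup>2) =
     cis ((real b - real c) * x + t * (real b - real c)\<^sup>2) * u b c a" for a b c
    unfolding u_def cis_mult by (rule arg_cong[of _ _ cis]) (simp add: power2_eq_square algebra_simps)
  have "norm ?D \<le> (\<Sum>b<L. \<Sum>c<L. y b c) / (real L)\<^sup>2"
  proof -
    have "norm (\<Sum>b<L. \<Sum>c<L. cis ((real b - real c) * x + t * (real b - real c)\<^sup>2) * sum (u b c) ?I)
        \<le> (\<Sum>b<L. \<Sum>c<L. y b c)"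
      by (intro sum_norm_le) (simp add: norm_mult y_def)
    then show ?thesis
      unfolding sum_cutoff fac sum_distrib_left[symmetric] norm_divide norm_of_real
      by (simp add: divide_right_mono)
  qed
  also have "(\<Sum>b<L. \<Sum>c<L. y b c) = (\<Sum>(b,c)\<in>?B. y b c)"
    unfolding sum.cartesian_product by (rule refl)
  finally have 1: "norm ?D \<le> (\<Sum>(b,c)\<in>?B. y b c) / (real L)\<^sup>2" .
  have cs: "(\<Sum>(b,c)\<in>?B. y b c)\<^sup>2 \<le> (\<Sum>(b,c)\<in>?B. (y b c)\<^sup>2) * (real L)\<^sup>2"
    using Cauchy_Schwarz_ineq_sum[of "\<lambda>(b,c). y b c" "\<lambda>_. 1" ?B]
    by (simp add: case_prod_unfold power2_eq_square[of "real L"])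
  have sq: "(r / m)\<^sup>2 \<le> q / m" if "r\<^sup>2 \<le> q * m" "m > 0" for r q m :: real
    using that by (simp add: power_divide power2_eq_square divide_le_eq)
  have 2: "((\<Sum>(b,c)\<in>?B. y b c) / (real L)\<^sup>2)\<^sup>2 \<le> (\<Sum>(b,c)\<in>?B. (y b c)\<^sup>2) / (real L)\<^sup>2"
    by (rule sq) (use cs False in auto)
  have 3: "(\<Sum>(b,c)\<in>?B. (y b c)\<^sup>2) \<le> weyl_majorant L t * (real L)\<^sup>2"
  proof -
    let ?v = "\<lambda>a. cis (of_int a * x + t * (of_int a)\<^sup>2)"
    \<comment> \<open>The cross term is linear in \<open>b - c\<close>, hence a function of
      \<open>b\<close> times the conjugate of the same function of \<open>c\<close>. Summing over
      both independently produces a squared modulus.\<close>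
    have e: "u b c a * cnj (u b c a') = ?v a * cnj (?v a') *
       (cis (real b * (2 * t * of_int (a - a'))) * cnj (cis (real c * (2 * t * of_int (a - a')))))" for a a' b c
      unfolding u_def complex_cnj_mult cis_cnj cis_mult
      by (rule arg_cong[of _ _ cis]) (simp add: algebra_simps)
    have "complex_of_real (\<Sum>(b,c)\<in>?B. (y b c)\<^sup>2) = (\<Sum>b<L. \<Sum>c<L. of_real ((y b c)\<^sup>2))"
      unfolding sum.cartesian_product of_real_sum by (simp add: case_prod_unfold)
    also have "\<dots> = (\<Sum>b<L. \<Sum>c<L. \<Sum>a\<in>?I. \<Sum>a'\<in>?I. u b c a * cnj (u b c a'))"
      unfolding y_def sum_norm_square by (rule refl)
    also have "\<dots> = (\<Sum>b<L. \<Sum>a\<in>?I. \<Sum>c<L. \<Sum>a'\<in>?I. u b c a * cnj (u b c a'))"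
      by (rule sum.cong[OF refl], rule sum.swap)
    also have "\<dots> = (\<Sum>b<L. \<Sum>a\<in>?I. \<Sum>a'\<in>?I. \<Sum>c<L. u b c a * cnj (u b c a'))"
      by (rule sum.cong[OF refl], rule sum.cong[OF refl], rule sum.swap)
    also have "\<dots> = (\<Sum>a\<in>?I. \<Sum>b<L. \<Sum>a'\<in>?I. \<Sum>c<L. u b c a * cnj (u b c a'))"
      by (rule sum.swap)
    also have "\<dots> = (\<Sum>a\<in>?I. \<Sum>a'\<in>?I. \<Sum>b<L. \<Sum>c<L. u b c a * cnj (u b c a'))"
      by (rule sum.cong[OF refl], rule sum.swap)
    also have "\<dots> = (\<Sum>a\<in>?I. \<Sum>a'\<in>?I. ?v a * cnj (?v a') *
         of_real ((norm (geom_cis L (2 * t * of_int (a - a'))))\<^sup>2))"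
      unfolding e geom_cis_def sum_norm_square sum_distrib_left ..
    finally have eq: "complex_of_real (\<Sum>(b,c)\<in>?B. (y b c)\<^sup>2) = \<dots>" .
    have "(\<Sum>(b,c)\<in>?B. (y b c)\<^sup>2) \<le> norm (complex_of_real (\<Sum>(b,c)\<in>?B. (y b c)\<^sup>2))"
      unfolding norm_of_real by (rule abs_ge_self)
    also have "\<dots> \<le> (\<Sum>a\<in>?I. \<Sum>a'\<in>?I. (norm (geom_cis L (2 * t * of_int (a - a'))))\<^sup>2)"
      unfolding eq by (intro sum_norm_le) (simp add: norm_mult norm_power)
    also have "\<dots> = weyl_majorant L t * (real L)\<^sup>2"
      using False by (simp add: weyl_majorant_def power_divide sum_divide_distrib[symmetric])
    finally show ?thesis .
  qed
  have "(norm ?D)\<^sup>2 \<le> ((\<Sum>(b,c)\<in>?B. y b c) / (real L)\<^sup>2)\<^sup>2"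
    using 1 by (intro power_mono) auto
  also have "\<dots> \<le> (\<Sum>(b,c)\<in>?B. (y b c)\<^sup>2) / (real L)\<^sup>2" by (rule 2)
  also have "\<dots> \<le> weyl_majorant L t" using 3 False by (simp add: divide_le_eq)
  finally show ?thesis by (rule real_le_rsqrt)
qed

section \<open>Large values of the majorant force good rational approximations\<close>

lemma sin_pi_ge:
  assumes "0 \<le> y" "y \<le> 1/2"
  shows "y \<le> sin (pi * y)"
proof (cases "y \<le> 1/3")
  case True
  show ?thesis
  proof (cases "y = 0")
    case False
    then have "0 < pi * y" using assms by simp
    from MVT2[OF this, of sin cos] DERIV_sin obtain z where
      z: "0 < z" "z < pi * y" "sin (pi * y) - sin 0 = (pi * y - 0) * cos z"
      by blast
    have "z \<le> pi / 3" using z(2) mult_left_mono[OF True pi_ge_zero] by linarith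
    then have "cos (pi / 3) \<le> cos z" using z(1) by (intro cos_monotone_0_pi_le) auto
    then have "pi * y * (1 / 2) \<le> pi * y * cos z"
      using assms by (intro mult_left_mono) (auto simp: cos_60)
    moreover have "2 * y \<le> pi * y" using pi_ge_two assms by (intro mult_right_mono) auto
    ultimately show ?thesis unfolding z(3)[unfolded sin_zero diff_0_right] by linarith
  qed auto
next
  case False
  have "- (pi / 2) \<le> pi / 3" using pi_gt_zero by linarith
  moreover have "pi / 3 \<le> pi * y" "pi * y \<le> pi / 2"
    using assms False mult_left_mono[of y "1/2" pi] mult_left_mono[of "1/3" y pi] by auto
  ultimately have "sin (pi / 3) \<le> sin (pi * y)" by (rule sin_monotone_2pi_le)
  moreover have "1 / 2 \<le> sin (pi / 3)"
    using real_le_rsqrt[of 1 3] by (simp add: sin_60)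
  ultimately show ?thesis using assms by simp
qed

text \<open>The left side is the distance from \<open>z\<close> to the nearest integer. Reduction
  modulo 1 changes only the sign of the sine, and reflection handles the upper half of the
  period.\<close>

lemma abs_sin_pi_ge: "min (frac z) (1 - frac z) \<le> \<bar>sin (pi * z)\<bar>"
proof -
  have f: "0 \<le> frac z" "frac z < 1" by (auto simp: frac_lt_1)
  have "pi * z = pi * frac z + pi * of_int \<lfloor>z\<rfloor>"
    unfolding frac_def by (simp add: algebra_simps)
  then have "sin (pi * z) = sin (pi * frac z) * cos (pi * of_int \<lfloor>z\<rfloor>) + cos (pi * frac z) * sin (pi * of_int \<lfloor>z\<rfloor>)"
    by (simp only: sin_add)
  moreover have s0: "sin (pi * of_int \<lfloor>z\<rfloor>) = 0" by (simp add: sin_times_pi_eq_0 mult.commute)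
  moreover have "\<bar>cos (pi * of_int \<lfloor>z\<rfloor>)\<bar> = 1" using sin_zero_abs_cos_one[OF s0] .
  ultimately have e: "\<bar>sin (pi * z)\<bar> = \<bar>sin (pi * frac z)\<bar>" by (simp add: abs_mult)
  show ?thesis
  proof (cases "frac z \<le> 1 / 2")
    case True
    then show ?thesis using sin_pi_ge[of "frac z"] f e by simp
  next
    case False
    have "sin (pi * (1 - frac z)) = sin (pi * frac z)"
      by (simp add: algebra_simps)
    then show ?thesis using sin_pi_ge[of "1 - frac z"] False f e by simp
  qed
qed

text \<open>Envelope of a squared normalised geometric sum at distance about j/L from the integers;
  the value 1 at 0 is the trivial bound.\<close>

definition inv_sq :: "nat \<Rightarrow> real" where
  "inv_sq j = (if j = 0 then 1 else 1 / (real j)\<^sup>2)"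

lemma sum_inv_sq_le: "(\<Sum>j<L. inv_sq j) \<le> 3"
proof -
  \<comment> \<open>The induction carries the telescoping remainder: after the terms 1 + 1, each
    1/j^2 is at most 1/(j-1) - 1/j.\<close>
  have *: "(\<Sum>j<m+2. inv_sq j) \<le> 3 - 1 / real (m + 1)" for m
  proof (induction m)
    case 0
    then show ?case by (simp add: inv_sq_def numeral_2_eq_2)
  next
    case (Suc m)
    have "inv_sq (m + 2) \<le> 1 / (real (m + 1) * real (m + 2))"
      by (auto simp: inv_sq_def power2_eq_square intro!: divide_left_mono mult_right_mono)
    also have "\<dots> = 1 / real (m + 1) - 1 / real (m + 2)"
      by (simp add: field_simps)
    finally have "inv_sq (m + 2) \<le> 1 / real (m + 1) - 1 / real (m + 2)" .
    then show ?case using Suc by simp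
  qed
  have "(\<Sum>j<L. inv_sq j) \<le> (\<Sum>j<L+2. inv_sq j)"
    by (rule sum_mono2) (auto simp: inv_sq_def)
  also have "\<dots> \<le> 3" using *[of L] by (rule order_trans) simp
  finally show ?thesis .
qed

text \<open>\<open>j\<close> numbers the cell of length 1/L, modulo 1, that contains
  \<open>z\<close>. The distance to the nearest integer is at least j/L or (L - 1 - j)/L; as it is
  not known which, both envelopes are added. The two end cells use the trivial bound.\<close>

lemma geom_cis_sq_le:
  assumes "L > 0" and j: "j = nat \<lfloor>L * frac z\<rfloor>"
  shows "j < L" "(norm (geom_cis L (2 * pi * z)) / L)\<^sup>2 \<le> inv_sq j + inv_sq (L - 1 - j)"
proof -
  have f: "0 \<le> frac z" "frac z < 1" by (auto simp: frac_lt_1)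
  have lf: "real L * frac z < L" using f assms(1) by simp
  have j1: "real j \<le> L * frac z" "L * frac z < real j + 1"
    using f unfolding j by (auto simp: of_nat_nat)
  show jL: "j < L"
  proof -
    have "real j < real L" using j1 lf by linarith
    then show ?thesis by simp
  qed
  let ?n = "norm (geom_cis L (2 * pi * z))"
  have n0: "inv_sq k \<ge> 0" for k by (simp add: inv_sq_def)
  show "(?n / L)\<^sup>2 \<le> inv_sq j + inv_sq (L - 1 - j)"
  proof (cases "j = 0 \<or> L - 1 - j = 0")
    case True
    have "(?n / L)\<^sup>2 \<le> 1"
      using norm_geom_cis_le[of L "2 * pi * z"] assms(1) by (simp add: power_le_one)
    moreover have "1 \<le> inv_sq j + inv_sq (L - 1 - j)"
      using True n0[of j] n0[of "L - 1 - j"] by (auto simp: inv_sq_def)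
    ultimately show ?thesis by linarith
  next
    case False
    have ns: "?n * \<bar>sin (pi * z)\<bar> \<le> 1"
      using norm_geom_cis_sin[of L "2 * pi * z"] by simp
    have b: "(?n / L)\<^sup>2 \<le> inv_sq k" if "k > 0" "real k \<le> L * \<bar>sin (pi * z)\<bar>" for k
    proof -
      have "?n * k \<le> ?n * (L * \<bar>sin (pi * z)\<bar>)" by (intro mult_left_mono that) auto
      also have "\<dots> \<le> L" using mult_left_mono[OF ns, of "real L"] by (simp add: algebra_simps)
      finally have "?n / L \<le> 1 / k" using that assms(1) by (simp add: field_simps)
      then have "(?n / L)\<^sup>2 \<le> (1 / k)\<^sup>2" by (intro power_mono) auto
      then show ?thesis using that by (simp add: inv_sq_def power_divide)
    qed
    have r: "real (L - 1 - j) = real L - 1 - real j" using jL by linarith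
    consider "frac z \<le> \<bar>sin (pi * z)\<bar>" | "1 - frac z \<le> \<bar>sin (pi * z)\<bar>"
      using abs_sin_pi_ge[of z] by linarith
    then show ?thesis
    proof cases
      case 1
      have "real j \<le> L * \<bar>sin (pi * z)\<bar>"
        using mult_left_mono[OF 1, of "real L"] j1 by linarith
      then show ?thesis using b[of j] n0[of "L - 1 - j"] False by linarith
    next
      case 2
      have "real (L - 1 - j) \<le> L * \<bar>sin (pi * z)\<bar>"
        using mult_left_mono[OF 2, of "real L"] j1 r by (simp add: algebra_simps)
      then show ?thesis using b[of "L - 1 - j"] n0[of j] False by linarith
    qed
  qed
qed

text \<open>Pigeonhole on the cells. If for every \<open>a\<close> each cell held at most n of the
  \<open>a'\<close>, summability of 1/j^2 would bound every inner sum by 6n, and the 4L + 1 \<le> 5L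
  values of \<open>a\<close> would give 30 L n. With 1/j instead of 1/j^2 a factor log L would
  appear.\<close>

lemma weyl_majorant_class:
  assumes L: "L > 0" and big: "30 * real L * real n < weyl_majorant L t"
  obtains a j where "card {a'\<in>{-2 * int L..2 * int L}. nat \<lfloor>L * frac (t / pi * of_int (a - a'))\<rfloor> = j} > n"
proof (rule ccontr)
  assume "\<not> thesis"
  let ?I = "{-2 * int L..2 * int L}"
  define J where "J a a' = nat \<lfloor>L * frac (t / pi * of_int (a - a'))\<rfloor>" for a a'
  have small: "card {a'\<in>?I. J a a' = j} \<le> n" for a j
    using that[of a j] \<open>\<not> thesis\<close> unfolding J_def by (meson not_le)
  have inner: "(\<Sum>a'\<in>?I. (norm (geom_cis L (2 * t * of_int (a - a'))) / L)\<^sup>2) \<le> 6 * n" for a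
  proof -
    have "(\<Sum>a'\<in>?I. (norm (geom_cis L (2 * t * of_int (a - a'))) / L)\<^sup>2)
        \<le> (\<Sum>a'\<in>?I. inv_sq (J a a') + inv_sq (L - 1 - J a a'))"
    proof (rule sum_mono)
      fix a'
      show "(norm (geom_cis L (2 * t * of_int (a - a'))) / L)\<^sup>2 \<le> inv_sq (J a a') + inv_sq (L - 1 - J a a')"
        using geom_cis_sq_le(2)[OF L J_def[of a a']] by (simp add: mult.assoc)
    qed
    also have "\<dots> = (\<Sum>j<L. \<Sum>a'\<in>{a'\<in>?I. J a a' = j}. inv_sq (J a a') + inv_sq (L - 1 - J a a'))"
      by (rule sum.group[symmetric]) (use geom_cis_sq_le(1)[OF L J_def] in auto)
    also have "\<dots> = (\<Sum>j<L. card {a'\<in>?I. J a a' = j} * (inv_sq j + inv_sq (L - 1 - j)))"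
      by (intro sum.cong refl) simp
    also have "\<dots> \<le> (\<Sum>j<L. n * (inv_sq j + inv_sq (L - 1 - j)))"
      by (intro sum_mono mult_right_mono) (use small in \<open>auto simp: inv_sq_def\<close>)
    also have "\<dots> = n * ((\<Sum>j<L. inv_sq j) + (\<Sum>j<L. inv_sq (L - 1 - j)))"
      by (simp add: sum_distrib_left sum.distrib distrib_left)
    also have "(\<Sum>j<L. inv_sq (L - 1 - j)) = (\<Sum>j<L. inv_sq j)"
      using sum.nat_diff_reindex[of inv_sq L] by simp
    also have "real n * ((\<Sum>j<L. inv_sq j) + (\<Sum>j<L. inv_sq j)) \<le> real n * 6"
      using sum_inv_sq_le[of L] by (intro mult_left_mono) auto
    finally show ?thesis by simp
  qed
  have "weyl_majorant L t \<le> (\<Sum>a\<in>?I. 6 * real n)"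
    unfolding weyl_majorant_def by (intro sum_mono order_trans[OF inner]) simp
  also have "\<dots> = (4 * real L + 1) * (6 * real n)" by simp
  also have "\<dots> \<le> 5 * real L * (6 * real n)" using L by (intro mult_right_mono) auto
  finally show False using big by simp
qed

text \<open>Many near-returns improve Dirichlet's theorem. The vectors (b - b0, z b) lie in a thin
  strip of slope \<alpha>, and more than m of them fall on one line parallel to the primitive vector
  (k, a). Being spaced by multiples of k within length 4L, they force k m \<le> 4L, and comparing
  the two extreme ones divides the approximation error by m as well.\<close>

lemma dirichlet_structure:
  fixes \<alpha> :: real and B :: "int set"
  assumes L: "L > 0" and m: "m > 0" and B: "B \<subseteq> {-2 * int L..2 * int L}" "card B > 9 * m"
    and close: "\<And>b b'. b \<in> B \<Longrightarrow> b' \<in> B \<Longrightarrow> \<exists>z::int. \<bar>\<alpha> * of_int (b - b') - of_int z\<bar> < 1 / L"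
  obtains q :: nat and a :: int where "q \<ge> 1" "q * m \<le> 4 * L" "real m * \<bar>q * \<alpha> - a\<bar> < 2 / L"
proof -
  obtain a k where ak: "coprime a k" "0 < k" "k \<le> int L" "\<bar>of_int k * \<alpha> - of_int a\<bar> < 1 / L"
    using Dirichlet_approx_coprime[OF L] by blast
  have finB: "finite B" using B(1) finite_subset by blast
  obtain b0 where b0: "b0 \<in> B" using B(2) by (metis card.empty ex_in_conv less_nat_zero_code)
  define z where "z b = (SOME z::int. \<bar>\<alpha> * of_int (b - b0) - of_int z\<bar> < 1 / L)" for b
  have z: "\<bar>\<alpha> * of_int (b - b0) - of_int (z b)\<bar> < 1 / L" if "b \<in> B" for b
    unfolding z_def by (rule someI_ex) (rule close[OF that b0])
  \<comment> \<open>The determinants of lattice vectors in a bounded box take few values; vectors with the same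
     determinant differ by a multiple of the Dirichlet vector.\<close>
  define D where "D b = (b - b0) * a - z b * k" for b
  \<comment> \<open>The first product is at most 4L/L, the second is less than k/L \<le> 1, so the
    determinant is below 5 in absolute value. The nine integers left are the 9 in
    \<open>card B > 9 * m\<close>.\<close>
  have D: "D b \<in> {-4..4}" if "b \<in> B" for b
  proof -
    have e: "real_of_int (D b) = of_int (b - b0) * (a - k * \<alpha>) + k * (\<alpha> * of_int (b - b0) - z b)"
      unfolding D_def by (simp add: algebra_simps)
    have "\<bar>b - b0\<bar> \<le> 4 * int L" using subsetD[OF B(1) that] subsetD[OF B(1) b0] by auto
    then have bb: "\<bar>real_of_int (b - b0)\<bar> \<le> 4 * real L" by linarith
    have "\<bar>real_of_int (D b)\<bar> \<le> \<bar>real_of_int (b - b0)\<bar> * \<bar>a - k * \<alpha>\<bar> + k * \<bar>\<alpha> * of_int (b - b0) - z b\<bar>"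
      unfolding e using ak(2) by (intro order_trans[OF abs_triangle_ineq]) (simp add: abs_mult)
    also have "\<bar>real_of_int (b - b0)\<bar> * \<bar>a - k * \<alpha>\<bar> \<le> 4 * L * (1 / L)"
      using ak(4) bb by (intro mult_mono) (auto simp: abs_minus_commute)
    also have "k * \<bar>\<alpha> * of_int (b - b0) - z b\<bar> < k * (1 / L)"
      using z[OF that] ak(2) by (intro mult_strict_left_mono) auto
    also have "k * (1 / L) \<le> L * (1 / L)"
      using ak(3) L by (intro mult_right_mono) auto
    finally have "\<bar>real_of_int (D b)\<bar> < 5" using L by simp
    then show ?thesis by auto
  qed
  have "\<exists>D0\<in>{-4..4}. card {b\<in>B. D b = D0} > m"
  proof (rule ccontr)
    assume "\<not> ?thesis"
    then have "\<And>D0. D0 \<in> {-4..4} \<Longrightarrow> card {b\<in>B. D b = D0} \<le> m" by (meson not_le)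
    then have "(\<Sum>D0\<in>{-4..4}. card {b\<in>B. D b = D0}) \<le> (\<Sum>D0\<in>{-4..4::int}. m)"
      by (intro sum_mono) auto
    moreover have "card B = (\<Sum>D0\<in>{-4..4}. card {b\<in>B. D b = D0})"
      using sum.group[of B "{-4..4}" D "\<lambda>_. 1::nat"] finB D by (simp add: image_subset_iff)
    ultimately show False using B(2) by simp
  qed
  then obtain D0 where D0: "card {b\<in>B. D b = D0} > m" by blast
  define E where "E = {b\<in>B. D b = D0}"
  have finE: "finite E" and E0: "E \<noteq> {}" and cE: "card E > m"
    using finB D0 unfolding E_def by (simp, metis card.empty less_nat_zero_code, simp)
  have dvd: "k dvd b - b'" if "b \<in> E" "b' \<in> E" for b b'
  proof -
    have "(b - b') * a = (z b - z b') * k"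
      using that unfolding E_def D_def by (auto simp: algebra_simps)
    then have "k dvd (b - b') * a" by simp
    then show ?thesis using ak(1) by (simp add: coprime_commute coprime_dvd_mult_left_iff)
  qed
  define lo hi where "lo = Min E" and "hi = Max E"
  have lohi: "lo \<in> E" "hi \<in> E" "\<And>b. b \<in> E \<Longrightarrow> lo \<le> b \<and> b \<le> hi"
    using finE E0 by (auto simp: lo_def hi_def)
  obtain r where r: "hi - lo = k * r" using dvd[OF lohi(2,1)] by blast
  \<comment> \<open>More than m points of an arithmetic progression of step k span at least m
    steps.\<close>
  have rm: "int m \<le> r"
  proof -
    have "E \<subseteq> (\<lambda>i. lo + k * i) ` {0..r}"
    proof
      fix b assume b: "b \<in> E"
      obtain i where i: "b - lo = k * i" using dvd[OF b lohi(1)] by blast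
      have "0 \<le> k * i" "k * i \<le> k * r" using lohi(3)[OF b] i r by linarith+
      then have "0 \<le> i" "i \<le> r" using ak(2) by (auto simp: zero_le_mult_iff)
      then show "b \<in> (\<lambda>i. lo + k * i) ` {0..r}" using i by (intro image_eqI[of _ _ i]) auto
    qed
    then have "card E \<le> card ((\<lambda>i. lo + k * i) ` {0..r})" by (intro card_mono) auto
    also have "\<dots> \<le> card {0..r}" by (rule card_image_le) simp
    finally show ?thesis using cE by simp
  qed
  have zz: "z hi - z lo = r * a"
  proof -
    have "(hi - lo) * a = (z hi - z lo) * k"
      using lohi(1,2) unfolding E_def D_def by (auto simp: algebra_simps)
    then show ?thesis using r ak(2) by simp
  qed
  \<comment> \<open>Both extreme points have error below 1/L, and the difference of these errors is
    r times the Dirichlet error.\<close>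
  have "real_of_int r * \<bar>k * \<alpha> - a\<bar> = \<bar>(\<alpha> * of_int (hi - b0) - z hi) - (\<alpha> * of_int (lo - b0) - z lo)\<bar>"
  proof -
    have "(\<alpha> * of_int (hi - b0) - z hi) - (\<alpha> * of_int (lo - b0) - z lo) = \<alpha> * of_int (hi - lo) - of_int (z hi - z lo)"
      by (simp add: algebra_simps)
    also have "\<dots> = r * (k * \<alpha> - a)" unfolding zz r by (simp add: algebra_simps)
    finally show ?thesis using rm m by (simp add: abs_mult)
  qed
  also have "\<dots> < 2 / L"
    using z[of hi] z[of lo] lohi(1,2) unfolding E_def by (simp add: abs_if split: if_splits)
  finally have rk: "real_of_int r * \<bar>k * \<alpha> - a\<bar> < 2 / L" .
  show ?thesis
  proof (rule that[of "nat k" a])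
    show "1 \<le> nat k" using ak(2) by simp
    have "k * int m \<le> k * r" using rm ak(2) by simp
    also have "\<dots> \<le> 4 * int L" using r subsetD[OF B(1), of hi] subsetD[OF B(1), of lo] lohi(1,2) unfolding E_def by simp
    finally have "int (nat k * m) \<le> int (4 * L)" using ak(2) by simp
    then show "nat k * m \<le> 4 * L" by (simp only: of_nat_le_iff)
    have "real m * \<bar>k * \<alpha> - a\<bar> \<le> real_of_int r * \<bar>k * \<alpha> - a\<bar>"
      using rm by (intro mult_right_mono) auto
    then show "real m * \<bar>real (nat k) * \<alpha> - a\<bar> < 2 / L" using rk ak(2) by simp
  qed
qed

text \<open>Here 270 = 30 * 9: \<open>weyl_majorant_class\<close> is applied with 9 m, the count
  that \<open>dirichlet_structure\<close> asks for. Two members of one cell have fractional parts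
  within 1/L of each other, and \<alpha> is t / pi because 2 t = 2 pi (t / pi).\<close>

lemma weyl_majorant_large:
  assumes L: "L > 0" and m: "m > 0" and big: "270 * real L * real m < weyl_majorant L t"
  obtains q :: nat and a :: int where "q \<ge> 1" "q * m \<le> 4 * L" "real m * \<bar>q * (t / pi) - a\<bar> < 2 / L"
proof -
  obtain a j where c: "card {a'\<in>{-2 * int L..2 * int L}. nat \<lfloor>L * frac (t / pi * of_int (a - a'))\<rfloor> = j} > 9 * m"
    using weyl_majorant_class[OF L, of "9 * m" t] big by auto
  let ?B = "{a'\<in>{-2 * int L..2 * int L}. nat \<lfloor>L * frac (t / pi * of_int (a - a'))\<rfloor> = j}"
  show ?thesis
  proof (rule dirichlet_structure[OF L m _ c, of "t / pi"])
    fix b b' assume b: "b \<in> ?B" "b' \<in> ?B"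
    let ?f = "\<lambda>b. frac (t / pi * of_int (a - b))"
    have f: "real j \<le> L * ?f c \<and> L * ?f c < real j + 1" if "c \<in> ?B" for c
    proof -
      have "0 \<le> \<lfloor>L * ?f c\<rfloor>" by simp
      then have "\<lfloor>L * ?f c\<rfloor> = int j" using that by auto
      then show ?thesis by linarith
    qed
    have "\<bar>L * ?f b' - L * ?f b\<bar> < 1" using f[OF b(1)] f[OF b(2)] by linarith
    then have "L * \<bar>?f b' - ?f b\<bar> < 1" by (simp add: abs_mult right_diff_distrib[symmetric])
    then have "\<bar>?f b' - ?f b\<bar> < 1 / L" using L by (simp add: field_simps)
    moreover have "t / pi * of_int (b - b') - of_int (\<lfloor>t / pi * of_int (a - b')\<rfloor> - \<lfloor>t / pi * of_int (a - b)\<rfloor>)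
        = ?f b' - ?f b" unfolding frac_def by (simp add: algebra_simps diff_divide_distrib)
    ultimately show "\<exists>z::int. \<bar>t / pi * of_int (b - b') - of_int z\<bar> < 1 / L" by metis
  qed (use that in auto)
qed

section \<open>The set of times at which the majorant is large\<close>

lemma continuous_on_weyl_majorant: "continuous_on S (weyl_majorant L)"
  unfolding weyl_majorant_def geom_cis_def cis_conv_exp divide_inverse
  by (intro continuous_intros)

lemma weyl_majorant_minus: "weyl_majorant L (- t) = weyl_majorant L t"
proof -
  have g: "norm (geom_cis L (- x)) = norm (geom_cis L x)" for x
  proof -
    have "geom_cis L (- x) = cnj (geom_cis L x)"
      by (simp add: geom_cis_def cis_cnj)
    then show ?thesis by simp
  qed
  have "2 * - t * of_int k = - (2 * t * of_int k)" for k by simp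
  then show ?thesis unfolding weyl_majorant_def by (simp only: g)
qed

text \<open>The term a = a' = 0 alone equals 1. Positivity passes to \<open>kernel_bound\<close>,
  which will be the positive constant \<open>G\<close> of the interpolation result.\<close>

lemma weyl_majorant_pos:
  assumes "L > 0"
  shows "weyl_majorant L t > 0"
proof -
  have "0 < (norm (geom_cis L (2 * t * of_int (0 - 0))) / L)\<^sup>2"
    using assms by (simp add: geom_cis_def)
  also have "\<dots> \<le> (\<Sum>a'\<in>{-2 * int L..2 * int L}. (norm (geom_cis L (2 * t * of_int (0 - a'))) / L)\<^sup>2)"
    by (rule member_le_sum) auto
  also have "\<dots> \<le> weyl_majorant L t"
    unfolding weyl_majorant_def
    by (rule member_le_sum[where f = "\<lambda>a. \<Sum>a'\<in>{-2 * int L..2 * int L}. (norm (geom_cis L (2 * t * of_int (a - a'))) / L)\<^sup>2"])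
      (auto intro!: sum_nonneg)
  finally show ?thesis .
qed

text \<open>A union bound over arcs around a pi / (q \<theta>) with q \<le> 4L/m. At most 7q
  numerators are counted while each arc has length proportional to 1/q, so all denominators
  contribute equally and the total is of order m^-2 without a logarithm.\<close>

lemma emeasure_weyl_majorant_large:
  fixes \<theta> :: real
  assumes \<theta>: "0 < \<theta>" "\<theta> \<le> 1" and L: "L > 0" and m: "m > 0"
  shows "emeasure lborel {\<tau>\<in>{-1..1}. weyl_majorant L (\<theta> * \<tau>) > 270 * real L * real m}
    \<le> ennreal (112 * pi / (\<theta> * (real m)\<^sup>2))"
proof -
  define K where "K = 4 * L div m"
  define J where "J = Sigma {1..K} (\<lambda>q. {-3 * int q..3 * int q})"
  \<comment> \<open>The error 2 / (L m) of q \<theta> \<tau> / pi, rescaled to an error of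
    \<tau>.\<close>
  define r where "r q = 2 * pi / (real L * m * q * \<theta>)" for q :: nat
  define c where "c q a = a * pi / (q * \<theta>)" for q :: nat and a :: int
  define A where "A = (\<lambda>(q, a). {c q a - r q<..<c q a + r q})"
  have sub: "{\<tau>\<in>{-1..1}. weyl_majorant L (\<theta> * \<tau>) > 270 * real L * real m} \<subseteq> (\<Union>x\<in>J. A x)"
  proof
    fix \<tau> assume "\<tau> \<in> {\<tau>\<in>{-1..1}. weyl_majorant L (\<theta> * \<tau>) > 270 * real L * real m}"
    then have \<tau>: "\<bar>\<tau>\<bar> \<le> 1" and big: "270 * real L * real m < weyl_majorant L (\<theta> * \<tau>)" by auto
    obtain q a where q: "q \<ge> 1" "q * m \<le> 4 * L" and a: "real m * \<bar>q * (\<theta> * \<tau> / pi) - of_int a\<bar> < 2 / L"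
      using weyl_majorant_large[OF L m big] by blast
    let ?e = "\<bar>q * (\<theta> * \<tau> / pi) - of_int a\<bar>"
    have e: "?e < 2 / (L * m)" using a m L by (simp add: field_simps)
    have lm: "1 \<le> real L * real m" using L m by (metis One_nat_def Suc_leI nat_0_less_mult_iff of_nat_1 of_nat_le_iff of_nat_mult)
    have "2 / (L * m) \<le> 2 / (1::real)" using lm by (intro divide_left_mono) auto
    with e have e2: "?e < 2" by simp
    \<comment> \<open>Since \<theta> and |\<tau>| are at most 1, the numerator is below q + 2 in
      absolute value, hence within 3q because q \<ge> 1.\<close>
    have "\<bar>q * (\<theta> * \<tau> / pi)\<bar> = q * (\<theta> * (\<bar>\<tau>\<bar> / pi))" using \<theta> by (simp add: abs_mult)
    also have "\<dots> \<le> real q * (1 * 1)"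
      using \<theta> \<tau> pi_ge_two by (intro mult_left_mono mult_mono) (auto simp: divide_le_eq)
    finally have "\<bar>real_of_int a\<bar> < q + 2" using e2 by linarith
    then have "\<bar>a\<bar> < int q + 2" by linarith
    then have aJ: "a \<in> {-3 * int q..3 * int q}" using q(1) by auto
    have "q \<le> K" unfolding K_def using q(2) m by (simp add: less_eq_div_iff_mult_less_eq)
    then have "(q, a) \<in> J" unfolding J_def using q(1) aJ by auto
    moreover have "\<tau> \<in> A (q, a)"
    proof -
      have qt: "0 < q * \<theta>" using q(1) \<theta> by simp
      have "\<tau> - c q a = (q * (\<theta> * \<tau> / pi) - of_int a) * (pi / (q * \<theta>))"
        unfolding c_def using q(1) \<theta> by (simp add: left_diff_distrib diff_divide_distrib)
      then have "\<bar>\<tau> - c q a\<bar> = ?e * (pi / (q * \<theta>))" using \<theta> by (simp add: abs_mult)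
      also have "\<dots> < 2 / (L * m) * (pi / (q * \<theta>))"
        using e qt by (intro mult_strict_right_mono) auto
      also have "\<dots> = r q" unfolding r_def by simp
      finally show ?thesis unfolding A_def by (auto simp: abs_less_iff)
    qed
    ultimately show "\<tau> \<in> (\<Union>x\<in>J. A x)" by blast
  qed
  have finJ: "finite J" unfolding J_def by (intro finite_SigmaI) auto
  have r0: "0 \<le> r q" for q unfolding r_def using \<theta> by simp
  have "emeasure lborel {\<tau>\<in>{-1..1}. weyl_majorant L (\<theta> * \<tau>) > 270 * real L * real m} \<le> emeasure lborel (\<Union>x\<in>J. A x)"
    by (intro emeasure_mono sub) (auto simp: A_def finJ intro!: sets.finite_UN)
  also have "\<dots> \<le> (\<Sum>x\<in>J. emeasure lborel (A x))"
    by (intro emeasure_subadditive_finite finJ) (auto simp: A_def)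
  also have "\<dots> = (\<Sum>x\<in>J. ennreal (2 * r (fst x)))"
    by (intro sum.cong refl) (auto simp: A_def r0)
  also have "\<dots> = ennreal (\<Sum>x\<in>J. 2 * r (fst x))"
    by (rule sum_ennreal) (simp add: r0)
  also have "(\<Sum>x\<in>J. 2 * r (fst x)) = (\<Sum>q\<in>{1..K}. \<Sum>a\<in>{-3 * int q..3 * int q}. 2 * r q)"
    unfolding J_def by (subst sum.Sigma) (auto simp: case_prod_unfold)
  also have "\<dots> \<le> (\<Sum>q\<in>{1..K}. 28 * pi / (L * m * \<theta>))"
  proof (rule sum_mono)
    fix q assume q: "q \<in> {1..K}"
    have "(\<Sum>a\<in>{-3 * int q..3 * int q}. 2 * r q) = (6 * real q + 1) * (2 * r q)" by simp
    also have "\<dots> \<le> 7 * real q * (2 * r q)" using q r0[of q] by (intro mult_right_mono) auto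
    also have "\<dots> = 28 * pi / (L * m * \<theta>)" unfolding r_def using q by simp
    finally show "(\<Sum>a\<in>{-3 * int q..3 * int q}. 2 * r q) \<le> 28 * pi / (L * m * \<theta>)" .
  qed
  also have "\<dots> = K * (28 * pi / (L * m * \<theta>))" by simp
  also have "\<dots> \<le> (4 * L / m) * (28 * pi / (L * m * \<theta>))"
  proof (rule mult_right_mono)
    have "K * m \<le> 4 * L" unfolding K_def by (rule div_times_less_eq_dividend)
    then have "real (K * m) \<le> real (4 * L)" by (simp only: of_nat_le_iff)
    then show "real K \<le> 4 * L / m" using m by (simp add: field_simps)
  qed (use \<theta> in auto)
  also have "\<dots> = 112 * pi / (\<theta> * (real m)\<^sup>2)" using L by (simp add: power2_eq_square)
  finally show ?thesis by (simp add: ennreal_leI)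
qed

lemma borel_measurable_weyl_majorant [measurable]: "weyl_majorant L \<in> borel_measurable borel"
  by (intro borel_measurable_continuous_onI continuous_on_weyl_majorant)

text \<open>Passes from integer thresholds to all heights. For y \<ge> 270 L, rounding down loses at
  most a factor 2, whence 540; for smaller y the right side is at least 2, the length of the whole
  interval. As the majorant controls the square of a Weyl sum, weak L^2 here is weak L^4 for that
  sum.\<close>

proposition weyl_majorant_weak_L2:
  fixes \<theta> :: real
  assumes \<theta>: "0 < \<theta>" "\<theta> \<le> 1" and L: "L > 0" and y: "y > 0"
  shows "emeasure lborel {\<tau>\<in>{-1..1}. weyl_majorant L (\<theta> * \<tau>) > y}
    \<le> ennreal (112 * pi * 540\<^sup>2 / \<theta> * (real L / y)\<^sup>2)"
proof -
  define m where "m = nat \<lfloor>y / (270 * L)\<rfloor>"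
  have m1: "real m \<le> y / (270 * L)" "y / (270 * L) < real m + 1"
    unfolding m_def using y L by (auto simp: of_nat_nat)
  show ?thesis
  proof (cases "m = 0")
    case False
    have "270 * real L * m \<le> y" using m1(1) L by (simp add: field_simps)
    then have "emeasure lborel {\<tau>\<in>{-1..1}. weyl_majorant L (\<theta> * \<tau>) > y} \<le>
        emeasure lborel {\<tau>\<in>{-1..1}. weyl_majorant L (\<theta> * \<tau>) > 270 * real L * real m}"
      by (intro emeasure_mono) auto
    also have "\<dots> \<le> ennreal (112 * pi / (\<theta> * (real m)\<^sup>2))"
      using emeasure_weyl_majorant_large[OF \<theta> L] False by simp
    also have "\<dots> \<le> ennreal (112 * pi * 540\<^sup>2 / \<theta> * (real L / y)\<^sup>2)"
    proof (rule ennreal_leI)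
      have "y < 270 * L * (real m + 1)" using m1(2) L by (simp add: field_simps)
      also have "\<dots> \<le> 270 * L * (2 * real m)" using False by (intro mult_left_mono) auto
      finally have "1 / real m \<le> 540 * (L / y)" using y False by (simp add: field_simps)
      then have "(1 / real m)\<^sup>2 \<le> (540 * (L / y))\<^sup>2" by (intro power_mono) auto
      then have "112 * pi / \<theta> * (1 / real m)\<^sup>2 \<le> 112 * pi / \<theta> * (540 * (L / y))\<^sup>2"
        using \<theta> by (intro mult_left_mono) auto
      then show "112 * pi / (\<theta> * (real m)\<^sup>2) \<le> 112 * pi * 540\<^sup>2 / \<theta> * (real L / y)\<^sup>2"
        by (simp add: power_mult_distrib power_divide)
    qed
    finally show ?thesis .
  next
    case True
    have "emeasure lborel {\<tau>\<in>{-1..1}. weyl_majorant L (\<theta> * \<tau>) > y} \<le> emeasure lborel {-1..1::real}"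
      by (intro emeasure_mono) auto
    also have "\<dots> = ennreal 2" by simp
    also have "\<dots> \<le> ennreal (112 * pi * 540\<^sup>2 / \<theta> * (real L / y)\<^sup>2)"
    proof (rule ennreal_leI)
      have "1 \<le> 270 * (L / y)" using m1(2) True L y by (simp add: field_simps)
      then have "1 \<le> (270 * (L / y))\<^sup>2" by (simp add: one_le_power)
      moreover have "2 \<le> 112 * pi / \<theta>"
        using \<theta> pi_ge_two by (simp add: le_divide_eq)
      ultimately have "2 * 1 \<le> 112 * pi / \<theta> * (270 * (L / y))\<^sup>2"
        using \<theta> by (intro mult_mono) auto
      also have "\<dots> = 112 * pi * 270\<^sup>2 / \<theta> * (L / y)\<^sup>2" by (simp add: power_mult_distrib power_divide)
      also have "\<dots> \<le> 112 * pi * 540\<^sup>2 / \<theta> * (L / y)\<^sup>2"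
        using \<theta> by (intro mult_right_mono divide_right_mono mult_left_mono) auto
      finally show "2 \<le> 112 * pi * 540\<^sup>2 / \<theta> * (real L / y)\<^sup>2" by simp
    qed
    finally show ?thesis .
  qed
qed

section \<open>Interpolation and the weak Young inequality\<close>

lemma nn_integral_powr_from_0:
  fixes s c :: real
  assumes "s > -1" "c \<ge> 0"
  shows "(\<integral>\<^sup>+x. ennreal (x powr s) * indicator {0<..<c} x \<partial>lborel) = ennreal (c powr (s + 1) / (s + 1))"
proof -
  have h: "((\<lambda>x. x powr s * indicator {0<..<c} x) has_integral (c powr (s + 1) / (s + 1))) UNIV"
  proof -
    have "((\<lambda>x. x powr s) has_integral (c powr (s + 1) / (s + 1))) {0<..<c}"
      using has_integral_powr_from_0[OF assms] has_integral_open_interval[of "\<lambda>x. x powr s" "c powr (s + 1) / (s + 1)" 0 c] by (simp add: box_real)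
    then have "((\<lambda>x. if x \<in> {0<..<c} then x powr s else 0) has_integral (c powr (s + 1) / (s + 1))) UNIV"
      by (subst has_integral_restrict_UNIV)
    also have "(\<lambda>x. if x \<in> {0<..<c} then x powr s else 0) = (\<lambda>x. x powr s * indicator {0<..<c} x)"
      by (auto simp: indicator_def)
    finally show ?thesis .
  qed
  have "(\<integral>\<^sup>+x. ennreal (x powr s) * indicator {0<..<c} x \<partial>lborel) =
      (\<integral>\<^sup>+x. ennreal (x powr s * indicator {0<..<c} x) \<partial>lborel)"
    by (intro nn_integral_cong) (auto simp: indicator_def)
  also have "\<dots> = ennreal (c powr (s + 1) / (s + 1))"
    by (rule nn_integral_has_integral_lborel[OF _ _ h]) auto
  finally show ?thesis .
qed

lemma nn_integral_powr_to_inf: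
  fixes r y :: real
  assumes "r > 1" "y > 0"
  shows "(\<integral>\<^sup>+x. ennreal (x powr - r) * indicator {y..} x \<partial>lborel) = ennreal (y powr (1 - r) / (r - 1))"
proof -
  have e: "- (y powr (- r + 1)) / (- r + 1) = y powr (1 - r) / (r - 1)"
    using assms by (simp add: field_simps)
  have h: "((\<lambda>x. x powr - r * indicator {y..} x) has_integral (y powr (1 - r) / (r - 1))) UNIV"
  proof -
    have "((\<lambda>x. x powr - r) has_integral (y powr (1 - r) / (r - 1))) {y..}"
      using has_integral_powr_to_inf[of "- r" y] assms e by simp
    then have "((\<lambda>x. if x \<in> {y..} then x powr - r else 0) has_integral (y powr (1 - r) / (r - 1))) UNIV"
      by (subst has_integral_restrict_UNIV)
    also have "(\<lambda>x. if x \<in> {y..} then x powr - r else 0) = (\<lambda>x. x powr - r * indicator {y..} x)"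
      by (auto simp: indicator_def)
    finally show ?thesis .
  qed
  have "(\<integral>\<^sup>+x. ennreal (x powr - r) * indicator {y..} x \<partial>lborel) =
      (\<integral>\<^sup>+x. ennreal (x powr - r * indicator {y..} x) \<partial>lborel)"
    by (intro nn_integral_cong) (auto simp: indicator_def)
  also have "\<dots> = ennreal (y powr (1 - r) / (r - 1))"
    by (rule nn_integral_has_integral_lborel[OF _ _ h]) auto
  finally show ?thesis .
qed

text \<open>Only the heights above \<open>y\<close> are resolved, because the weak bound \<kappa>^-r
  with r > 1 is integrable at infinity but not at 0.\<close>

lemma layer_cake_le:
  fixes v y :: real
  assumes "0 \<le> y"
  shows "ennreal v \<le> ennreal y + (\<integral>\<^sup>+\<kappa>. indicator {y..} \<kappa> * indicator {..<v} \<kappa> \<partial>lborel)"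
proof (cases "v \<le> y")
  case True
  then show ?thesis by (intro order_trans[OF ennreal_leI[OF True]]) simp
next
  case False
  have "(\<integral>\<^sup>+\<kappa>. indicator {y..} \<kappa> * indicator {..<v} \<kappa> \<partial>lborel) = (\<integral>\<^sup>+\<kappa>. indicator {y..<v} \<kappa> \<partial>lborel)"
    by (intro nn_integral_cong) (auto simp: indicator_def)
  also have "\<dots> = ennreal (v - y)" using False by simp
  finally show ?thesis using False assms by (simp flip: ennreal_plus)
qed

text \<open>Heights below \<open>y\<close> cost y times the measure of the set; above
  \<open>y\<close> the weak bound is integrated, applied to a reflected translate of a superlevel
  set of \<open>k\<close>. The split height stays free, to be optimised for each set.\<close>

lemma nn_integral_weak_on_set:
  fixes k :: "real \<Rightarrow> real" and t :: real
  assumes [measurable]: "k \<in> borel_measurable borel" "E \<in> sets borel"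
    and r: "r > 1" and W: "W \<ge> 0" and y: "y > 0"
    and weak: "\<And>\<kappa>. \<kappa> > 0 \<Longrightarrow> emeasure lborel {\<tau>. k \<tau> > \<kappa>} \<le> ennreal (W * \<kappa> powr - r)"
  shows "(\<integral>\<^sup>+s. ennreal (k (t - s)) * indicator E s \<partial>lborel)
    \<le> ennreal y * emeasure lborel E + ennreal (W * (y powr (1 - r) / (r - 1)))"
proof -
  have "(\<integral>\<^sup>+s. ennreal (k (t - s)) * indicator E s \<partial>lborel) \<le>
     (\<integral>\<^sup>+s. ennreal y * indicator E s +
        (\<integral>\<^sup>+\<kappa>. indicator {y..} \<kappa> * indicator {..<k (t - s)} \<kappa> \<partial>lborel) \<partial>lborel)"
    by (intro nn_integral_mono) (use layer_cake_le[of y] y in \<open>auto simp: indicator_def split: if_splits\<close>)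
  also have "\<dots> = ennreal y * emeasure lborel E +
        (\<integral>\<^sup>+s. (\<integral>\<^sup>+\<kappa>. indicator {y..} \<kappa> * indicator {\<kappa>. \<kappa> < k (t - s)} \<kappa> \<partial>lborel) \<partial>lborel)"
    by (subst nn_integral_add) (auto simp: nn_integral_cmult lessThan_def)
  also have "(\<integral>\<^sup>+s. (\<integral>\<^sup>+\<kappa>. indicator {y..} \<kappa> * indicator {\<kappa>. \<kappa> < k (t - s)} \<kappa> \<partial>lborel) \<partial>lborel) =
     (\<integral>\<^sup>+\<kappa>. (\<integral>\<^sup>+s. indicator {y..} \<kappa> * indicator {\<kappa>. \<kappa> < k (t - s)} \<kappa> \<partial>lborel) \<partial>lborel)"
    by (rule lborel_pair.Fubini') measurable
  also have "\<dots> \<le> (\<integral>\<^sup>+\<kappa>. ennreal W * (ennreal (\<kappa> powr - r) * indicator {y..} \<kappa>) \<partial>lborel)"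
  proof (rule nn_integral_mono)
    fix \<kappa> :: real
    show "(\<integral>\<^sup>+s. indicator {y..} \<kappa> * indicator {\<kappa>. \<kappa> < k (t - s)} \<kappa> \<partial>lborel)
      \<le> ennreal W * (ennreal (\<kappa> powr - r) * indicator {y..} \<kappa>)"
    proof (cases "\<kappa> \<in> {y..}")
      case True
      have "(\<integral>\<^sup>+s. indicator {y..} \<kappa> * indicator {\<kappa>. \<kappa> < k (t - s)} \<kappa> \<partial>lborel) =
          (\<integral>\<^sup>+s. indicator {\<tau>. k \<tau> > \<kappa>} (t + (-1) * s) \<partial>lborel)"
        using True by (intro nn_integral_cong) (auto simp: indicator_def)
      also have "\<dots> = (\<integral>\<^sup>+\<tau>. indicator {\<tau>. k \<tau> > \<kappa>} \<tau> \<partial>lborel)"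
        by (subst nn_integral_real_affine[of _ "-1" t]) auto
      also have "\<dots> = emeasure lborel {\<tau>. k \<tau> > \<kappa>}" by simp
      also have "\<dots> \<le> ennreal (W * \<kappa> powr - r)" using True y by (intro weak) auto
      finally show ?thesis using True W by (simp add: ennreal_mult)
    qed simp
  qed
  also have "\<dots> = ennreal W * ennreal (y powr (1 - r) / (r - 1))"
    by (subst nn_integral_cmult) (auto simp: nn_integral_powr_to_inf r y)
  also have "\<dots> = ennreal (W * (y powr (1 - r) / (r - 1)))"
    by (rule ennreal_mult[symmetric]) (use W r in auto)
  finally show ?thesis by (simp add: add_left_mono)
qed

lemma emeasure_superlevel_le:
  fixes f :: "real \<Rightarrow> real"
  assumes [measurable]: "f \<in> borel_measurable borel" and \<mu>: "\<mu> > 0" and q: "q > 0"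
    and A: "(\<integral>\<^sup>+s. ennreal (f s powr q) \<partial>lborel) \<le> ennreal A" "A \<ge> 0"
  shows "emeasure lborel {s. f s > \<mu>} \<le> ennreal (A * \<mu> powr - q)"
proof -
  have "emeasure lborel {s. f s > \<mu>} = (\<integral>\<^sup>+s. indicator {s. f s > \<mu>} s \<partial>lborel)" by simp
  also have "\<dots> \<le> (\<integral>\<^sup>+s. ennreal (\<mu> powr - q) * ennreal (f s powr q) \<partial>lborel)"
  proof (rule nn_integral_mono)
    fix s
    show "indicator {s. f s > \<mu>} s \<le> ennreal (\<mu> powr - q) * ennreal (f s powr q)"
    proof (cases "f s > \<mu>")
      case True
      have "1 = \<mu> powr - q * \<mu> powr q" using \<mu> by (simp add: powr_minus)
      also have "\<dots> \<le> \<mu> powr - q * f s powr q"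
        using True \<mu> q by (intro mult_left_mono powr_mono2) auto
      finally show ?thesis using True by (simp flip: ennreal_mult)
    qed simp
  qed
  also have "\<dots> = ennreal (\<mu> powr - q) * (\<integral>\<^sup>+s. ennreal (f s powr q) \<partial>lborel)"
    by (rule nn_integral_cmult) measurable
  also have "\<dots> \<le> ennreal (\<mu> powr - q) * ennreal A" by (intro mult_left_mono A) auto
  also have "\<dots> = ennreal (A * \<mu> powr - q)" using A by (simp flip: ennreal_mult add: mult.commute)
  finally show ?thesis .
qed

text \<open>Decompose \<open>f\<close> into its superlevel sets at heights 0 < \<mu> < M and apply
  the estimate for sets to each. With the best split height each contributes a multiple of \<mu>^-s0
  with s0 < 1, so the integral in \<mu> converges at 0; for p = 2 r its value is a multiple of
  M^(q-1).\<close>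

lemma nn_integral_weak_truncated:
  fixes k f :: "real \<Rightarrow> real" and t :: real
  assumes [measurable]: "k \<in> borel_measurable borel" "f \<in> borel_measurable borel"
    and r: "r > 1" and W: "W > 0" and p: "p = 2 * r" and q: "q = p / (p - 1)"
    and weak: "\<And>\<kappa>. \<kappa> > 0 \<Longrightarrow> emeasure lborel {\<tau>. k \<tau> > \<kappa>} \<le> ennreal (W * \<kappa> powr - r)"
    and A: "(\<integral>\<^sup>+s. ennreal (f s powr q) \<partial>lborel) \<le> ennreal A" "A > 0"
    and f: "\<And>s. f s \<ge> 0" and M: "M > 0"
  shows "(\<integral>\<^sup>+s. ennreal (k (t - s)) * (ennreal (f s) * indicator {s. f s \<le> M} s) \<partial>lborel)
    \<le> ennreal (r / (r - 1) * (p - 1) * W powr (1 / r) * A powr (1 - 1 / r) * M powr (q - 1))"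
proof -
  have q1: "q - 1 = 1 / (p - 1)" using r p q by (auto simp: field_simps)
  have qpos: "q > 0" unfolding q using r p by simp
  define s0 where "s0 = q * (1 - 1 / r)"
  have s0_1: "1 - s0 = q - 1"
  proof -
    have "2 * r - 1 \<noteq> 0" using r by simp
    then show ?thesis unfolding s0_def q p using r by (simp add: field_simps)
  qed
  moreover have "0 < q - 1" unfolding q1 using r p by simp
  ultimately have s0: "1 - s0 = q - 1" "- s0 > -1" by linarith+
  define c where "c = r / (r - 1) * W powr (1 / r) * A powr (1 - 1 / r)"
  have c0: "c \<ge> 0" unfolding c_def using r by simp
  have "(\<integral>\<^sup>+s. ennreal (k (t - s)) * (ennreal (f s) * indicator {s. f s \<le> M} s) \<partial>lborel) \<le>
     (\<integral>\<^sup>+s. \<integral>\<^sup>+\<mu>. indicator {0<..<M} \<mu> * (ennreal (k (t - s)) * indicator {s. f s > \<mu>} s) \<partial>lborel \<partial>lborel)"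
  proof (rule nn_integral_mono)
    fix s
    have "ennreal (f s) * indicator {s. f s \<le> M} s \<le> (\<integral>\<^sup>+\<mu>. indicator {0<..<M} \<mu> * indicator {s. f s > \<mu>} s \<partial>lborel)"
    proof (cases "f s \<le> M")
      case True
      have "(\<integral>\<^sup>+\<mu>. indicator {0<..<M} \<mu> * indicator {s. f s > \<mu>} s \<partial>lborel) = (\<integral>\<^sup>+\<mu>. indicator {0<..<f s} \<mu> \<partial>lborel)"
        using True by (intro nn_integral_cong) (auto simp: indicator_def)
      also have "\<dots> = ennreal (f s)" using f[of s] by simp
      finally show ?thesis using True by simp
    qed simp
    then have "ennreal (k (t - s)) * (ennreal (f s) * indicator {s. f s \<le> M} s) \<le>
       ennreal (k (t - s)) * (\<integral>\<^sup>+\<mu>. indicator {0<..<M} \<mu> * indicator {s. f s > \<mu>} s \<partial>lborel)"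
      by (rule mult_left_mono) simp
    also have "\<dots> = (\<integral>\<^sup>+\<mu>. ennreal (k (t - s)) * (indicator {0<..<M} \<mu> * indicator {s. f s > \<mu>} s) \<partial>lborel)"
      by (rule nn_integral_cmult[symmetric]) measurable
    finally show "ennreal (k (t - s)) * (ennreal (f s) * indicator {s. f s \<le> M} s) \<le>
       (\<integral>\<^sup>+\<mu>. indicator {0<..<M} \<mu> * (ennreal (k (t - s)) * indicator {s. f s > \<mu>} s) \<partial>lborel)"
      by (simp add: ac_simps)
  qed
  also have "\<dots> = (\<integral>\<^sup>+\<mu>. \<integral>\<^sup>+s. indicator {0<..<M} \<mu> * (ennreal (k (t - s)) * indicator {s. f s > \<mu>} s) \<partial>lborel \<partial>lborel)"
    by (rule lborel_pair.Fubini') measurable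
  also have "\<dots> \<le> (\<integral>\<^sup>+\<mu>. ennreal c * (ennreal (\<mu> powr - s0) * indicator {0<..<M} \<mu>) \<partial>lborel)"
  proof (rule nn_integral_mono)
    fix \<mu> :: real
    show "(\<integral>\<^sup>+s. indicator {0<..<M} \<mu> * (ennreal (k (t - s)) * indicator {s. f s > \<mu>} s) \<partial>lborel)
      \<le> ennreal c * (ennreal (\<mu> powr - s0) * indicator {0<..<M} \<mu>)"
    proof (cases "\<mu> \<in> {0<..<M}")
      case True
      then have \<mu>: "\<mu> > 0" by simp
      define e where "e = A * \<mu> powr - q"
      \<comment> \<open>The choice that makes y e and W y^(1-r) equal, where \<open>e\<close> is the
        Chebyshev bound for the measure of the superlevel set.\<close>
      define y where "y = (W / e) powr (1 / r)"
      have e: "e > 0" unfolding e_def using A \<mu> by simp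
      have y: "y > 0" unfolding y_def using e W by simp
      have "(\<integral>\<^sup>+s. indicator {0<..<M} \<mu> * (ennreal (k (t - s)) * indicator {s. f s > \<mu>} s) \<partial>lborel)
          = (\<integral>\<^sup>+s. ennreal (k (t - s)) * indicator {s. f s > \<mu>} s \<partial>lborel)"
        using True by simp
      also have "\<dots> \<le> ennreal y * emeasure lborel {s. f s > \<mu>} + ennreal (W * (y powr (1 - r) / (r - 1)))"
        using W y by (intro nn_integral_weak_on_set r weak) auto
      also have "\<dots> \<le> ennreal y * ennreal e + ennreal (W * (y powr (1 - r) / (r - 1)))"
        unfolding e_def using A
        by (intro add_right_mono mult_left_mono emeasure_superlevel_le \<mu> qpos) auto
      also have "\<dots> = ennreal (y * e + W * (y powr (1 - r) / (r - 1)))"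
        using y e W r by (simp add: ennreal_mult[symmetric] ennreal_plus[symmetric] del: ennreal_plus)
      also have "y * e + W * (y powr (1 - r) / (r - 1)) = c * \<mu> powr - s0"
      proof -
        have ye: "y * e = W powr (1 / r) * e powr (1 - 1 / r)"
          unfolding y_def using e W by (simp add: powr_divide powr_diff)
        have "y powr (1 - r) = (W / e) powr (1 / r - 1)"
          unfolding y_def using r by (simp add: powr_powr diff_divide_distrib)
        then have wy: "W * y powr (1 - r) = W powr (1 / r) * e powr (1 - 1 / r)"
          using e W by (simp add: powr_divide powr_diff)
        have ee: "e powr (1 - 1 / r) = A powr (1 - 1 / r) * \<mu> powr - s0"
          unfolding e_def s0_def using A \<mu> by (simp add: powr_mult powr_powr algebra_simps)
        have "z + z / (r - 1) = r / (r - 1) * z" for z using r by (simp add: field_simps)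
        then show ?thesis
          unfolding ye c_def times_divide_eq_right[of W] wy unfolding ee by (simp add: mult.assoc)
      qed
      finally show ?thesis using True c0 by (simp add: ennreal_mult)
    qed simp
  qed
  also have "\<dots> = ennreal c * ennreal (M powr (1 - s0) / (1 - s0))"
    using s0 M by (subst nn_integral_cmult) (auto simp: nn_integral_powr_from_0)
  also have "\<dots> = ennreal (c * (M powr (1 - s0) / (1 - s0)))"
    by (rule ennreal_mult[symmetric]) (use c0 s0 in auto)
  also have "c * (M powr (1 - s0) / (1 - s0)) = r / (r - 1) * (p - 1) * W powr (1 / r) * A powr (1 - 1 / r) * M powr (q - 1)"
    unfolding s0(1) c_def using q1 by simp
  finally show ?thesis .
qed

text \<open>As \<open>k\<close> is even, the form is at most twice its part over f s \<le> f t.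
  There \<open>f t\<close> itself is the truncation height, the inner integral is a multiple of
  f(t)^(q-1), and multiplying by f(t) leaves the q-th power whose integral is bounded by
  \<open>A\<close>.\<close>

proposition weak_young_quadratic:
  fixes k f :: "real \<Rightarrow> real"
  assumes [measurable]: "k \<in> borel_measurable borel" "f \<in> borel_measurable borel"
    and r: "r > 1" and W: "W > 0" and p: "p = 2 * r" and q: "q = p / (p - 1)"
    and even: "\<And>\<tau>. k (- \<tau>) = k \<tau>"
    and weak: "\<And>\<kappa>. \<kappa> > 0 \<Longrightarrow> emeasure lborel {\<tau>. k \<tau> > \<kappa>} \<le> ennreal (W * \<kappa> powr - r)"
    and A: "(\<integral>\<^sup>+s. ennreal (f s powr q) \<partial>lborel) \<le> ennreal A" "A > 0"
    and f: "\<And>s. f s \<ge> 0"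
  shows "(\<integral>\<^sup>+t. \<integral>\<^sup>+s. ennreal (k (t - s)) * (ennreal (f s) * ennreal (f t)) \<partial>lborel \<partial>lborel)
    \<le> ennreal (2 * (r / (r - 1) * (p - 1)) * W powr (1 / r) * A powr (2 / q))"
proof -
  define c where "c = r / (r - 1) * (p - 1) * W powr (1 / r) * A powr (1 - 1 / r)"
  have c0: "c \<ge> 0" unfolding c_def using r p by simp
  let ?h = "\<lambda>t s. ennreal (k (t - s)) * (ennreal (f s) * ennreal (f t)) * indicator {s. f s \<le> f t} s"
  have half: "(\<integral>\<^sup>+t. \<integral>\<^sup>+s. ?h t s \<partial>lborel \<partial>lborel) \<le> ennreal (c * A)"
  proof -
    have "(\<integral>\<^sup>+t. \<integral>\<^sup>+s. ?h t s \<partial>lborel \<partial>lborel) \<le> (\<integral>\<^sup>+t. ennreal c * ennreal (f t powr q) \<partial>lborel)"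
    proof (rule nn_integral_mono)
      fix t
      show "(\<integral>\<^sup>+s. ?h t s \<partial>lborel) \<le> ennreal c * ennreal (f t powr q)"
      proof (cases "f t = 0")
        case False
        then have ft: "f t > 0" using f[of t] by simp
        have "(\<integral>\<^sup>+s. ?h t s \<partial>lborel) =
           (\<integral>\<^sup>+s. ennreal (f t) * (ennreal (k (t - s)) * (ennreal (f s) * indicator {s. f s \<le> f t} s)) \<partial>lborel)"
          by (intro nn_integral_cong) (simp add: ac_simps)
        also have "\<dots> = ennreal (f t) * (\<integral>\<^sup>+s. ennreal (k (t - s)) * (ennreal (f s) * indicator {s. f s \<le> f t} s) \<partial>lborel)"
          by (rule nn_integral_cmult) measurable
        also have "\<dots> \<le> ennreal (f t) * ennreal (c * f t powr (q - 1))"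
          unfolding c_def
          by (intro mult_left_mono nn_integral_weak_truncated[OF _ _ r W p q weak A f ft]) auto
        also have "\<dots> = ennreal (c * f t powr q)"
          using ft c0 by (simp add: powr_diff flip: ennreal_mult)
        finally show ?thesis using c0 by (simp add: ennreal_mult)
      qed simp
    qed
    also have "\<dots> = ennreal c * (\<integral>\<^sup>+s. ennreal (f s powr q) \<partial>lborel)"
      by (rule nn_integral_cmult) measurable
    also have "\<dots> \<le> ennreal c * ennreal A" by (intro mult_left_mono A) auto
    finally show ?thesis using c0 A by (simp add: ennreal_mult)
  qed
  have "(\<integral>\<^sup>+t. \<integral>\<^sup>+s. ennreal (k (t - s)) * (ennreal (f s) * ennreal (f t)) \<partial>lborel \<partial>lborel)
     \<le> (\<integral>\<^sup>+t. \<integral>\<^sup>+s. ?h t s + ?h s t \<partial>lborel \<partial>lborel)"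
  proof (intro nn_integral_mono)
    fix t s
    have "k (s - t) = k (t - s)" using even[of "t - s"] by simp
    then show "ennreal (k (t - s)) * (ennreal (f s) * ennreal (f t)) \<le> ?h t s + ?h s t"
      by (cases "f s \<le> f t") (auto simp: ac_simps)
  qed
  also have "\<dots> = (\<integral>\<^sup>+t. (\<integral>\<^sup>+s. ?h t s \<partial>lborel) + (\<integral>\<^sup>+s. ?h s t \<partial>lborel) \<partial>lborel)"
    by (intro nn_integral_cong nn_integral_add) measurable
  also have "\<dots> = (\<integral>\<^sup>+t. \<integral>\<^sup>+s. ?h t s \<partial>lborel \<partial>lborel) + (\<integral>\<^sup>+t. \<integral>\<^sup>+s. ?h s t \<partial>lborel \<partial>lborel)"
    by (rule nn_integral_add) measurable
  also have "(\<integral>\<^sup>+t. \<integral>\<^sup>+s. ?h s t \<partial>lborel \<partial>lborel) = (\<integral>\<^sup>+t. \<integral>\<^sup>+s. ?h t s \<partial>lborel \<partial>lborel)"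
    by (rule lborel_pair.Fubini') measurable
  also have "(\<integral>\<^sup>+t. \<integral>\<^sup>+s. ?h t s \<partial>lborel \<partial>lborel) + (\<integral>\<^sup>+t. \<integral>\<^sup>+s. ?h t s \<partial>lborel \<partial>lborel)
      \<le> ennreal (c * A) + ennreal (c * A)"
    by (intro add_mono half)
  also have "\<dots> = ennreal (2 * c * A)" using c0 A by (simp flip: ennreal_plus)
  also have "2 * c * A = 2 * (r / (r - 1) * (p - 1)) * W powr (1 / r) * A powr (2 / q)"
  proof -
    have "2 / q = (1 - 1 / r) + 1" unfolding q p using r by (simp add: field_simps)
    then have "A powr (2 / q) = A powr (1 - 1 / r) * A"
      using A by (metis powr_add powr_one less_imp_le)
    then show ?thesis unfolding c_def by simp
  qed
  finally show ?thesis .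
qed

text \<open>A Marcinkiewicz argument: at height \<open>\<lambda>\<close> the input is truncated at the level where the
  \<open>L\<^sup>1\<close> bound controls the large part pointwise by \<open>\<lambda>\<close>; the small part is measured in \<open>L\<^sup>2\<close>.\<close>

proposition L1_L2_interpolation:
  fixes T :: "('a \<Rightarrow> complex) \<Rightarrow> 'a \<Rightarrow> complex" and f :: "'a \<Rightarrow> complex"
  assumes "finite_measure M" and f [measurable]: "f \<in> borel_measurable M"
    and bd: "\<And>x. norm (f x) \<le> B"
    and p: "p > 2" and q: "q = p / (p - 1)" and G: "G > 0" and D: "D \<ge> 0"
    and meas: "\<And>g. \<lbrakk>g \<in> borel_measurable M; \<And>x. norm (g x) \<le> B\<rbrakk> \<Longrightarrow> T g \<in> borel_measurable M"
    and add: "\<And>g h x. \<lbrakk>g \<in> borel_measurable M; h \<in> borel_measurable M;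
      \<And>x. norm (g x) \<le> B; \<And>x. norm (h x) \<le> B\<rbrakk> \<Longrightarrow> T (\<lambda>x. g x + h x) x = T g x + T h x"
    and T1: "\<And>g x. \<lbrakk>g \<in> borel_measurable M; \<And>x. norm (g x) \<le> B\<rbrakk>
      \<Longrightarrow> ennreal (norm (T g x)) \<le> ennreal G * (\<integral>\<^sup>+y. norm (g y) \<partial>M)"
    and T2: "\<And>g. \<lbrakk>g \<in> borel_measurable M; \<And>x. norm (g x) \<le> B\<rbrakk>
      \<Longrightarrow> (\<integral>\<^sup>+x. ennreal ((norm (T g x))\<^sup>2) \<partial>M) \<le> ennreal D * (\<integral>\<^sup>+y. ennreal ((norm (g y))\<^sup>2) \<partial>M)"
    and I: "(\<integral>\<^sup>+y. ennreal (norm (f y) powr q) \<partial>M) = ennreal I" "I \<ge> 0"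
  shows "(\<integral>\<^sup>+x. ennreal (norm (T f x) powr p) \<partial>M)
    \<le> ennreal (2 powr p * D * G powr (p - 2) * I powr (p - 1))"
proof (cases "I = 0")
  case True
  have "AE y in M. ennreal (norm (f y) powr q) = 0"
    using I True by (subst nn_integral_0_iff_AE[symmetric]) auto
  then have "AE y in M. ennreal (norm (f y)) = 0" by eventually_elim simp
  then have "(\<integral>\<^sup>+y. norm (f y) \<partial>M) = 0"
    by (subst nn_integral_0_iff_AE) auto
  then have "T f x = 0" for x using T1[OF f bd, of x] by simp
  then show ?thesis by simp
next
  case False
  have Tf [measurable]: "T f \<in> borel_measurable M" by (rule meas[OF f bd])
  interpret finite_measure M by fact
  interpret pair_sigma_finite lborel M ..
  have I0: "I > 0" using False I by simp
  have q1: "q - 1 = 1 / (p - 1)" using p q by (auto simp: field_simps)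
  have "q - 1 > 0" unfolding q1 using p by simp
  then have q0: "q > 1" by simp
  \<comment> \<open>Solves G I \<gamma>^(1-q) = l. The part of \<open>f\<close> above \<gamma> has
    L^1 norm at most \<gamma>^(1-q) I, so its image is pointwise at most l.\<close>
  define \<gamma> where "\<gamma> l = (G * I / l) powr (p - 1)" for l
  have \<gamma>0: "\<gamma> l > 0" if "l > 0" for l unfolding \<gamma>_def using G I0 that by simp
  have \<gamma>1: "\<gamma> l powr (1 - q) = l / (G * I)" if "l > 0" for l
  proof -
    have "(p - 1) * (q - 1) = 1" using q1 p by simp
    then have e: "(p - 1) * (1 - q) = -1" by (simp add: algebra_simps)
    show ?thesis unfolding \<gamma>_def powr_powr e using G I0 that by (simp add: powr_minus)
  qed
  define lo where "lo l x = (if norm (f x) \<le> \<gamma> l then f x else 0)" for l x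
  define hi where "hi l x = (if norm (f x) \<le> \<gamma> l then 0 else f x)" for l x
  have lo_m [measurable]: "lo l \<in> borel_measurable M" for l unfolding lo_def by measurable
  have hi_m [measurable]: "hi l \<in> borel_measurable M" for l unfolding hi_def by measurable
  have B0: "B \<ge> 0" using bd[of undefined] norm_ge_zero order_trans by blast
  have lo_b: "norm (lo l x) \<le> B" and hi_b: "norm (hi l x) \<le> B" for l x
    using bd[of x] B0 by (auto simp: lo_def hi_def)
  have split: "T f x = T (lo l) x + T (hi l) x" for l x
  proof -
    have "f = (\<lambda>x. lo l x + hi l x)" by (auto simp: lo_def hi_def)
    then show ?thesis using add[OF lo_m hi_m lo_b hi_b, of l l x] by simp
  qed
  have hi_small: "norm (T (hi l) x) \<le> l" if "l > 0" for l x
  proof -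
    have "(\<integral>\<^sup>+y. norm (hi l y) \<partial>M) \<le> (\<integral>\<^sup>+y. ennreal (\<gamma> l powr (1 - q)) * ennreal (norm (f y) powr q) \<partial>M)"
    proof (rule nn_integral_mono)
      fix y
      show "ennreal (norm (hi l y)) \<le> ennreal (\<gamma> l powr (1 - q)) * ennreal (norm (f y) powr q)"
      proof (cases "norm (f y) \<le> \<gamma> l")
        case False
        then have fy: "norm (f y) > 0" using \<gamma>0[OF that] by linarith
        have "norm (f y) = norm (f y) powr (1 - q) * norm (f y) powr q"
          using fy by (simp flip: powr_add)
        also have "\<dots> \<le> \<gamma> l powr (1 - q) * norm (f y) powr q"
          using False \<gamma>0[OF that] q0 by (intro mult_right_mono powr_mono2') auto
        finally show ?thesis using False by (simp add: hi_def flip: ennreal_mult)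
      qed (simp add: hi_def)
    qed
    also have "\<dots> = ennreal (\<gamma> l powr (1 - q)) * ennreal I"
      by (subst nn_integral_cmult) (auto simp: I)
    finally have "ennreal G * (\<integral>\<^sup>+y. norm (hi l y) \<partial>M) \<le> ennreal G * (ennreal (\<gamma> l powr (1 - q)) * ennreal I)"
      by (rule mult_left_mono) simp
    also have "\<dots> = ennreal l"
      unfolding \<gamma>1[OF that] using G I0 that by (simp flip: ennreal_mult)
    finally have "ennreal (norm (T (hi l) x)) \<le> ennreal l"
      by (rule order_trans[OF T1[OF hi_m hi_b]])
    then show ?thesis using that by simp
  qed
  \<comment> \<open>Normalises the layer cake: a^p equals c a^2 times the integral of l^(p-3) over 0
    < l < a/2. Keeping a^2 outside leaves room for the L^2 bound of \<open>T\<close>, and the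
    threshold 2l leaves room for the large part.\<close>
  define c where "c = (p - 2) * 2 powr (p - 2)"
  have c0: "c > 0" unfolding c_def using p by simp
  have height: "ennreal (a powr p) =
      ennreal c * (\<integral>\<^sup>+l. ennreal (l powr (p - 3)) * (indicator {0<..} l * (ennreal (a\<^sup>2) * indicator {l. 2 * l < a} l)) \<partial>lborel)"
    if "a \<ge> 0" for a :: real
  proof -
    have "(\<integral>\<^sup>+l. ennreal (l powr (p - 3)) * (indicator {0<..} l * (ennreal (a\<^sup>2) * indicator {l. 2 * l < a} l)) \<partial>lborel)
        = (\<integral>\<^sup>+l. ennreal (a\<^sup>2) * (ennreal (l powr (p - 3)) * indicator {0<..<a / 2} l) \<partial>lborel)"
      by (intro nn_integral_cong) (auto simp: indicator_def mult.commute)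
    also have "\<dots> = ennreal (a\<^sup>2) * ennreal ((a / 2) powr (p - 2) / (p - 2))"
      using that p by (subst nn_integral_cmult) (auto simp: nn_integral_powr_from_0)
    finally have "ennreal c * (\<integral>\<^sup>+l. ennreal (l powr (p - 3)) * (indicator {0<..} l * (ennreal (a\<^sup>2) * indicator {l. 2 * l < a} l)) \<partial>lborel)
        = ennreal (c * (a\<^sup>2 * ((a / 2) powr (p - 2) / (p - 2))))"
      using c0 by (simp only: ennreal_mult' less_imp_le zero_le_power2)
    also have "c * (a\<^sup>2 * ((a / 2) powr (p - 2) / (p - 2))) = a powr p"
    proof (cases "a = 0")
      case False
      then show ?thesis unfolding c_def using that p by (simp add: powr_divide powr_diff)
    qed simp
    finally show ?thesis by simp
  qed
  have "(\<integral>\<^sup>+x. (\<integral>\<^sup>+l. ennreal (l powr (p - 3)) * (indicator {0<..} l *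
        (ennreal ((norm (T f x))\<^sup>2) * indicator {l. 2 * l < norm (T f x)} l)) \<partial>lborel) \<partial>M) =
     (\<integral>\<^sup>+l. (\<integral>\<^sup>+x. ennreal (l powr (p - 3)) * (indicator {0<..} l *
        (ennreal ((norm (T f x))\<^sup>2) * indicator {l. 2 * l < norm (T f x)} l)) \<partial>M) \<partial>lborel)"
    by (rule Fubini') measurable
  also have "\<dots> \<le> (\<integral>\<^sup>+l. (\<integral>\<^sup>+y. ennreal (4 * D) * (ennreal (l powr (p - 3)) * (indicator {0<..} l * ennreal ((norm (lo l y))\<^sup>2))) \<partial>M) \<partial>lborel)"
  proof (rule nn_integral_mono)
    fix l :: real
    show "(\<integral>\<^sup>+x. ennreal (l powr (p - 3)) * (indicator {0<..} l *
        (ennreal ((norm (T f x))\<^sup>2) * indicator {l. 2 * l < norm (T f x)} l)) \<partial>M)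
      \<le> (\<integral>\<^sup>+y. ennreal (4 * D) * (ennreal (l powr (p - 3)) * (indicator {0<..} l * ennreal ((norm (lo l y))\<^sup>2))) \<partial>M)"
    proof (cases "l > 0")
      case l: True
      have "(\<integral>\<^sup>+x. ennreal (l powr (p - 3)) * (indicator {0<..} l *
          (ennreal ((norm (T f x))\<^sup>2) * indicator {l. 2 * l < norm (T f x)} l)) \<partial>M)
         \<le> (\<integral>\<^sup>+x. ennreal (4 * l powr (p - 3)) * ennreal ((norm (T (lo l) x))\<^sup>2) \<partial>M)"
      proof (rule nn_integral_mono)
        fix x
        show "ennreal (l powr (p - 3)) * (indicator {0<..} l *
          (ennreal ((norm (T f x))\<^sup>2) * indicator {l. 2 * l < norm (T f x)} l))
          \<le> ennreal (4 * l powr (p - 3)) * ennreal ((norm (T (lo l) x))\<^sup>2)"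
        proof (cases "2 * l < norm (T f x)")
          case True
          have "norm (T f x) \<le> norm (T (lo l) x) + norm (T (hi l) x)"
            unfolding split[of x l] by (rule norm_triangle_ineq)
          \<comment> \<open>The large part contributes at most l, which is less than half of
            \<open>norm (T f x)\<close>.\<close>
          then have "norm (T f x) \<le> 2 * norm (T (lo l) x)" using hi_small[OF l, of x] True by linarith
          then have "(norm (T f x))\<^sup>2 \<le> (2 * norm (T (lo l) x))\<^sup>2" by (intro power_mono) auto
          then have "l powr (p - 3) * (norm (T f x))\<^sup>2 \<le> l powr (p - 3) * (4 * (norm (T (lo l) x))\<^sup>2)"
            by (intro mult_left_mono) (auto simp: power_mult_distrib)
          then have "l powr (p - 3) * (norm (T f x))\<^sup>2 \<le> 4 * l powr (p - 3) * (norm (T (lo l) x))\<^sup>2"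
            by (simp add: mult.assoc mult.left_commute)
          then show ?thesis using True l by (simp flip: ennreal_mult add: ennreal_leI)
        qed simp
      qed
      also have "\<dots> = ennreal (4 * l powr (p - 3)) * (\<integral>\<^sup>+x. ennreal ((norm (T (lo l) x))\<^sup>2) \<partial>M)"
      proof (rule nn_integral_cmult)
        have "T (lo l) \<in> borel_measurable M" by (rule meas[OF lo_m lo_b])
        then show "(\<lambda>x. ennreal ((norm (T (lo l) x))\<^sup>2)) \<in> borel_measurable M" by measurable
      qed
      also have "\<dots> \<le> ennreal (4 * l powr (p - 3)) * (ennreal D * (\<integral>\<^sup>+y. ennreal ((norm (lo l y))\<^sup>2) \<partial>M))"
        by (intro mult_left_mono T2[OF lo_m lo_b]) simp
      also have "\<dots> = ennreal (4 * D * l powr (p - 3)) * (\<integral>\<^sup>+y. ennreal ((norm (lo l y))\<^sup>2) \<partial>M)"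
      proof -
        have "ennreal (4 * D * l powr (p - 3)) = ennreal (4 * l powr (p - 3)) * ennreal D"
          by (subst ennreal_mult'[symmetric]) (auto simp: ac_simps)
        then show ?thesis by (simp only: mult.assoc)
      qed
      also have "\<dots> = (\<integral>\<^sup>+y. ennreal (4 * D * l powr (p - 3)) * ennreal ((norm (lo l y))\<^sup>2) \<partial>M)"
        by (rule nn_integral_cmult[symmetric]) measurable
      also have "\<dots> = (\<integral>\<^sup>+y. ennreal (4 * D) * (ennreal (l powr (p - 3)) * (indicator {0<..} l * ennreal ((norm (lo l y))\<^sup>2))) \<partial>M)"
        using l D by (intro nn_integral_cong) (simp add: ennreal_mult mult.assoc)
      finally show ?thesis .
    qed simp
  qed
  also have "\<dots> = (\<integral>\<^sup>+y. (\<integral>\<^sup>+l. ennreal (4 * D) * (ennreal (l powr (p - 3)) * (indicator {0<..} l * ennreal ((norm (lo l y))\<^sup>2))) \<partial>lborel) \<partial>M)"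
    unfolding lo_def \<gamma>_def by (rule Fubini'[symmetric]) measurable
  also have "\<dots> \<le> (\<integral>\<^sup>+y. ennreal (4 * D * ((G * I) powr (p - 2) / (p - 2))) * ennreal (norm (f y) powr q) \<partial>M)"
  proof (rule nn_integral_mono)
    fix y
    let ?a = "norm (f y)"
    show "(\<integral>\<^sup>+l. ennreal (4 * D) * (ennreal (l powr (p - 3)) * (indicator {0<..} l * ennreal ((norm (lo l y))\<^sup>2))) \<partial>lborel)
       \<le> ennreal (4 * D * ((G * I) powr (p - 2) / (p - 2))) * ennreal (?a powr q)"
    proof (cases "f y = 0")
      case True
      then have "lo l y = 0" for l by (simp add: lo_def)
      then show ?thesis by simp
    next
      case False
      then have a: "?a > 0" by simp
      \<comment> \<open>The height at which the decreasing level \<gamma> falls to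
        \<open>?a\<close>; beyond it the value of \<open>f\<close> at this point belongs to the
        large part.\<close>
      define m where "m = G * I * ?a powr - (1 / (p - 1))"
      have m0: "m > 0" unfolding m_def using G I0 a by simp
      have lem: "l \<le> m" if "l > 0" "?a \<le> \<gamma> l" for l
      proof -
        have "?a powr (1 / (p - 1)) \<le> \<gamma> l powr (1 / (p - 1))"
          using that p by (intro powr_mono2) auto
        also have "\<dots> = G * I / l"
          unfolding \<gamma>_def using G I0 that p by (simp add: powr_powr)
        finally have "l \<le> G * I / ?a powr (1 / (p - 1))"
          using that a by (simp add: field_simps)
        then show ?thesis unfolding m_def powr_minus by (simp add: divide_inverse)
      qed
      \<comment> \<open>\<open>lem\<close> yields only l \<le> m, whereas the integral formula is
        for an open interval.\<close>
      have null: "AE l in lborel. l \<noteq> m" by (rule AE_lborel_singleton)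
      have "(\<integral>\<^sup>+l. ennreal (4 * D) * (ennreal (l powr (p - 3)) * (indicator {0<..} l * ennreal ((norm (lo l y))\<^sup>2))) \<partial>lborel)
         \<le> (\<integral>\<^sup>+l. ennreal (4 * D * ?a\<^sup>2) * (ennreal (l powr (p - 3)) * indicator {0<..<m} l) \<partial>lborel)"
      proof (rule nn_integral_mono_AE)
        show "AE l in lborel. ennreal (4 * D) * (ennreal (l powr (p - 3)) * (indicator {0<..} l * ennreal ((norm (lo l y))\<^sup>2)))
          \<le> ennreal (4 * D * ?a\<^sup>2) * (ennreal (l powr (p - 3)) * indicator {0<..<m} l)"
          using null
        proof eventually_elim
          case (elim l)
          show ?case
          proof (cases "l > 0 \<and> ?a \<le> \<gamma> l")
            case True
            then have "l < m" using lem[of l] elim by simp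
            moreover have eq: "ennreal (4 * D * ?a\<^sup>2) = ennreal (4 * D) * ennreal (?a\<^sup>2)"
              using D by (intro ennreal_mult') simp
            ultimately show ?thesis using True unfolding eq by (simp add: lo_def ac_simps)
          qed (auto simp: lo_def)
        qed
      qed
      also have "\<dots> = ennreal (4 * D * ?a\<^sup>2) * ennreal (m powr (p - 2) / (p - 2))"
        using m0 p by (subst nn_integral_cmult) (auto simp: nn_integral_powr_from_0)
      also have "\<dots> = ennreal (4 * D * ?a\<^sup>2 * (m powr (p - 2) / (p - 2)))"
        by (rule ennreal_mult[symmetric]) (use D p in auto)
      also have "4 * D * ?a\<^sup>2 * (m powr (p - 2) / (p - 2)) = 4 * D * ((G * I) powr (p - 2) / (p - 2)) * ?a powr q"
      proof -
        have "?a\<^sup>2 * m powr (p - 2) = (G * I) powr (p - 2) * ?a powr (2 + - (1 / (p - 1)) * (p - 2))"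
          unfolding m_def powr_add using a G I0 by (simp add: powr_mult powr_powr)
        also have "2 + - (1 / (p - 1)) * (p - 2) = q" using p unfolding q by (simp add: field_simps)
        finally have e: "?a\<^sup>2 * m powr (p - 2) = (G * I) powr (p - 2) * ?a powr q" .
        have "4 * D * ?a\<^sup>2 * (m powr (p - 2) / (p - 2)) = 4 * D / (p - 2) * (?a\<^sup>2 * m powr (p - 2))" by simp
        also have "\<dots> = 4 * D * ((G * I) powr (p - 2) / (p - 2)) * ?a powr q" unfolding e by simp
        finally show ?thesis .
      qed
      finally show ?thesis by (subst ennreal_mult'[symmetric]) (use D p in auto)
    qed
  qed
  also have "\<dots> = ennreal (4 * D * ((G * I) powr (p - 2) / (p - 2))) * ennreal I"
    by (subst nn_integral_cmult) (auto simp: I)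
  finally have main: "(\<integral>\<^sup>+x. (\<integral>\<^sup>+l. ennreal (l powr (p - 3)) * (indicator {0<..} l *
        (ennreal ((norm (T f x))\<^sup>2) * indicator {l. 2 * l < norm (T f x)} l)) \<partial>lborel) \<partial>M)
      \<le> ennreal (4 * D * ((G * I) powr (p - 2) / (p - 2))) * ennreal I" .
  have "(\<integral>\<^sup>+x. ennreal (norm (T f x) powr p) \<partial>M) =
    (\<integral>\<^sup>+x. ennreal c * (\<integral>\<^sup>+l. ennreal (l powr (p - 3)) * (indicator {0<..} l *
        (ennreal ((norm (T f x))\<^sup>2) * indicator {l. 2 * l < norm (T f x)} l)) \<partial>lborel) \<partial>M)"
    by (intro nn_integral_cong height) simp
  also have "\<dots> = ennreal c * (\<integral>\<^sup>+x. (\<integral>\<^sup>+l. ennreal (l powr (p - 3)) * (indicator {0<..} l *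
        (ennreal ((norm (T f x))\<^sup>2) * indicator {l. 2 * l < norm (T f x)} l)) \<partial>lborel) \<partial>M)"
    by (rule nn_integral_cmult) measurable
  also have "\<dots> \<le> ennreal c * (ennreal (4 * D * ((G * I) powr (p - 2) / (p - 2))) * ennreal I)"
    by (intro mult_left_mono main) simp
  also have "\<dots> = ennreal (c * (4 * D * ((G * I) powr (p - 2) / (p - 2)) * I))"
  proof -
    have "0 \<le> 4 * D * ((G * I) powr (p - 2) / (p - 2))" using D p by simp
    then show ?thesis using c0 by (simp only: ennreal_mult' less_imp_le)
  qed
  also have "c * (4 * D * ((G * I) powr (p - 2) / (p - 2)) * I) = 2 powr p * D * G powr (p - 2) * I powr (p - 1)"
  proof -
    have 1: "2 powr p = 4 * (2::real) powr (p - 2)" by (simp add: powr_diff)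
    have 2: "I powr (p - 1) = I powr (p - 2) * I"
      using I0 by (simp add: powr_diff power2_eq_square)
    have 3: "(G * I) powr (p - 2) = G powr (p - 2) * I powr (p - 2)" using G I0 by (simp add: powr_mult)
    show ?thesis unfolding c_def 1 2 3 using p by simp
  qed
  finally show ?thesis .
qed

section \<open>Fourier series on the torus\<close>

abbreviation circle :: "real measure" where
  "circle \<equiv> restrict_space lborel {0..<2 * pi}"

lemma emeasure_circle: "emeasure circle (space circle) = ennreal (2 * pi)"
  by (simp add: emeasure_restrict_space space_restrict_space)

lemma finite_measure_circle: "finite_measure circle"
  by (rule finite_measureI) (simp only: emeasure_circle, simp)

interpretation circle: finite_measure circle
  by (rule finite_measure_circle)

interpretation circles: product_sigma_finite "\<lambda>_::nat. circle"
  by (simp add: product_sigma_finite_def circle.sigma_finite_measure_axioms)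

lemma finite_measure_torus: "finite_measure (torus d)"
proof (rule finite_measureI)
  have "space (torus d) = Pi\<^sub>E {1..d} (\<lambda>_. space circle)"
    by (simp add: torus_def space_PiM)
  then have "emeasure (torus d) (space (torus d)) = (\<Prod>i\<in>{1..d}. emeasure circle (space circle))"
    by (simp only: torus_def) (rule circles.emeasure_PiM, simp, rule sets.top)
  also have "\<dots> \<noteq> \<infinity>"
    unfolding emeasure_circle by (simp add: ennreal_power)
  finally show "emeasure (torus d) (space (torus d)) \<noteq> \<infinity>" .
qed

interpretation torus: finite_measure "torus d" for d
  by (rule finite_measure_torus)

lemma character_eq_prod: "character d k x = (\<Prod>j\<in>{1..d}. cis (of_int (k j) * x j))"
proof -
  have "(\<Prod>j\<in>A. cis (of_int (k j) * x j)) = cis (\<Sum>j\<in>A. of_int (k j) * x j)" if "finite A" for A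
    using that by (induction A) (auto simp: cis_mult)
  then show ?thesis by (simp add: character_def cis_conv_exp)
qed

lemma norm_character [simp]: "norm (character d k x) = 1"
  by (simp add: character_def norm_exp_i_times)

lemma measurable_coordinate: "j \<in> {1..d} \<Longrightarrow> (\<lambda>x. x j) \<in> borel_measurable (torus d)"
proof -
  assume j: "j \<in> {1..d}"
  have 1: "(\<lambda>x. x j) \<in> measurable (torus d) circle"
    unfolding torus_def by (rule measurable_component_singleton[OF j])
  have 2: "(\<lambda>x. x) \<in> measurable circle borel"
    by (rule measurable_restrict_space1) simp
  show ?thesis using measurable_compose[OF 1 2] .
qed

lemma borel_measurable_character [measurable]: "character d k \<in> borel_measurable (torus d)"
proof -
  have [measurable]: "(\<lambda>x. \<Sum>j\<in>{1..d}. real_of_int (k j) * x j) \<in> borel_measurable (torus d)"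
    by (intro borel_measurable_sum borel_measurable_times borel_measurable_const measurable_coordinate)
  show ?thesis unfolding character_def by measurable
qed

lemma borel_measurable_cnj [measurable (raw)]:
  "f \<in> borel_measurable M \<Longrightarrow> (\<lambda>x. cnj (f x)) \<in> borel_measurable M"
  by (rule borel_measurable_continuous_on[OF continuous_on_cnj[OF continuous_on_id]])

lemma integral_circle_cis:
  "(LINT x|circle. cis (of_int n * x)) = (if n = 0 then of_real (2 * pi) else 0)"
proof -
  have "(LINT x|circle. cis (of_int n * x)) = (LINT x|lborel. indicator {0..<2 * pi} x *\<^sub>R cis (of_int n * x))"
    by (rule integral_restrict_space) simp
  also have "\<dots> = (LINT x|lborel. indicator {0..2 * pi} x *\<^sub>R cis (of_int n * x))"
  proof (rule integral_cong_AE)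
    show "AE x in lborel. indicator {0..<2 * pi} x *\<^sub>R cis (of_int n * x) = indicator {0..2 * pi} x *\<^sub>R cis (of_int n * x)"
      using AE_lborel_singleton[of "2 * pi"] by eventually_elim (auto simp: indicator_def)
  qed (auto simp: cis_conv_exp)
  also have "\<dots> = (if n = 0 then of_real (2 * pi) else 0)"
  proof (cases "n = 0")
    case True
    then show ?thesis by (simp add: measure_lborel_Icc scaleR_conv_of_real)
  next
    case False
    let ?F = "\<lambda>x. cis (of_int n * x) / (\<i> * of_int n)"
    have "(LINT x|lborel. indicator {0..2 * pi} x *\<^sub>R cis (of_int n * x)) = ?F (2 * pi) - ?F 0"
    proof (rule integral_FTC_atLeastAtMost)
      fix x :: real
      have "((\<lambda>x. exp (\<i> * of_real (of_int n * x)) / (\<i> * of_int n)) has_vector_derivative exp (\<i> * of_real (of_int n * x))) (at x within {0..2 * pi})"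
        using False by (auto intro!: derivative_eq_intros has_vector_derivative_real_field simp: field_simps)
      then show "(?F has_vector_derivative cis (of_int n * x)) (at x within {0..2 * pi})"
        by (simp add: cis_conv_exp)
    qed (auto simp: cis_conv_exp intro!: continuous_intros)
    also have "\<dots> = 0"
    proof -
      have "cis (of_int n * (2 * pi)) = 1"
        by (simp add: complex_eq_iff cos_int_2pin sin_int_2pin mult.commute[of _ "2 * pi"])
      then show ?thesis by simp
    qed
    finally show ?thesis using False by simp
  qed
  finally show ?thesis .
qed

lemma integral_character_cnj:
  assumes "k \<in> lattice d" "l \<in> lattice d"
  shows "(LINT x|torus d. character d k x * cnj (character d l x)) = (if k = l then of_real ((2 * pi) ^ d) else 0)"
proof -
  have "(LINT x|torus d. character d k x * cnj (character d l x)) =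
     (LINT x|torus d. (\<Prod>j\<in>{1..d}. cis (of_int (k j - l j) * x j)))"
    by (simp add: character_eq_prod cis_cnj cis_mult prod.distrib[symmetric] algebra_simps)
  also have "\<dots> = (\<Prod>j\<in>{1..d}. LINT x|circle. cis (of_int (k j - l j) * x))"
    unfolding torus_def
  proof (rule circles.product_integral_prod)
    fix j assume "j \<in> {1..d}"
    show "integrable circle (\<lambda>x. cis (of_int (k j - l j) * x))"
      by (rule circle.integrable_const_bound[of _ 1]) (auto simp: cis_conv_exp measurable_restrict_space1)
  qed simp
  also have "\<dots> = (\<Prod>j\<in>{1..d}. if k j = l j then of_real (2 * pi) else 0)"
    unfolding integral_circle_cis by (intro prod.cong) auto
  also have "\<dots> = (if k = l then of_real ((2 * pi) ^ d) else 0)"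
  proof (cases "k = l")
    case False
    then obtain j where "j \<in> {1..d}" "k j \<noteq> l j"
      using PiE_ext[OF assms[unfolded lattice_def]] by blast
    then show ?thesis using False by (auto intro!: prod_zero)
  qed simp
  finally show ?thesis .
qed

section \<open>Trigonometric polynomials and Bessel's inequality\<close>

definition trig_poly :: "nat \<Rightarrow> (nat \<Rightarrow> int) set \<Rightarrow> ((nat \<Rightarrow> int) \<Rightarrow> complex) \<Rightarrow> (nat \<Rightarrow> real) \<Rightarrow> complex" where
  "trig_poly d S c x = (\<Sum>k\<in>S. c k * character d k x)"

lemma borel_measurable_trig_poly [measurable]: "trig_poly d S c \<in> borel_measurable (torus d)"
  unfolding trig_poly_def by measurable

lemma norm_trig_poly_le: "norm (trig_poly d S c x) \<le> (\<Sum>k\<in>S. norm (c k))"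
  unfolding trig_poly_def by (rule order_trans[OF norm_sum]) (simp add: norm_mult)

lemma integrable_mult_bounded:
  fixes f g :: "'a \<Rightarrow> complex"
  assumes "integrable M f" and [measurable]: "g \<in> borel_measurable M" and b: "\<And>x. norm (g x) \<le> b"
  shows "integrable M (\<lambda>x. f x * g x)"
proof (rule Bochner_Integration.integrable_bound)
  show "integrable M (\<lambda>x. b * norm (f x))" using assms(1) by simp
  have [measurable]: "f \<in> borel_measurable M" using assms(1) by simp
  show "(\<lambda>x. f x * g x) \<in> borel_measurable M" by measurable
  show "AE x in M. norm (f x * g x) \<le> norm (b * norm (f x))"
  proof (rule AE_I2)
    fix x
    have "norm (f x) * norm (g x) \<le> norm (f x) * b" by (intro mult_left_mono b) auto
    then show "norm (f x * g x) \<le> norm (b * norm (f x))"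
      by (simp add: norm_mult mult.commute abs_mult order_trans[OF _ mult_right_mono[OF abs_ge_self]])
  qed
qed

lemma integrable_trig_poly: "integrable (torus d) (trig_poly d S c)"
  by (rule torus.integrable_const_bound[of _ "\<Sum>k\<in>S. norm (c k)"]) (auto intro: norm_trig_poly_le)

text \<open>Taking \<open>f\<close> to be the polynomial itself gives Parseval, and taking
  \<open>c\<close> to be the coefficients of \<open>f\<close> gives the cross term in Bessel's
  inequality. The factor is the total mass of the unnormalised measure.\<close>

lemma integral_mult_cnj_trig_poly:
  assumes "integrable (torus d) f"
  shows "(LINT x|torus d. f x * cnj (trig_poly d S c x)) =
    of_real ((2 * pi) ^ d) * (\<Sum>k\<in>S. cnj (c k) * fourier_coeff d f k)"
proof -
  have i: "integrable (torus d) (\<lambda>x. f x * cnj (character d k x))" for k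
    by (rule integrable_mult_bounded[OF assms, of _ 1]) auto
  have "(LINT x|torus d. f x * cnj (trig_poly d S c x)) =
     (LINT x|torus d. (\<Sum>k\<in>S. cnj (c k) * (f x * cnj (character d k x))))"
    unfolding trig_poly_def by (simp add: sum_distrib_left ac_simps)
  also have "\<dots> = (\<Sum>k\<in>S. cnj (c k) * (LINT x|torus d. f x * cnj (character d k x)))"
    by (subst Bochner_Integration.integral_sum) (auto intro: i)
  also have "\<dots> = of_real ((2 * pi) ^ d) * (\<Sum>k\<in>S. cnj (c k) * fourier_coeff d f k)"
    unfolding fourier_coeff_def by (simp add: sum_distrib_left field_simps)
  finally show ?thesis .
qed

lemma fourier_coeff_trig_poly:
  assumes "finite S" "S \<subseteq> lattice d" "k \<in> lattice d"
  shows "fourier_coeff d (trig_poly d S c) k = (if k \<in> S then c k else 0)"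
proof -
  have i: "integrable (torus d) (\<lambda>x. c l * (character d l x * cnj (character d k x)))" for l
    by (rule torus.integrable_const_bound[of _ "norm (c l)"]) (auto simp: norm_mult)
  have "(LINT x|torus d. trig_poly d S c x * cnj (character d k x)) =
      (LINT x|torus d. (\<Sum>l\<in>S. c l * (character d l x * cnj (character d k x))))"
    unfolding trig_poly_def by (simp add: sum_distrib_right mult.assoc)
  also have "\<dots> = (\<Sum>l\<in>S. c l * (LINT x|torus d. character d l x * cnj (character d k x)))"
    by (subst Bochner_Integration.integral_sum) (auto intro: i)
  also have "\<dots> = (\<Sum>l\<in>S. if l = k then c k * of_real ((2 * pi) ^ d) else 0)"
    by (intro sum.cong refl) (use assms in \<open>auto simp: integral_character_cnj subset_eq\<close>)
  also have "\<dots> = (if k \<in> S then c k * of_real ((2 * pi) ^ d) else 0)"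
    using assms(1) by simp
  finally show ?thesis unfolding fourier_coeff_def by simp
qed

lemma integral_norm_trig_poly_sq:
  assumes "finite S" "S \<subseteq> lattice d"
  shows "(LINT x|torus d. (norm (trig_poly d S c x))\<^sup>2) = (2 * pi) ^ d * (\<Sum>k\<in>S. (norm (c k))\<^sup>2)"
proof -
  have "complex_of_real (LINT x|torus d. (norm (trig_poly d S c x))\<^sup>2) =
     (LINT x|torus d. complex_of_real ((norm (trig_poly d S c x))\<^sup>2))"
    by (rule integral_complex_of_real[symmetric])
  also have "\<dots> = (LINT x|torus d. trig_poly d S c x * cnj (trig_poly d S c x))"
    by (simp only: complex_norm_square)
  also have "\<dots> = of_real ((2 * pi) ^ d) * (\<Sum>k\<in>S. cnj (c k) * fourier_coeff d (trig_poly d S c) k)"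
    by (rule integral_mult_cnj_trig_poly[OF integrable_trig_poly])
  also have "(\<Sum>k\<in>S. cnj (c k) * fourier_coeff d (trig_poly d S c) k) = (\<Sum>k\<in>S. of_real ((norm (c k))\<^sup>2))"
  proof (intro sum.cong refl)
    fix k assume "k \<in> S"
    then show "cnj (c k) * fourier_coeff d (trig_poly d S c) k = of_real ((norm (c k))\<^sup>2)"
      using assms fourier_coeff_trig_poly[OF assms, of k c] complex_norm_square[of "c k"]
      by (auto simp: mult.commute)
  qed
  also have "of_real ((2 * pi) ^ d) * (\<Sum>k\<in>S. of_real ((norm (c k))\<^sup>2)) =
     complex_of_real ((2 * pi) ^ d * (\<Sum>k\<in>S. (norm (c k))\<^sup>2))" by simp
  finally show ?thesis by (simp only: of_real_eq_iff)
qed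

lemma integrable_of_integrable_norm_sq:
  fixes f :: "'a \<Rightarrow> complex"
  assumes "finite_measure M" and [measurable]: "f \<in> borel_measurable M" and "integrable M (\<lambda>x. (norm (f x))\<^sup>2)"
  shows "integrable M f"
proof (rule Bochner_Integration.integrable_bound)
  interpret finite_measure M by fact
  show "integrable M (\<lambda>x. 1 + (norm (f x))\<^sup>2)" using assms(3) by simp
  show "AE x in M. norm (f x) \<le> norm (1 + (norm (f x))\<^sup>2)"
  proof (rule AE_I2)
    fix x
    have "0 \<le> (norm (f x) - 1)\<^sup>2" by simp
    then have "2 * norm (f x) \<le> 1 + (norm (f x))\<^sup>2" by (simp add: power2_diff)
    then have "norm (f x) \<le> 1 + (norm (f x))\<^sup>2" using norm_ge_zero[of "f x"] by linarith
    then show "norm (f x) \<le> norm (1 + (norm (f x))\<^sup>2)" by simp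
  qed
qed fact

lemma bessel_inequality:
  assumes [measurable]: "f \<in> borel_measurable (torus d)" and f2: "integrable (torus d) (\<lambda>x. (norm (f x))\<^sup>2)"
    and S: "finite S" "S \<subseteq> lattice d"
  shows "(2 * pi) ^ d * (\<Sum>k\<in>S. (norm (fourier_coeff d f k))\<^sup>2) \<le> (LINT x|torus d. (norm (f x))\<^sup>2)"
proof -
  have f1: "integrable (torus d) f"
    by (rule integrable_of_integrable_norm_sq[OF finite_measure_torus _ f2]) measurable
  define s where "s = trig_poly d S (fourier_coeff d f)"
  let ?b = "\<Sum>k\<in>S. (norm (fourier_coeff d f k))\<^sup>2"
  have s_m [measurable]: "s \<in> borel_measurable (torus d)" unfolding s_def by measurable
  have s_b: "norm (s x) \<le> (\<Sum>k\<in>S. norm (fourier_coeff d f k))" for x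
    unfolding s_def by (rule norm_trig_poly_le)
  have fs: "integrable (torus d) (\<lambda>x. f x * cnj (s x))"
    by (rule integrable_mult_bounded[OF f1]) (use s_b in auto)
  have s2: "integrable (torus d) (\<lambda>x. (norm (s x))\<^sup>2)"
    by (rule torus.integrable_const_bound[of _ "(\<Sum>k\<in>S. norm (fourier_coeff d f k))\<^sup>2"])
      (use s_b in \<open>auto intro!: power_mono\<close>)
  have "(LINT x|torus d. f x * cnj (s x)) = of_real ((2 * pi) ^ d * ?b)"
    unfolding s_def integral_mult_cnj_trig_poly[OF f1]
    by (simp only: of_real_mult of_real_sum complex_norm_square mult.commute[of "cnj (fourier_coeff d f _)"])
  then have re: "(LINT x|torus d. Re (f x * cnj (s x))) = (2 * pi) ^ d * ?b"
    using integral_Re[OF fs] by simp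
  have "0 \<le> (LINT x|torus d. (norm (f x - s x))\<^sup>2)" by simp
  also have "\<dots> = (LINT x|torus d. ((norm (f x))\<^sup>2 - 2 * Re (f x * cnj (s x))) + (norm (s x))\<^sup>2)"
  proof (intro Bochner_Integration.integral_cong refl)
    fix x
    show "(norm (f x - s x))\<^sup>2 = ((norm (f x))\<^sup>2 - 2 * Re (f x * cnj (s x))) + (norm (s x))\<^sup>2"
      unfolding cmod_power2 by (simp add: power2_eq_square algebra_simps)
  qed
  also have "\<dots> = (LINT x|torus d. (norm (f x))\<^sup>2) - 2 * ((2 * pi) ^ d * ?b) + (2 * pi) ^ d * ?b"
  proof -
    have "(LINT x|torus d. (norm (s x))\<^sup>2) = (2 * pi) ^ d * ?b"
      unfolding s_def by (rule integral_norm_trig_poly_sq[OF S])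
    moreover have r: "integrable (torus d) (\<lambda>x. 2 * Re (f x * cnj (s x)))"
      by (intro integrable_mult_right integrable_Re fs)
    moreover have "(LINT x|torus d. ((norm (f x))\<^sup>2 - 2 * Re (f x * cnj (s x))) + (norm (s x))\<^sup>2) =
        (LINT x|torus d. (norm (f x))\<^sup>2 - 2 * Re (f x * cnj (s x))) + (LINT x|torus d. (norm (s x))\<^sup>2)"
      by (intro Bochner_Integration.integral_add Bochner_Integration.integrable_diff f2 r s2)
    moreover have "(LINT x|torus d. (norm (f x))\<^sup>2 - 2 * Re (f x * cnj (s x))) =
        (LINT x|torus d. (norm (f x))\<^sup>2) - (LINT x|torus d. 2 * Re (f x * cnj (s x)))"
      by (intro Bochner_Integration.integral_diff f2 r)
    ultimately show ?thesis by (simp only: integral_mult_right_zero re)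
  qed
  finally show ?thesis by linarith
qed

section \<open>Riesz-Fischer and the coefficients of the propagator\<close>

lemma countable_lattice: "countable (lattice d)"
  unfolding lattice_def by (intro countable_PiE) auto

text \<open>Makes the enumeration of the lattice by the natural numbers a bijection. Constant
  vectors suffice; for d = 0 the lattice is a singleton.\<close>

lemma infinite_lattice:
  assumes "d \<ge> 1"
  shows "infinite (lattice d)"
proof
  assume fin: "finite (lattice d)"
  let ?e = "\<lambda>n::int. \<lambda>j\<in>{1..d}. n"
  have "range ?e \<subseteq> lattice d" unfolding lattice_def by auto
  moreover have "inj ?e"
  proof (rule injI)
    fix m n assume "?e m = ?e n"
    then have "?e m 1 = ?e n 1" by simp
    then show "m = n" using assms by simp
  qed
  ultimately have "finite (UNIV :: int set)"
    using fin finite_subset finite_imageD by blast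
  then show False by simp
qed

text \<open>Rate 1/4 for squared norms is rate 1/2 for norms, so blocks chosen this way sum
  absolutely. Block 0 is no small tail: the summand \<open>suminf a\<close> of \<open>K\<close>
  covers it, and the + 1 keeps \<open>K\<close> positive.\<close>

lemma summable_geometric_blocks:
  fixes a :: "nat \<Rightarrow> real"
  assumes "summable a" "\<And>i. a i \<ge> 0"
  obtains m :: "nat \<Rightarrow> nat" and K where "strict_mono m" "m 0 = 0" "K \<ge> 0"
    "\<And>n. (\<Sum>i\<in>{m n..<m (Suc n)}. a i) \<le> K * (1 / 4) ^ n"
proof -
  define K where "K = suminf a + 1"
  have K: "K > 0" unfolding K_def using suminf_nonneg[OF assms] by linarith
  have tail: "\<exists>N. \<forall>j\<ge>N. \<forall>l. (\<Sum>i\<in>{j..<l}. a i) < e" if e: "e > 0" for e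
  proof -
    obtain N where N: "\<forall>j\<ge>N. \<forall>l. norm (sum a {j..<l}) < e"
      using assms(1) e unfolding summable_Cauchy by blast
    then show ?thesis using abs_ge_self le_less_trans by (metis real_norm_def)
  qed
  have step: "\<exists>y>x. \<forall>l. (\<Sum>i\<in>{y..<l}. a i) \<le> K * (1 / 4) ^ Suc n" for x n
  proof -
    obtain N where "\<forall>j\<ge>N. \<forall>l. (\<Sum>i\<in>{j..<l}. a i) < K * (1 / 4) ^ Suc n"
      using tail[of "K * (1 / 4) ^ Suc n"] K by auto
    then show ?thesis by (intro exI[of _ "max N (Suc x)"]) (auto intro: less_imp_le)
  qed
  define m where "m = rec_nat (0::nat) (\<lambda>n x. SOME y. y > x \<and> (\<forall>l. (\<Sum>i\<in>{y..<l}. a i) \<le> K * (1 / 4) ^ Suc n))"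
  have m: "m (Suc n) > m n \<and> (\<forall>l. (\<Sum>i\<in>{m (Suc n)..<l}. a i) \<le> K * (1 / 4) ^ Suc n)" for n
  proof -
    have "m (Suc n) = (SOME y. y > m n \<and> (\<forall>l. (\<Sum>i\<in>{y..<l}. a i) \<le> K * (1 / 4) ^ Suc n))"
      unfolding m_def by simp
    then show ?thesis using someI_ex[OF step[of "m n" n]] by simp
  qed
  show thesis
  proof (rule that[of m K])
    show "strict_mono m" using m by (simp add: strict_mono_Suc_iff)
    show "m 0 = 0" by (simp add: m_def)
    show "K \<ge> 0" using K by simp
    fix n
    show "(\<Sum>i\<in>{m n..<m (Suc n)}. a i) \<le> K * (1 / 4) ^ n"
    proof (cases n)
      case 0
      have "(\<Sum>i\<in>{m 0..<m (Suc 0)}. a i) \<le> suminf a"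
        by (rule sum_le_suminf[OF assms(1)]) (use assms in auto)
      then show ?thesis using 0 by (simp add: K_def)
    qed (use m in auto)
  qed
qed

text \<open>Riesz-Fischer: the series is summed in blocks whose \<open>L\<^sup>2\<close> norms decay geometrically, so it
  converges almost everywhere and in \<open>L\<^sup>1\<close>, and Fatou's lemma puts the limit in \<open>L\<^sup>2\<close>.\<close>

lemma riesz_fischer:
  assumes d: "d \<ge> 1"
    and bd: "\<And>S. finite S \<Longrightarrow> S \<subseteq> lattice d \<Longrightarrow> (\<Sum>k\<in>S. (norm (c k))\<^sup>2) \<le> B"
  obtains g where "g \<in> Lp_space 2 (torus d)" "\<And>k. k \<in> lattice d \<Longrightarrow> fourier_coeff d g k = c k"
proof -
  define e where "e = from_nat_into (lattice d)"
  have e: "bij_betw e UNIV (lattice d)"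
    unfolding e_def by (rule bij_betw_from_nat_into[OF countable_lattice infinite_lattice[OF d]])
  then have e_inj: "inj e" and e_lat: "e i \<in> lattice d" for i
    by (auto simp: bij_betw_def)
  define a where "a i = (norm (c (e i)))\<^sup>2" for i
  have a0: "a i \<ge> 0" for i by (simp add: a_def)
  have "summable a"
  proof (rule summableI_nonneg_bounded[OF a0])
    fix n
    have "(\<Sum>i<n. a i) = (\<Sum>k\<in>e ` {..<n}. (norm (c k))\<^sup>2)"
      unfolding a_def by (subst sum.reindex) (auto intro: inj_on_subset[OF e_inj])
    also have "\<dots> \<le> B" by (rule bd) (use e_lat in auto)
    finally show "(\<Sum>i<n. a i) \<le> B" .
  qed
  then obtain m K where m: "strict_mono m" "m 0 = 0" and K: "K \<ge> 0"
    and blocks: "\<And>n. (\<Sum>i\<in>{m n..<m (Suc n)}. a i) \<le> K * (1 / 4) ^ n"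
    using summable_geometric_blocks[of a] a0 by blast
  have sum_e: "(\<Sum>k\<in>e ` A. (norm (c k))\<^sup>2) = (\<Sum>i\<in>A. a i)" for A
    unfolding a_def by (subst sum.reindex) (auto intro: inj_on_subset[OF e_inj])
  define F where "F n = trig_poly d (e ` {m n..<m (Suc n)}) c" for n
  have F_m [measurable]: "F n \<in> borel_measurable (torus d)" for n unfolding F_def by measurable
  define P where "P = (2 * pi) ^ d"
  have P: "P > 0" unfolding P_def by simp
  have F2: "(LINT x|torus d. (norm (F n x))\<^sup>2) \<le> P * (K * (1 / 4) ^ n)" for n
  proof -
    have "(LINT x|torus d. (norm (F n x))\<^sup>2) = P * (\<Sum>i\<in>{m n..<m (Suc n)}. a i)"
      unfolding F_def P_def sum_e[symmetric] by (rule integral_norm_trig_poly_sq) (use e_lat in auto)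
    then show ?thesis using blocks[of n] P by simp
  qed
  have F2i: "integrable (torus d) (\<lambda>x. (norm (F n x))\<^sup>2)" for n
    unfolding F_def
    by (rule torus.integrable_const_bound[of _ "(\<Sum>k\<in>e ` {m n..<m (Suc n)}. norm (c k))\<^sup>2"])
      (auto intro!: power_mono norm_trig_poly_le)
  have Fi: "integrable (torus d) (F n)" for n
    unfolding F_def by (rule integrable_trig_poly)
  define V where "V = measure (torus d) (space (torus d))"
  \<comment> \<open>The inequality y \<le> 2^-n + 2^n y^2 plays the part of Cauchy-Schwarz: 2^n
    times the rate 4^-n is again 2^-n.\<close>
  have F1: "(LINT x|torus d. norm (F n x)) \<le> (V + P * K) * (1 / 2) ^ n" for n
  proof -
    have "(LINT x|torus d. norm (F n x)) \<le> (LINT x|torus d. (1 / 2) ^ n + 2 ^ n * (norm (F n x))\<^sup>2)"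
    proof (rule integral_mono)
      fix x
      have "0 \<le> ((1::real) - 2 ^ n * norm (F n x))\<^sup>2" by simp
      then have "2 * (2 ^ n * norm (F n x)) \<le> 1 + (2 ^ n * norm (F n x))\<^sup>2" by (simp add: power2_diff)
      moreover have "0 \<le> 2 ^ n * norm (F n x)" by simp
      ultimately have "2 ^ n * norm (F n x) \<le> 1 + (2 ^ n * norm (F n x))\<^sup>2" by linarith
      then have "(1 / 2) ^ n * (2 ^ n * norm (F n x)) \<le> (1 / 2) ^ n * (1 + (2 ^ n * norm (F n x))\<^sup>2)"
        by (intro mult_left_mono) auto
      then show "norm (F n x) \<le> (1 / 2) ^ n + 2 ^ n * (norm (F n x))\<^sup>2"
        by (simp add: power_mult_distrib power2_eq_square field_simps)
    qed (intro integrable_norm Fi Bochner_Integration.integrable_add integrable_mult_right F2i torus.integrable_const)+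
    also have "\<dots> = V * (1 / 2) ^ n + 2 ^ n * (LINT x|torus d. (norm (F n x))\<^sup>2)"
      by (subst Bochner_Integration.integral_add)
        (auto simp: V_def F2i)
    also have "\<dots> \<le> V * (1 / 2) ^ n + 2 ^ n * (P * (K * (1 / 4) ^ n))"
      using F2[of n] by simp
    also have "2 ^ n * (P * (K * (1 / 4) ^ n)) = P * K * (1 / 2) ^ n"
    proof -
      have "(1 / 2 :: real) ^ n = 2 ^ n * (1 / 4) ^ n" by (simp flip: power_mult_distrib)
      then show ?thesis by simp
    qed
    finally show ?thesis by (simp add: distrib_right)
  qed
  have sum_int: "summable (\<lambda>n. LINT x|torus d. norm (F n x))"
  proof (rule summable_comparison_test')
    show "summable (\<lambda>n. (V + P * K) * (1 / 2 :: real) ^ n)" by (intro summable_mult summable_geometric) simp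
    show "norm (LINT x|torus d. norm (F n x)) \<le> (V + P * K) * (1 / 2) ^ n" if "n \<ge> 0" for n
      using F1[of n] by simp
  qed
  have ae: "AE x in torus d. summable (\<lambda>n. norm (F n x))"
  proof -
    have "(\<integral>\<^sup>+x. (\<Sum>n. ennreal (norm (F n x))) \<partial>torus d) = (\<Sum>n. \<integral>\<^sup>+x. ennreal (norm (F n x)) \<partial>torus d)"
      by (rule nn_integral_suminf) measurable
    also have "\<dots> = (\<Sum>n. ennreal (LINT x|torus d. norm (F n x)))"
      by (intro suminf_cong nn_integral_eq_integral integrable_norm Fi) auto
    also have "\<dots> < \<infinity>"
      by (subst suminf_ennreal_eq[OF _ summable_sums[OF sum_int]]) auto
    finally have "AE x in torus d. (\<Sum>n. ennreal (norm (F n x))) \<noteq> \<infinity>"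
      by (intro nn_integral_PInf_AE) auto
    then show ?thesis
      by eventually_elim (auto intro!: summable_suminf_not_top)
  qed
  define g where "g x = (\<Sum>n. F n x)" for x
  have gi: "integrable (torus d) g"
    unfolding g_def by (rule integrable_suminf[OF Fi ae sum_int])
  then have g_m [measurable]: "g \<in> borel_measurable (torus d)" by simp
  have partial: "(\<Sum>n<N. F n x) = trig_poly d (e ` {..<m N}) c x" for N x
  proof -
    have mono: "m i \<le> m (Suc i)" for i using m(1) by (simp add: strict_mono_Suc_iff less_imp_le)
    have "(\<Sum>n<N. F n x) = (\<Sum>n<N. \<Sum>i\<in>{m n..<m (Suc n)}. c (e i) * character d (e i) x)"
      unfolding F_def trig_poly_def
      by (intro sum.cong refl sum.reindex_cong[of e]) (auto intro: inj_on_subset[OF e_inj])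
    also have "\<dots> = (\<Sum>i\<in>{m 0..<m N}. c (e i) * character d (e i) x)"
      by (induction N) (auto intro!: sum.atLeastLessThan_concat lift_Suc_mono_le[of m] mono)
    also have "\<dots> = trig_poly d (e ` {..<m N}) c x"
      unfolding trig_poly_def m(2) atLeast0LessThan
      by (rule sum.reindex_cong[of e, symmetric]) (auto intro: inj_on_subset[OF e_inj])
    finally show ?thesis .
  qed
  have fatou: "(\<integral>\<^sup>+x. ennreal ((norm (g x))\<^sup>2) \<partial>torus d) \<le> ennreal (P * B)"
  proof -
    have "(\<integral>\<^sup>+x. ennreal ((norm (g x))\<^sup>2) \<partial>torus d) =
        (\<integral>\<^sup>+x. liminf (\<lambda>N. ennreal ((norm (\<Sum>n<N. F n x))\<^sup>2)) \<partial>torus d)"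
    proof (rule nn_integral_cong_AE)
      show "AE x in torus d. ennreal ((norm (g x))\<^sup>2) = liminf (\<lambda>N. ennreal ((norm (\<Sum>n<N. F n x))\<^sup>2))"
        using ae
      proof eventually_elim
        case (elim x)
        then have "(\<lambda>N. \<Sum>n<N. F n x) \<longlonglongrightarrow> g x"
          unfolding g_def by (intro summable_LIMSEQ summable_norm_cancel[of "\<lambda>n. F n x"])
        then have "(\<lambda>N. ennreal ((norm (\<Sum>n<N. F n x))\<^sup>2)) \<longlonglongrightarrow> ennreal ((norm (g x))\<^sup>2)"
          by (intro tendsto_ennrealI tendsto_power tendsto_norm)
        from lim_imp_Liminf[OF _ this] show ?case by simp
      qed
    qed
    also have "\<dots> \<le> liminf (\<lambda>N. \<integral>\<^sup>+x. ennreal ((norm (\<Sum>n<N. F n x))\<^sup>2) \<partial>torus d)"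
      by (rule nn_integral_liminf) measurable
    also have "\<dots> \<le> ennreal (P * B)"
    proof (rule Liminf_le)
      show "\<forall>\<^sub>F N in sequentially. (\<integral>\<^sup>+x. ennreal ((norm (\<Sum>n<N. F n x))\<^sup>2) \<partial>torus d) \<le> ennreal (P * B)"
      proof (rule always_eventually, rule allI)
        fix N
        have "integrable (torus d) (\<lambda>x. (norm (trig_poly d (e ` {..<m N}) c x))\<^sup>2)"
          by (rule torus.integrable_const_bound[of _ "(\<Sum>k\<in>e ` {..<m N}. norm (c k))\<^sup>2"])
            (auto intro!: power_mono norm_trig_poly_le)
        then have "(\<integral>\<^sup>+x. ennreal ((norm (\<Sum>n<N. F n x))\<^sup>2) \<partial>torus d) =
            ennreal (LINT x|torus d. (norm (trig_poly d (e ` {..<m N}) c x))\<^sup>2)"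
          unfolding partial by (intro nn_integral_eq_integral) auto
        also have "(LINT x|torus d. (norm (trig_poly d (e ` {..<m N}) c x))\<^sup>2) = P * (\<Sum>k\<in>e ` {..<m N}. (norm (c k))\<^sup>2)"
          unfolding P_def by (rule integral_norm_trig_poly_sq) (use e_lat in auto)
        also have "ennreal \<dots> \<le> ennreal (P * B)"
          using P by (intro ennreal_leI mult_left_mono bd) (use e_lat in auto)
        finally show "(\<integral>\<^sup>+x. ennreal ((norm (\<Sum>n<N. F n x))\<^sup>2) \<partial>torus d) \<le> ennreal (P * B)" .
      qed
    qed simp
    finally show ?thesis .
  qed
  have g2: "integrable (torus d) (\<lambda>x. (norm (g x))\<^sup>2)"
    by (rule integrableI_nonneg) (use fatou in \<open>auto simp: less_top[symmetric] top_unique\<close>)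
  show thesis
  proof (rule that[of g])
    have "(norm (g x)) powr 2 = (norm (g x))\<^sup>2" for x by (simp add: powr_numeral)
    then show "g \<in> Lp_space 2 (torus d)" unfolding Lp_space_def using g2 by simp
    fix k assume k: "k \<in> lattice d"
    then obtain i where i: "k = e i" using e by (metis bij_betw_iff_bijections)
    have cF: "integrable (torus d) (\<lambda>x. F n x * cnj (character d k x))" for n
      by (rule integrable_mult_bounded[OF Fi, of _ 1]) auto
    have nF: "norm (F n x * cnj (character d k x)) = norm (F n x)" for n x by (simp add: norm_mult)
    have "(\<lambda>n. LINT x|torus d. F n x * cnj (character d k x)) sums
        (LINT x|torus d. (\<Sum>n. F n x * cnj (character d k x)))"
      by (rule sums_integral[OF cF]) (simp_all only: nF ae sum_int)
    also have "(LINT x|torus d. (\<Sum>n. F n x * cnj (character d k x))) = (LINT x|torus d. g x * cnj (character d k x))"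
    proof (rule integral_cong_AE)
      show "AE x in torus d. (\<Sum>n. F n x * cnj (character d k x)) = g x * cnj (character d k x)"
        using ae
      proof eventually_elim
        case (elim x)
        then show ?case unfolding g_def by (intro suminf_mult2[symmetric] summable_norm_cancel[of "\<lambda>n. F n x"])
      qed
      show "(\<lambda>x. \<Sum>n. F n x * cnj (character d k x)) \<in> borel_measurable (torus d)"
        using integrable_suminf[OF cF] by (simp only: nF ae sum_int borel_measurable_integrable)
    qed measurable
    finally have "(\<lambda>N. \<Sum>n<N. LINT x|torus d. F n x * cnj (character d k x)) \<longlonglongrightarrow> (LINT x|torus d. g x * cnj (character d k x))"
      by (simp add: sums_def)
    then have lim: "(\<lambda>N. complex_of_real (1 / (2 * pi) ^ d) * (\<Sum>n<N. LINT x|torus d. F n x * cnj (character d k x))) \<longlonglongrightarrow> fourier_coeff d g k"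
      unfolding fourier_coeff_def by (intro tendsto_mult tendsto_const)
    have "\<forall>\<^sub>F N in sequentially. complex_of_real (1 / (2 * pi) ^ d) * (\<Sum>n<N. LINT x|torus d. F n x * cnj (character d k x)) = c k"
      using eventually_ge_at_top[of "Suc i"]
    proof eventually_elim
      case (elim N)
      have "(\<Sum>n<N. LINT x|torus d. F n x * cnj (character d k x)) = (LINT x|torus d. (\<Sum>n<N. F n x) * cnj (character d k x))"
        by (simp add: sum_distrib_right Bochner_Integration.integral_sum[OF cF])
      then have "complex_of_real (1 / (2 * pi) ^ d) * (\<Sum>n<N. LINT x|torus d. F n x * cnj (character d k x)) =
          fourier_coeff d (trig_poly d (e ` {..<m N}) c) k"
        unfolding fourier_coeff_def partial by simp
      also have "\<dots> = (if k \<in> e ` {..<m N} then c k else 0)"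
        by (rule fourier_coeff_trig_poly) (use e_lat k in auto)
      also have "\<dots> = c k"
      proof -
        \<comment> \<open>Strict monotonicity gives N \<le> m N, so the partial sum already contains
          the frequency \<open>e i\<close>, and its coefficient there stays constant.\<close>
        have "i < m N" using elim strict_mono_imp_increasing[OF m(1), of N] by simp
        then show ?thesis using i by simp
      qed
      finally show ?case .
    qed
    then have "(\<lambda>N. complex_of_real (1 / (2 * pi) ^ d) * (\<Sum>n<N. LINT x|torus d. F n x * cnj (character d k x))) \<longlonglongrightarrow> c k"
      by (rule tendsto_eventually)
    then show "fourier_coeff d g k = c k" using LIMSEQ_unique[OF lim] by simp
  qed
qed

text \<open>The choice in \<open>fourier_multiplier\<close> says something only once a candidate
  exists. The symbol is unimodular, so Bessel's inequality bounds the new coefficients and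
  Riesz-Fischer supplies the function.\<close>

lemma fourier_coeff_propagator:
  assumes d: "d \<ge> 1" and \<phi>: "\<phi> \<in> Lp_space 2 (torus d)" and k: "k \<in> lattice d"
  shows "fourier_coeff d (propagator d v \<theta> t \<phi>) k =
    exp (\<i> * complex_of_real (t * box_symbol d v \<theta> k)) * fourier_coeff d \<phi> k"
proof -
  let ?m = "\<lambda>k. exp (\<i> * complex_of_real (t * box_symbol d v \<theta> k))"
  have [simp]: "norm (?m k) = 1" for k by (rule norm_exp_i_times)
  have "norm (\<phi> x) powr 2 = (norm (\<phi> x))\<^sup>2" for x by (simp add: powr_numeral)
  then have \<phi>m: "\<phi> \<in> borel_measurable (torus d)" and \<phi>2: "integrable (torus d) (\<lambda>x. (norm (\<phi> x))\<^sup>2)"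
    using \<phi> unfolding Lp_space_def by auto
  have P: "(2 * pi) ^ d > 0" by simp
  have bd: "(\<Sum>k\<in>S. (norm (?m k * fourier_coeff d \<phi> k))\<^sup>2) \<le> (LINT x|torus d. (norm (\<phi> x))\<^sup>2) / (2 * pi) ^ d"
    if "finite S" "S \<subseteq> lattice d" for S
    using bessel_inequality[OF \<phi>m \<phi>2 that] P by (simp add: norm_mult pos_le_divide_eq mult.commute)
  have "\<exists>g. g \<in> Lp_space 2 (torus d) \<and> (\<forall>k\<in>lattice d. fourier_coeff d g k = ?m k * fourier_coeff d \<phi> k)"
    using riesz_fischer[OF d bd] by metis
  from someI_ex[OF this] show ?thesis
    using k unfolding propagator_def fourier_multiplier_def by blast
qed

section \<open>The dispersive estimate and the endpoint\<close>

text \<open>\<open>X\<close> and \<open>Y\<close> may be upper bounds of the integrals, so an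
  estimate can be inserted directly. The vanishing case is separate because Young's inequality is
  applied after normalising by both.\<close>

lemma nn_integral_holder:
  fixes a b :: "'a \<Rightarrow> real"
  assumes [measurable]: "a \<in> borel_measurable M" "b \<in> borel_measurable M"
    and nn: "\<And>x. a x \<ge> 0" "\<And>x. b x \<ge> 0"
    and pq: "p > 1" "q > 1" "1 / p + 1 / q = 1"
    and X: "(\<integral>\<^sup>+x. ennreal (a x powr p) \<partial>M) \<le> ennreal X" "X \<ge> 0"
    and Y: "(\<integral>\<^sup>+x. ennreal (b x powr q) \<partial>M) \<le> ennreal Y" "Y \<ge> 0"
  shows "(\<integral>\<^sup>+x. ennreal (a x * b x) \<partial>M) \<le> ennreal (X powr (1 / p) * Y powr (1 / q))"
proof (cases "X = 0 \<or> Y = 0")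
  case True
  have "AE x in M. a x * b x = 0"
  proof (cases "X = 0")
    case True
    then have "AE x in M. ennreal (a x powr p) = 0"
      using X by (subst nn_integral_0_iff_AE[symmetric]) auto
    then show ?thesis by eventually_elim simp
  next
    case False
    then have "AE x in M. ennreal (b x powr q) = 0"
      using Y True by (subst nn_integral_0_iff_AE[symmetric]) auto
    then show ?thesis by eventually_elim simp
  qed
  then have "AE x in M. ennreal (a x * b x) = 0" by eventually_elim (simp only: ennreal_0)
  then have "(\<integral>\<^sup>+x. ennreal (a x * b x) \<partial>M) = 0" by (subst nn_integral_0_iff_AE) auto
  then show ?thesis by simp
next
  case False
  then have X0: "X > 0" and Y0: "Y > 0" using X Y by auto
  define Z where "Z = X powr (1 / p) * Y powr (1 / q)"
  have Z: "Z > 0" unfolding Z_def using X0 Y0 by simp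
  have young: "a x * b x \<le> Z / (p * X) * a x powr p + Z / (q * Y) * b x powr q" for x
  proof -
    have "(a x / X powr (1 / p)) * (b x / Y powr (1 / q)) \<le>
       (a x / X powr (1 / p)) powr p / p + (b x / Y powr (1 / q)) powr q / q"
      by (rule Youngs_inequality) (use pq nn in auto)
    then have "Z * (a x * b x / Z) \<le> Z * ((a x / X powr (1 / p)) powr p / p + (b x / Y powr (1 / q)) powr q / q)"
      using Z by (intro mult_left_mono) (auto simp: Z_def)
    then show ?thesis
      using Z pq X0 Y0 nn by (simp add: powr_divide powr_powr distrib_left mult.commute)
  qed
  have "(\<integral>\<^sup>+x. ennreal (a x * b x) \<partial>M) \<le>
     (\<integral>\<^sup>+x. ennreal (Z / (p * X)) * ennreal (a x powr p) + ennreal (Z / (q * Y)) * ennreal (b x powr q) \<partial>M)"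
  proof (rule nn_integral_mono)
    fix x
    have "ennreal (a x * b x) \<le> ennreal (Z / (p * X) * a x powr p + Z / (q * Y) * b x powr q)"
      by (intro ennreal_leI young)
    also have "\<dots> = ennreal (Z / (p * X)) * ennreal (a x powr p) + ennreal (Z / (q * Y)) * ennreal (b x powr q)"
      using Z X0 Y0 pq by (subst ennreal_plus) (auto simp: ennreal_mult'[symmetric])
    finally show "ennreal (a x * b x) \<le> \<dots>" .
  qed
  also have "\<dots> = ennreal (Z / (p * X)) * (\<integral>\<^sup>+x. ennreal (a x powr p) \<partial>M) + ennreal (Z / (q * Y)) * (\<integral>\<^sup>+x. ennreal (b x powr q) \<partial>M)"
    by (simp add: nn_integral_add nn_integral_cmult)
  also have "\<dots> \<le> ennreal (Z / (p * X)) * ennreal X + ennreal (Z / (q * Y)) * ennreal Y"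
    by (intro add_mono mult_left_mono X Y) auto
  also have "\<dots> = ennreal (Z / p + Z / q)"
    using Z X0 Y0 pq by (simp add: ennreal_mult'[symmetric] ennreal_plus[symmetric] del: ennreal_plus)
  also have "Z / p + Z / q = Z * (1 / p + 1 / q)" by (simp add: distrib_left)
  finally show ?thesis unfolding pq(3) Z_def by simp
qed

section \<open>The truncated propagator at a fixed time\<close>

locale hyperbolic =
  fixes d v :: nat and \<theta> :: "nat \<Rightarrow> real" and L :: nat
  assumes d: "d \<ge> 1" and v: "v \<le> d" and \<theta>: "\<And>j. j \<in> {1..d} \<Longrightarrow> 0 < \<theta> j \<and> \<theta> j \<le> 1" and L: "L > 0"
begin

text \<open>Contains every frequency at which \<open>weight\<close> is nonzero: the factors vanish
  beyond 3L and are 1 up to L.\<close>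

definition freq_box :: "(nat \<Rightarrow> int) set" where
  "freq_box = PiE {1..d} (\<lambda>_. {-3 * int L..3 * int L})"

definition weight :: "(nat \<Rightarrow> int) \<Rightarrow> real" where
  "weight k = (\<Prod>j\<in>{1..d}. cutoff L (k j))"

definition phase :: "real \<Rightarrow> (nat \<Rightarrow> int) \<Rightarrow> complex" where
  "phase t k = cis (t * box_symbol d v \<theta> k)"

text \<open>The dispersive bound G(t), with the majorant in place of each squared Weyl sum.\<close>

definition kernel_bound :: "real \<Rightarrow> real" where
  "kernel_bound t = (\<Prod>j\<in>{1..d}. sqrt (weyl_majorant L (\<theta> j * t)))"

lemma finite_freq_box: "finite freq_box"
  unfolding freq_box_def by (intro finite_PiE) auto

lemma freq_box_subset: "freq_box \<subseteq> lattice d"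
  unfolding freq_box_def lattice_def by (auto simp: PiE_iff)

lemma weight_bounds: "0 \<le> weight k" "weight k \<le> 1"
  unfolding weight_def by (auto intro!: prod_nonneg prod_le_1 cutoff_nonneg cutoff_le_1)

lemma norm_phase [simp]: "norm (phase t k) = 1"
  by (simp add: phase_def)

lemma phase_diff: "phase (s - t) k = phase s k * cnj (phase t k)"
  by (simp add: phase_def cis_cnj cis_mult algebra_simps)

lemma kernel_bound_pos: "kernel_bound t > 0"
  unfolding kernel_bound_def by (intro prod_pos) (simp add: weyl_majorant_pos L)

lemma kernel_bound_minus: "kernel_bound (- t) = kernel_bound t"
  unfolding kernel_bound_def by (simp add: weyl_majorant_minus)

lemma borel_measurable_kernel_bound [measurable]: "kernel_bound \<in> borel_measurable borel"
  unfolding kernel_bound_def by measurable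

text \<open>The symbol is a sum over coordinates and the box is a product, so the kernel factors
  into one-dimensional Weyl sums at position x j - y j and time \<theta> j t up to sign. The
  majorant is even in time, so the indefinite operator is treated exactly like an elliptic
  one.\<close>

lemma norm_kernel_le:
  "norm (\<Sum>k\<in>freq_box. of_real (weight k) * phase t k * (character d k x * cnj (character d k y))) \<le> kernel_bound t"
proof -
  define \<sigma> where "\<sigma> j = (if j \<le> v then - 1 else 1 :: real)" for j
  define D where "D j m = of_real (cutoff L m) * cis (of_int m * (x j - y j) + (\<sigma> j * \<theta> j * t) * (of_int m)\<^sup>2)" for j and m :: int
  have box: "box_symbol d v \<theta> k = (\<Sum>j\<in>{1..d}. \<sigma> j * \<theta> j * (of_int (k j))\<^sup>2)" for k
  proof -
    have "{1..d} = {1..v} \<union> {v<..d}" using v by auto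
    then have "(\<Sum>j\<in>{1..d}. \<sigma> j * \<theta> j * (of_int (k j))\<^sup>2) =
       (\<Sum>j\<in>{1..v}. \<sigma> j * \<theta> j * (of_int (k j))\<^sup>2) + (\<Sum>j\<in>{v<..d}. \<sigma> j * \<theta> j * (of_int (k j))\<^sup>2)"
      by (simp only:) (rule sum.union_disjoint, auto)
    also have "(\<Sum>j\<in>{1..v}. \<sigma> j * \<theta> j * (of_int (k j))\<^sup>2) = - (\<Sum>j\<in>{1..v}. \<theta> j * (of_int (k j))\<^sup>2)"
      unfolding sum_negf[symmetric] by (intro sum.cong) (auto simp: \<sigma>_def)
    also have "(\<Sum>j\<in>{v<..d}. \<sigma> j * \<theta> j * (of_int (k j))\<^sup>2) = (\<Sum>j\<in>{v<..d}. \<theta> j * (of_int (k j))\<^sup>2)"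
      by (intro sum.cong) (auto simp: \<sigma>_def)
    finally show ?thesis unfolding box_symbol_def ..
  qed
  have cis_sum: "cis (\<Sum>j\<in>A. f j) = (\<Prod>j\<in>A. cis (f j))" if "finite A" for A :: "nat set" and f
    using that by (induction A) (auto simp: cis_mult[symmetric])
  have "of_real (weight k) * phase t k * (character d k x * cnj (character d k y)) = (\<Prod>j\<in>{1..d}. D j (k j))" for k
  proof -
    have "phase t k = (\<Prod>j\<in>{1..d}. cis (t * (\<sigma> j * \<theta> j * (of_int (k j))\<^sup>2)))"
      unfolding phase_def box sum_distrib_left by (rule cis_sum) simp
    then have "of_real (weight k) * phase t k * (character d k x * cnj (character d k y)) =
      (\<Prod>j\<in>{1..d}. of_real (cutoff L (k j)) * cis (t * (\<sigma> j * \<theta> j * (of_int (k j))\<^sup>2)) *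
         (cis (of_int (k j) * x j) * cnj (cis (of_int (k j) * y j))))"
      unfolding weight_def character_eq_prod of_real_prod cnj_prod by (simp only: prod.distrib)
    also have "\<dots> = (\<Prod>j\<in>{1..d}. D j (k j))"
      unfolding D_def by (intro prod.cong refl) (simp add: cis_cnj cis_mult algebra_simps)
    finally show ?thesis .
  qed
  then have "(\<Sum>k\<in>freq_box. of_real (weight k) * phase t k * (character d k x * cnj (character d k y))) =
     (\<Prod>j\<in>{1..d}. \<Sum>m\<in>{-3 * int L..3 * int L}. D j m)"
    unfolding freq_box_def by (simp add: prod_sum_PiE)
  also have "norm \<dots> \<le> kernel_bound t"
    unfolding prod_norm[symmetric] kernel_bound_def
  proof (rule prod_mono, safe)
    fix j assume "j \<in> {1..d}"
    have "norm (\<Sum>m\<in>{-3 * int L..3 * int L}. D j m) \<le> sqrt (weyl_majorant L (\<sigma> j * \<theta> j * t))"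
      unfolding D_def by (rule weyl_bound)
    also have "weyl_majorant L (\<sigma> j * \<theta> j * t) = weyl_majorant L (\<theta> j * t)"
      by (simp add: \<sigma>_def weyl_majorant_minus)
    finally show "norm (\<Sum>m\<in>{-3 * int L..3 * int L}. D j m) \<le> sqrt (weyl_majorant L (\<theta> j * t))" .
  qed simp
  finally show ?thesis .
qed

text \<open>Unnormalised, so that pairing \<open>evolve t f\<close> with \<open>g\<close> produces
  no power of 2 pi.\<close>

definition hat :: "((nat \<Rightarrow> real) \<Rightarrow> complex) \<Rightarrow> (nat \<Rightarrow> int) \<Rightarrow> complex" where
  "hat f k = (LINT x|torus d. f x * cnj (character d k x))"

lemma hat_eq: "hat f k = of_real ((2 * pi) ^ d) * fourier_coeff d f k"
  unfolding hat_def fourier_coeff_def by simp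

text \<open>Equals (2 pi)^d times the propagator followed by the smooth truncation
  \<open>weight\<close>; as an operator it is integration against the kernel of
  \<open>norm_kernel_le\<close>.\<close>

definition evolve :: "real \<Rightarrow> ((nat \<Rightarrow> real) \<Rightarrow> complex) \<Rightarrow> (nat \<Rightarrow> real) \<Rightarrow> complex" where
  "evolve t f = trig_poly d freq_box (\<lambda>k. of_real (weight k) * phase t k * hat f k)"

lemma borel_measurable_evolve [measurable]: "evolve t f \<in> borel_measurable (torus d)"
  unfolding evolve_def by measurable

lemma evolve_add:
  assumes "integrable (torus d) f" "integrable (torus d) g"
  shows "evolve t (\<lambda>x. f x + g x) x = evolve t f x + evolve t g x"
proof -
  have "integrable (torus d) (\<lambda>x. h x * cnj (character d k x))" if "integrable (torus d) h" for h k
    by (rule integrable_mult_bounded[OF that, of _ 1]) auto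
  then have "hat (\<lambda>x. f x + g x) k = hat f k + hat g k" for k
    unfolding hat_def using assms by (simp add: distrib_right)
  then show ?thesis
    unfolding evolve_def trig_poly_def by (simp add: distrib_left distrib_right sum.distrib)
qed

lemma norm_evolve_le:
  assumes f: "integrable (torus d) f"
  shows "norm (evolve t f x) \<le> kernel_bound t * (LINT y|torus d. norm (f y))"
proof -
  let ?K = "\<lambda>y. \<Sum>k\<in>freq_box. of_real (weight k) * phase t k * (character d k x * cnj (character d k y))"
  have i: "integrable (torus d) (\<lambda>y. f y * cnj (character d k y))" for k
    by (rule integrable_mult_bounded[OF f, of _ 1]) auto
  have "evolve t f x = (\<Sum>k\<in>freq_box. LINT y|torus d. of_real (weight k) * phase t k * character d k x * (f y * cnj (character d k y)))"
    unfolding evolve_def trig_poly_def hat_def integral_mult_right_zero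
    by (intro sum.cong refl) (simp add: mult.commute mult.left_commute)
  also have "\<dots> = (LINT y|torus d. (\<Sum>k\<in>freq_box. of_real (weight k) * phase t k * character d k x * (f y * cnj (character d k y))))"
    by (rule Bochner_Integration.integral_sum[symmetric]) (intro integrable_mult_right i)
  also have "\<dots> = (LINT y|torus d. f y * ?K y)"
    by (intro Bochner_Integration.integral_cong refl) (simp add: sum_distrib_left ac_simps)
  finally have "norm (evolve t f x) \<le> (LINT y|torus d. norm (f y * ?K y))"
    by (simp only: integral_norm_bound)
  also have "\<dots> \<le> (LINT y|torus d. kernel_bound t * norm (f y))"
  proof (rule integral_mono)
    show "integrable (torus d) (\<lambda>y. norm (f y * ?K y))"
      by (intro integrable_norm, rule integrable_mult_bounded[OF f _ norm_kernel_le]) measurable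
    show "norm (f y * ?K y) \<le> kernel_bound t * norm (f y)" for y
      using mult_left_mono[OF norm_kernel_le[of t x y], of "norm (f y)"] by (simp add: norm_mult mult.commute)
  qed (use f in simp)
  finally show ?thesis by simp
qed

lemma integral_norm_evolve_sq_le:
  assumes "f \<in> borel_measurable (torus d)" "integrable (torus d) (\<lambda>x. (norm (f x))\<^sup>2)"
  shows "(LINT x|torus d. (norm (evolve t f x))\<^sup>2) \<le> ((2 * pi) ^ d)\<^sup>2 * (LINT x|torus d. (norm (f x))\<^sup>2)"
proof -
  let ?P = "(2 * pi) ^ d"
  have "(LINT x|torus d. (norm (evolve t f x))\<^sup>2) =
      ?P * (\<Sum>k\<in>freq_box. (norm (of_real (weight k) * phase t k * hat f k))\<^sup>2)"
    unfolding evolve_def by (rule integral_norm_trig_poly_sq[OF finite_freq_box freq_box_subset])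
  also have "\<dots> \<le> ?P * (\<Sum>k\<in>freq_box. ?P\<^sup>2 * (norm (fourier_coeff d f k))\<^sup>2)"
  proof (intro mult_left_mono sum_mono)
    fix k
    have "norm (of_real (weight k) * phase t k * hat f k) \<le> 1 * (?P * norm (fourier_coeff d f k))"
      unfolding hat_eq norm_mult norm_phase norm_of_real using weight_bounds[of k]
      by (intro mult_mono) auto
    then have "(norm (of_real (weight k) * phase t k * hat f k))\<^sup>2 \<le> (?P * norm (fourier_coeff d f k))\<^sup>2"
      by (intro power_mono) auto
    then show "(norm (of_real (weight k) * phase t k * hat f k))\<^sup>2 \<le> ?P\<^sup>2 * (norm (fourier_coeff d f k))\<^sup>2"
      by (simp only: power_mult_distrib)
  qed simp
  also have "\<dots> = ?P\<^sup>2 * (?P * (\<Sum>k\<in>freq_box. (norm (fourier_coeff d f k))\<^sup>2))"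
    by (simp only: sum_distrib_left[symmetric] mult.left_commute)
  also have "\<dots> \<le> ?P\<^sup>2 * (LINT x|torus d. (norm (f x))\<^sup>2)"
    by (intro mult_left_mono bessel_inequality[OF assms finite_freq_box freq_box_subset]) simp
  finally show ?thesis .
qed

lemma integral_evolve_cnj:
  assumes g: "integrable (torus d) g"
  shows "(LINT x|torus d. evolve t f x * cnj (g x)) =
    (\<Sum>k\<in>freq_box. of_real (weight k) * phase t k * hat f k * cnj (hat g k))"
proof -
  let ?c = "\<lambda>k. of_real (weight k) * phase t k * hat f k"
  have "(LINT x|torus d. evolve t f x * cnj (g x)) = (LINT x|torus d. cnj (g x * cnj (evolve t f x)))"
    by (simp add: mult.commute)
  also have "\<dots> = cnj (LINT x|torus d. g x * cnj (evolve t f x))"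
    by (rule Bochner_Integration.integral_cnj)
  also have "(LINT x|torus d. g x * cnj (evolve t f x)) = of_real ((2 * pi) ^ d) * (\<Sum>k\<in>freq_box. cnj (?c k) * fourier_coeff d g k)"
    unfolding evolve_def by (rule integral_mult_cnj_trig_poly[OF g])
  also have "cnj \<dots> = (\<Sum>k\<in>freq_box. ?c k * cnj (hat g k))"
    by (simp add: hat_eq sum_distrib_left ac_simps)
  finally show ?thesis .
qed

text \<open>The kernel bound from L^1 to sup norm and the L^2 bound interpolate to a map from L^q to
  L^p with norm a multiple of G^(1-2/p), and Hoelder pairs the result with \<open>g\<close>. Bounded
  functions form a class stable under the truncations of the interpolation, and on it all integrals
  are finite.\<close>

lemma pairing_le:
  assumes fm [measurable]: "f \<in> borel_measurable (torus d)" and gm [measurable]: "g \<in> borel_measurable (torus d)"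
    and fb: "\<And>x. norm (f x) \<le> B" and gb: "\<And>x. norm (g x) \<le> B"
    and p: "p > 2" and q: "q = p / (p - 1)"
  shows "norm (\<Sum>k\<in>freq_box. of_real (weight k) * phase t k * hat f k * cnj (hat g k))
    \<le> 2 * ((2 * pi) ^ d)\<^sup>2 powr (1 / p) * kernel_bound t powr (1 - 2 / p) *
      ((LINT x|torus d. norm (f x) powr q) powr (1 / q) * (LINT x|torus d. norm (g x) powr q) powr (1 / q))"
proof -
  let ?D = "((2 * pi) ^ d)\<^sup>2" and ?If = "LINT x|torus d. norm (f x) powr q" and ?Ig = "LINT x|torus d. norm (g x) powr q"
  have pq: "p > 1" "q > 1" "1 / p + 1 / q = 1" using p unfolding q by (auto simp: field_simps)
  have int: "integrable (torus d) h" if "h \<in> borel_measurable (torus d)" "\<And>x. norm (h x) \<le> B" for h :: "_ \<Rightarrow> complex"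
    by (rule torus.integrable_const_bound[of _ B]) (use that in auto)
  have int2: "integrable (torus d) (\<lambda>x. (norm (h x))\<^sup>2)" if [measurable]: "h \<in> borel_measurable (torus d)" and "\<And>x. norm (h x) \<le> B" for h :: "_ \<Rightarrow> complex"
    by (rule torus.integrable_const_bound[of _ "B\<^sup>2"]) (use that in \<open>auto intro!: power_mono\<close>)
  have intq: "(\<integral>\<^sup>+x. ennreal (norm (h x) powr q) \<partial>torus d) = ennreal (LINT x|torus d. norm (h x) powr q)"
    if [measurable]: "h \<in> borel_measurable (torus d)" and "\<And>x. norm (h x) \<le> B" for h :: "_ \<Rightarrow> complex"
  proof (rule nn_integral_eq_integral)
    show "integrable (torus d) (\<lambda>x. norm (h x) powr q)"
      by (rule torus.integrable_const_bound[of _ "B powr q"]) (use that pq in \<open>auto intro!: powr_mono2\<close>)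
  qed simp
  have ev: "(\<integral>\<^sup>+x. ennreal (norm (evolve t f x) powr p) \<partial>torus d)
     \<le> ennreal (2 powr p * ?D * kernel_bound t powr (p - 2) * ?If powr (p - 1))"
  proof (rule L1_L2_interpolation[OF finite_measure_torus fm fb p q])
    fix g h :: "(nat \<Rightarrow> real) \<Rightarrow> complex" and x assume "g \<in> borel_measurable (torus d)" "h \<in> borel_measurable (torus d)"
      "\<And>x. norm (g x) \<le> B" "\<And>x. norm (h x) \<le> B"
    then show "evolve t (\<lambda>x. g x + h x) x = evolve t g x + evolve t h x"
      by (intro evolve_add int)
  next
    fix g :: "(nat \<Rightarrow> real) \<Rightarrow> complex" and x assume g: "g \<in> borel_measurable (torus d)" "\<And>x. norm (g x) \<le> B"
    have "ennreal (norm (evolve t g x)) \<le> ennreal (kernel_bound t * (LINT y|torus d. norm (g y)))"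
      by (intro ennreal_leI norm_evolve_le int g)
    also have "\<dots> = ennreal (kernel_bound t) * (\<integral>\<^sup>+y. norm (g y) \<partial>torus d)"
      using kernel_bound_pos[of t] int[OF g] by (subst nn_integral_eq_integral) (auto simp: ennreal_mult')
    finally show "ennreal (norm (evolve t g x)) \<le> \<dots>" .
  next
    fix g :: "(nat \<Rightarrow> real) \<Rightarrow> complex" assume g: "g \<in> borel_measurable (torus d)" "\<And>x. norm (g x) \<le> B"
    have "integrable (torus d) (\<lambda>x. (norm (evolve t g x))\<^sup>2)"
      unfolding evolve_def
      by (rule torus.integrable_const_bound[of _ "(\<Sum>k\<in>freq_box. norm (of_real (weight k) * phase t k * hat g k))\<^sup>2"])
        (auto intro!: power_mono norm_trig_poly_le)
    then have "(\<integral>\<^sup>+x. ennreal ((norm (evolve t g x))\<^sup>2) \<partial>torus d) = ennreal (LINT x|torus d. (norm (evolve t g x))\<^sup>2)"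
      by (intro nn_integral_eq_integral) auto
    also have "\<dots> \<le> ennreal (?D * (LINT x|torus d. (norm (g x))\<^sup>2))"
      by (intro ennreal_leI integral_norm_evolve_sq_le int2 g)
    also have "\<dots> = ennreal ?D * (\<integral>\<^sup>+y. ennreal ((norm (g y))\<^sup>2) \<partial>torus d)"
      using int2[OF g] by (subst nn_integral_eq_integral) (auto simp: ennreal_mult')
    finally show "(\<integral>\<^sup>+x. ennreal ((norm (evolve t g x))\<^sup>2) \<partial>torus d) \<le> \<dots>" .
  qed (use kernel_bound_pos intq[OF fm fb] in auto)
  have "norm (\<Sum>k\<in>freq_box. of_real (weight k) * phase t k * hat f k * cnj (hat g k)) =
      norm (LINT x|torus d. evolve t f x * cnj (g x))"
    unfolding integral_evolve_cnj[OF int[OF gm gb]] ..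
  then have "ennreal (norm (\<Sum>k\<in>freq_box. of_real (weight k) * phase t k * hat f k * cnj (hat g k))) =
      ennreal (norm (LINT x|torus d. evolve t f x * cnj (g x)))" by simp
  also have "\<dots> \<le> (\<integral>\<^sup>+x. ennreal (norm (evolve t f x * cnj (g x))) \<partial>torus d)"
    by (rule integral_norm_bound_ennreal, rule integrable_mult_bounded[of _ _ _ B])
      (use gb in \<open>auto simp: evolve_def integrable_trig_poly\<close>)
  also have "\<dots> = (\<integral>\<^sup>+x. ennreal (norm (evolve t f x) * norm (g x)) \<partial>torus d)"
    by (simp add: norm_mult)
  also have "\<dots> \<le> ennreal ((2 powr p * ?D * kernel_bound t powr (p - 2) * ?If powr (p - 1)) powr (1 / p) * ?Ig powr (1 / q))"
    by (rule nn_integral_holder[OF _ _ _ _ pq ev]) (use intq[OF gm gb] in auto)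
  also have "(2 powr p * ?D * kernel_bound t powr (p - 2) * ?If powr (p - 1)) powr (1 / p) =
     2 * ?D powr (1 / p) * kernel_bound t powr (1 - 2 / p) * ?If powr (1 / q)"
  proof -
    have "(p - 2) * (1 / p) = 1 - 2 / p" "(p - 1) * (1 / p) = 1 / q" using p unfolding q by (auto simp: field_simps)
    then show ?thesis using p kernel_bound_pos[of t] by (simp add: powr_mult powr_powr less_imp_le)
  qed
  finally show ?thesis by (simp add: mult.assoc)
qed

end

section \<open>Integration in time\<close>

abbreviation unit_time :: "real measure" where
  "unit_time \<equiv> restrict_space lborel {0..1}"

lemma finite_measure_unit_time: "finite_measure unit_time"
  by (rule finite_measureI) (simp add: emeasure_restrict_space space_restrict_space)

interpretation unit_time: finite_measure unit_time
  by (rule finite_measure_unit_time)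

lemma measurable_unit_time: "f \<in> borel_measurable borel \<Longrightarrow> f \<in> borel_measurable unit_time"
  by (rule measurable_restrict_space1) simp

context hyperbolic
begin

definition arc_const :: real where
  "arc_const = (\<Sum>j\<in>{1..d}. 112 * pi * 540\<^sup>2 / \<theta> j)"

lemma arc_const_pos: "arc_const > 0"
  unfolding arc_const_def using d \<theta> by (intro sum_pos) auto

text \<open>The indicator is of [-1, 1] because the argument is a difference of two times in
  [0, 1].\<close>

definition time_kernel :: "real \<Rightarrow> real \<Rightarrow> real" where
  "time_kernel p \<tau> = indicator {-1..1} \<tau> * kernel_bound \<tau> powr (1 - 2 / p)"

lemma borel_measurable_time_kernel [measurable]: "time_kernel p \<in> borel_measurable borel"
  unfolding time_kernel_def by measurable

text \<open>If a product of d factors exceeds \<mu>, some factor exceeds \<mu>^(1/d), so the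
  superlevel set is covered by d sets measured in \<open>weyl_majorant_weak_L2\<close>. The value of
  \<open>p\<close> makes the resulting exponent p / 2.\<close>

lemma time_kernel_weak:
  assumes p: "p = 2 + 8 / d" and \<kappa>: "\<kappa> > 0"
  shows "emeasure lborel {\<tau>. time_kernel p \<tau> > \<kappa>} \<le> ennreal (arc_const * (real L)\<^sup>2 * \<kappa> powr - (p / 2))"
proof -
  have p2: "p > 2" and p8: "p - 2 = 8 / d" using p d by auto
  \<comment> \<open>\<mu> is the height of \<open>kernel_bound\<close> that matches \<kappa>, and
    \<open>y\<close> is the height of a single majorant, the square of \<mu>^(1/d).\<close>
  define \<mu> where "\<mu> = \<kappa> powr (p / (p - 2))"
  define y where "y = \<mu> powr (2 / d)"
  have \<mu>: "\<mu> > 0" and y: "y > 0" unfolding \<mu>_def y_def using \<kappa> by auto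
  have yk: "(real L / y)\<^sup>2 = (real L)\<^sup>2 * \<kappa> powr - (p / 2)"
  proof -
    have "y = \<kappa> powr (p / 4)" unfolding y_def \<mu>_def powr_powr p8 using d by simp
    then have "y\<^sup>2 = \<kappa> powr (p / 2)"
      unfolding power2_eq_square by (simp only: powr_add[symmetric]) simp
    then show ?thesis by (simp add: power_divide powr_minus_divide)
  qed
  have "{\<tau>. time_kernel p \<tau> > \<kappa>} \<subseteq> (\<Union>j\<in>{1..d}. {\<tau>\<in>{-1..1}. weyl_majorant L (\<theta> j * \<tau>) > y})"
  proof
    fix \<tau> assume "\<tau> \<in> {\<tau>. time_kernel p \<tau> > \<kappa>}"
    then have \<tau>: "\<tau> \<in> {-1..1}" and big: "\<kappa> < kernel_bound \<tau> powr (1 - 2 / p)"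
      using \<kappa> by (cases "\<tau> \<in> {-1..1}"; simp add: time_kernel_def)+
    have "\<mu> < (kernel_bound \<tau> powr (1 - 2 / p)) powr (p / (p - 2))"
      unfolding \<mu>_def using big \<kappa> p2 by (intro powr_less_mono2) auto
    also have "\<dots> = kernel_bound \<tau>"
    proof -
      have "(1 - 2 / p) * (p / (p - 2)) = 1" using p2 by (simp add: field_simps)
      then show ?thesis unfolding powr_powr using kernel_bound_pos[of \<tau>] p2 by simp
    qed
    finally have G: "\<mu> < kernel_bound \<tau>" .
    have "\<exists>j\<in>{1..d}. \<mu> powr (1 / d) < sqrt (weyl_majorant L (\<theta> j * \<tau>))"
    proof (rule ccontr)
      assume "\<not> ?thesis"
      then have "kernel_bound \<tau> \<le> (\<Prod>j\<in>{1..d}. \<mu> powr (1 / d))"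
        unfolding kernel_bound_def
        by (intro prod_mono) (auto simp: not_less weyl_majorant_pos L less_imp_le)
      also have "\<dots> = \<mu>" using \<mu> d by (simp add: powr_power)
      finally show False using G by simp
    qed
    then obtain j where j: "j \<in> {1..d}" "\<mu> powr (1 / d) < sqrt (weyl_majorant L (\<theta> j * \<tau>))" by blast
    have "(\<mu> powr (1 / d))\<^sup>2 < (sqrt (weyl_majorant L (\<theta> j * \<tau>)))\<^sup>2"
      using j(2) by (intro power_strict_mono) auto
    then have "y < weyl_majorant L (\<theta> j * \<tau>)"
      unfolding y_def using \<mu> weyl_majorant_pos[OF L, of "\<theta> j * \<tau>"]
      by (simp add: power2_eq_square flip: powr_add)
    then show "\<tau> \<in> (\<Union>j\<in>{1..d}. {\<tau>\<in>{-1..1}. weyl_majorant L (\<theta> j * \<tau>) > y})" using \<tau> j by blast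
  qed
  then have "emeasure lborel {\<tau>. time_kernel p \<tau> > \<kappa>} \<le>
      emeasure lborel (\<Union>j\<in>{1..d}. {\<tau>\<in>{-1..1}. weyl_majorant L (\<theta> j * \<tau>) > y})"
    by (intro emeasure_mono) auto
  also have "\<dots> \<le> (\<Sum>j\<in>{1..d}. emeasure lborel {\<tau>\<in>{-1..1}. weyl_majorant L (\<theta> j * \<tau>) > y})"
    by (intro emeasure_subadditive_finite) auto
  also have "\<dots> \<le> (\<Sum>j\<in>{1..d}. ennreal (112 * pi * 540\<^sup>2 / \<theta> j * (real L / y)\<^sup>2))"
    by (intro sum_mono weyl_majorant_weak_L2 L y) (use \<theta> in auto)
  also have "\<dots> = ennreal (\<Sum>j\<in>{1..d}. 112 * pi * 540\<^sup>2 / \<theta> j * (real L / y)\<^sup>2)"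
    by (intro sum_ennreal) (use \<theta> in \<open>auto simp: less_imp_le\<close>)
  also have "(\<Sum>j\<in>{1..d}. 112 * pi * 540\<^sup>2 / \<theta> j * (real L / y)\<^sup>2) = arc_const * (real L / y)\<^sup>2"
    unfolding arc_const_def sum_distrib_right ..
  finally show ?thesis unfolding yk by (simp only: mult.assoc)
qed

text \<open>Involves \<open>d\<close> and \<theta> but not the scale \<open>L\<close>, which makes
  the final constant uniform in N.\<close>

definition endpoint_const :: real where
  "endpoint_const = (let p = 2 + 8 / real d; r = p / 2 in
     (2 * ((2 * pi) ^ d)\<^sup>2 powr (1 / p) * (2 * (r / (r - 1) * (p - 1)))) powr r * arc_const)"

text \<open>Duality with \<open>F = |u|\<^bsup>p-2\<^esup>u\<close>: the square of the dual norm is a quadratic form in time whose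
  kernel is controlled by \<^const>\<open>time_kernel\<close>.\<close>

proposition endpoint_estimate:
  assumes S: "finite S" "\<And>k. k \<in> S \<Longrightarrow> k \<in> lattice d \<and> (\<forall>j\<in>{1..d}. \<bar>k j\<bar> \<le> int L)"
    and p: "p = 2 + 8 / real d"
  shows "(LINT t|unit_time. LINT x|torus d. norm (trig_poly d S (\<lambda>k. c k * phase t k) x) powr p)
    \<le> endpoint_const * (real L)\<^sup>2 * (\<Sum>k\<in>S. (norm (c k))\<^sup>2) powr (p / 2)"
proof -
  define u where "u t x = trig_poly d S (\<lambda>k. c k * phase t k) x" for t x
  define r where "r = p / 2"
  define q where "q = p / (p - 1)"
  have p2: "p > 2" using p d by simp
  have r1: "r > 1" and pr: "p = 2 * r" using p2 by (auto simp: r_def)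
  have q1: "q > 1" unfolding q_def using p2 by simp
  have qp: "q * (p - 1) = p" unfolding q_def using p2 by simp
  define B0 where "B0 = (\<Sum>k\<in>S. norm (c k))"
  have ub: "norm (u t x) \<le> B0" for t x
    unfolding u_def B0_def using norm_trig_poly_le[of d S "\<lambda>k. c k * phase t k" x] by (simp add: norm_mult)
  \<comment> \<open>The dual function: u times the conjugate of F is |u|^p, and |F|^q is |u|^p as
    well, so its norm is expressed by the very quantity under estimation.\<close>
  define F where "F t x = of_real (norm (u t x) powr (p - 2)) * u t x" for t x
  have Fn: "norm (F t x) = norm (u t x) powr (p - 1)" for t x
  proof (cases "u t x = 0")
    case False
    then have "norm (u t x) powr (p - 1) = norm (u t x) powr (p - 2) * norm (u t x) powr 1"
      by (simp only: powr_add[symmetric]) simp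
    then show ?thesis by (simp add: F_def norm_mult)
  qed (simp add: F_def)
  define B where "B = B0 powr (p - 1)"
  have Fb: "norm (F t x) \<le> B" for t x
    unfolding Fn B_def using ub[of t x] p2 by (intro powr_mono2) auto
  have Fq: "norm (F t x) powr q = norm (u t x) powr p" for t x
    unfolding Fn powr_powr using qp by (simp add: mult.commute)
  have uF: "u t x * cnj (F t x) = of_real (norm (u t x) powr p)" for t x
  proof (cases "u t x = 0")
    case False
    have "norm (u t x) powr p = norm (u t x) powr (p - 2) * norm (u t x) powr 2"
      by (simp only: powr_add[symmetric]) simp
    also have "norm (u t x) powr 2 = (norm (u t x))\<^sup>2" using False by (simp add: powr_numeral)
    finally have "complex_of_real (norm (u t x) powr p) = of_real (norm (u t x) powr (p - 2)) * (u t x * cnj (u t x))"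
      by (simp only: of_real_mult complex_norm_square)
    then show ?thesis unfolding F_def by (simp add: ac_simps)
  qed (use p2 in simp)
  have phase_m [measurable]: "(\<lambda>t. phase t k) \<in> borel_measurable borel" for k
    unfolding phase_def cis_conv_exp by measurable
  have u_m [measurable]: "(\<lambda>(t, x). u t x) \<in> borel_measurable (borel \<Otimes>\<^sub>M torus d)"
    unfolding u_def trig_poly_def by measurable
  have F_m [measurable]: "(\<lambda>(t, x). F t x) \<in> borel_measurable (borel \<Otimes>\<^sub>M torus d)"
    unfolding F_def by measurable
  have Ft_m [measurable]: "F t \<in> borel_measurable (torus d)" for t
    unfolding F_def u_def trig_poly_def by measurable
  have Fi: "integrable (torus d) (F t)" for t
    by (rule torus.integrable_const_bound[of _ B]) (auto simp: Fb)
  have hat_m [measurable]: "(\<lambda>t. hat (F t) k) \<in> borel_measurable borel" for k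
    unfolding hat_def by measurable
  define P where "P = measure (torus d) (space (torus d))"
  have hat_b: "norm (hat (F t) k) \<le> B * P" for t k
  proof -
    have "norm (hat (F t) k) \<le> (LINT x|torus d. norm (F t x * cnj (character d k x)))"
      unfolding hat_def by (rule integral_norm_bound)
    also have "\<dots> \<le> (LINT x|torus d. B)"
      by (rule integral_mono) (auto simp: norm_mult Fb intro: integrable_norm Fi)
    also have "\<dots> = B * P" by (simp add: P_def)
    finally show ?thesis .
  qed
  define V where "V t = (LINT x|torus d. norm (u t x) powr p)" for t
  have V_m [measurable]: "V \<in> borel_measurable borel"
    unfolding V_def by measurable
  have V0: "V t \<ge> 0" for t unfolding V_def by simp
  have V_b: "V t \<le> B0 powr p * P" for t
  proof -
    have "V t \<le> (LINT x|torus d. B0 powr p)"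
      unfolding V_def
    proof (rule integral_mono)
      show "integrable (torus d) (\<lambda>x. norm (u t x) powr p)"
        by (rule torus.integrable_const_bound[of _ "B0 powr p"]) (use ub p2 in \<open>auto intro!: powr_mono2 simp: u_def\<close>)
    qed (use ub p2 in \<open>auto intro!: powr_mono2\<close>)
    then show ?thesis by (simp add: P_def mult.commute)
  qed
  have V_i: "integrable unit_time V"
    by (rule unit_time.integrable_const_bound[of _ "B0 powr p * P"]) (auto simp: V0 V_b measurable_unit_time)
  define X where "X = (LINT t|unit_time. V t)"
  have X0: "X \<ge> 0" unfolding X_def using V0 by simp
  \<comment> \<open>The coefficient at \<open>k\<close> of the adjoint evolution applied to
    \<open>F\<close>.\<close>
  define b where "b k = (LINT t|unit_time. cnj (phase t k) * hat (F t) k)" for k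
  have bi: "integrable unit_time (\<lambda>t. cnj (phase t k) * hat (F t) k)" for k
    by (rule unit_time.integrable_const_bound[of _ "B * P"]) (auto simp: norm_mult hat_b intro!: measurable_unit_time)
  have dual: "of_real X = (\<Sum>k\<in>S. c k * cnj (b k))"
  proof -
    have Vt: "of_real (V t) = (\<Sum>k\<in>S. c k * cnj (cnj (phase t k) * hat (F t) k))" for t
    proof -
      have "complex_of_real (V t) = (LINT x|torus d. cnj (F t x * cnj (u t x)))"
        unfolding V_def integral_complex_of_real[symmetric] by (simp add: mult.commute flip: uF)
      also have "\<dots> = cnj (LINT x|torus d. F t x * cnj (u t x))"
        by (rule Bochner_Integration.integral_cnj)
      also have "(LINT x|torus d. F t x * cnj (u t x)) =
          of_real ((2 * pi) ^ d) * (\<Sum>k\<in>S. cnj (c k * phase t k) * fourier_coeff d (F t) k)"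
        unfolding u_def by (rule integral_mult_cnj_trig_poly[OF Fi])
      also have "cnj \<dots> = (\<Sum>k\<in>S. c k * cnj (cnj (phase t k) * hat (F t) k))"
        by (simp add: hat_eq sum_distrib_left ac_simps)
      finally show ?thesis .
    qed
    have "of_real X = (LINT t|unit_time. complex_of_real (V t))"
      unfolding X_def by (rule integral_complex_of_real[symmetric])
    also have "\<dots> = (\<Sum>k\<in>S. LINT t|unit_time. c k * cnj (cnj (phase t k) * hat (F t) k))"
      unfolding Vt by (rule Bochner_Integration.integral_sum) (intro integrable_mult_right integrable_cnj bi)
    also have "\<dots> = (\<Sum>k\<in>S. c k * cnj (b k))"
      unfolding b_def integral_mult_right_zero Bochner_Integration.integral_cnj ..
    finally show ?thesis .
  qed
  define A where "A = (\<Sum>k\<in>S. (norm (c k))\<^sup>2)"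
  have A0: "A \<ge> 0" unfolding A_def by (simp add: sum_nonneg)
  \<comment> \<open>\<open>weight\<close> is 1 on \<open>S\<close> and nonnegative elsewhere, so
    passing from \<open>S\<close> to the whole box only increases the sum, and the weighted sum has
    the kernel that obeys the dispersive bound.\<close>
  define N where "N = (\<Sum>k\<in>freq_box. weight k * (norm (b k))\<^sup>2)"
  have XN: "X\<^sup>2 \<le> A * N"
  proof -
    have "X \<le> (\<Sum>k\<in>S. norm (c k) * norm (b k))"
    proof -
      have "X = norm (complex_of_real X)" using X0 by simp
      also have "\<dots> \<le> (\<Sum>k\<in>S. norm (c k * cnj (b k)))" unfolding dual by (rule norm_sum)
      finally show ?thesis by (simp add: norm_mult)
    qed
    then have "X\<^sup>2 \<le> (\<Sum>k\<in>S. norm (c k) * norm (b k))\<^sup>2" using X0 by (intro power_mono)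
    also have "\<dots> \<le> A * (\<Sum>k\<in>S. (norm (b k))\<^sup>2)" unfolding A_def by (rule Cauchy_Schwarz_ineq_sum)
    also have "(\<Sum>k\<in>S. (norm (b k))\<^sup>2) = (\<Sum>k\<in>S. weight k * (norm (b k))\<^sup>2)"
    proof (rule sum.cong[OF refl])
      fix k assume "k \<in> S"
      then have "weight k = 1" unfolding weight_def using S(2) by (intro prod.neutral) (auto intro!: cutoff_eq_1 L)
      then show "(norm (b k))\<^sup>2 = weight k * (norm (b k))\<^sup>2" by simp
    qed
    also have "A * \<dots> \<le> A * N"
      unfolding N_def
    proof (intro mult_left_mono sum_mono2 A0 finite_freq_box)
      show "S \<subseteq> freq_box"
      proof
        fix k assume "k \<in> S"
        then have "k \<in> lattice d" "\<And>j. j \<in> {1..d} \<Longrightarrow> \<bar>k j\<bar> \<le> int L" using S(2) by blast+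
        then show "k \<in> freq_box" unfolding freq_box_def lattice_def PiE_iff by force
      qed
    qed (auto intro!: mult_nonneg_nonneg weight_bounds)
    finally show ?thesis .
  qed
  \<comment> \<open>Opening |b k|^2 as a double time integral; the two phases combine into the
    evolution over time s - t, which \<open>pairing_le\<close> estimates.\<close>
  define E where "E t s = (\<Sum>k\<in>freq_box. of_real (weight k) * phase (s - t) k * hat (F t) k * cnj (hat (F s) k))" for t s
  define C0 where "C0 = 2 * ((2 * pi) ^ d)\<^sup>2 powr (1 / p)"
  have C0: "C0 > 0" unfolding C0_def by simp
  have E_b: "norm (E t s) \<le> C0 * kernel_bound (s - t) powr (1 - 2 / p) * (V t powr (1 / q) * V s powr (1 / q))" for t s
    using pairing_le[OF Ft_m[of t] Ft_m[of s] Fb Fb p2 q_def, of "s - t"] unfolding E_def C0_def V_def Fq .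
  have E': "E t s = (\<Sum>k\<in>freq_box. of_real (weight k) * (cnj (phase t k) * hat (F t) k) * cnj (cnj (phase s k) * hat (F s) k))" for t s
    unfolding E_def phase_diff by (simp add: ac_simps)
  have inner: "(LINT s|unit_time. E t s) = (\<Sum>k\<in>freq_box. of_real (weight k) * (cnj (phase t k) * hat (F t) k) * cnj (b k))" for t
    unfolding E' b_def
    by (subst Bochner_Integration.integral_sum) 
      (auto intro!: integrable_mult_right integrable_cnj bi sum.cong simp only: integral_mult_right_zero Bochner_Integration.integral_cnj)
  have NE: "of_real N = (LINT t|unit_time. LINT s|unit_time. E t s)"
  proof -
    have "(LINT t|unit_time. LINT s|unit_time. E t s) =
       (\<Sum>k\<in>freq_box. LINT t|unit_time. of_real (weight k) * (cnj (phase t k) * hat (F t) k) * cnj (b k))"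
      unfolding inner by (rule Bochner_Integration.integral_sum) (intro integrable_mult_left integrable_mult_right bi)
    also have "\<dots> = (\<Sum>k\<in>freq_box. of_real (weight k) * b k * cnj (b k))"
      unfolding integral_mult_left_zero integral_mult_right_zero b_def ..
    also have "\<dots> = of_real N"
      unfolding N_def of_real_sum of_real_mult complex_norm_square by (simp only: mult.assoc)
    finally show ?thesis ..
  qed
  \<comment> \<open>Extended by 0 to the whole line, where the weak Young inequality lives; its q-th
    power integrates to X.\<close>
  define f where "f t = indicator {0..1} t * V t powr (1 / q)" for t :: real
  have f_m [measurable]: "f \<in> borel_measurable borel" unfolding f_def by measurable
  have f0: "f t \<ge> 0" for t unfolding f_def by simp
  have N_le: "ennreal N \<le> ennreal C0 * (\<integral>\<^sup>+t. \<integral>\<^sup>+s. ennreal (time_kernel p (t - s)) * (ennreal (f s) * ennreal (f t)) \<partial>lborel \<partial>lborel)"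
  proof -
    have Es_i: "integrable unit_time (E t)" for t
      unfolding E' by (intro Bochner_Integration.integrable_sum integrable_mult_right integrable_cnj bi)
    have Et_i: "integrable unit_time (\<lambda>t. LINT s|unit_time. E t s)"
      unfolding inner by (intro Bochner_Integration.integrable_sum integrable_mult_left integrable_mult_right bi)
    have "N \<le> norm (complex_of_real N)" by simp
    then have "ennreal N \<le> ennreal (norm (LINT t|unit_time. LINT s|unit_time. E t s))"
      unfolding NE by (rule ennreal_leI)
    also have "\<dots> \<le> (\<integral>\<^sup>+t. ennreal (norm (LINT s|unit_time. E t s)) \<partial>unit_time)"
      by (rule integral_norm_bound_ennreal[OF Et_i])
    also have "\<dots> \<le> (\<integral>\<^sup>+t. \<integral>\<^sup>+s. ennreal (norm (E t s)) \<partial>unit_time \<partial>unit_time)"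
      by (intro nn_integral_mono integral_norm_bound_ennreal Es_i)
    also have "\<dots> = (\<integral>\<^sup>+t. (\<integral>\<^sup>+s. ennreal (norm (E t s)) * indicator {0..1} s \<partial>lborel) * indicator {0..1} t \<partial>lborel)"
      by (simp add: nn_integral_restrict_space)
    also have "\<dots> \<le> (\<integral>\<^sup>+t. ennreal C0 * (\<integral>\<^sup>+s. ennreal (time_kernel p (t - s)) * (ennreal (f s) * ennreal (f t)) \<partial>lborel) \<partial>lborel)"
    proof (rule nn_integral_mono)
      fix t :: real
      have "(\<integral>\<^sup>+s. ennreal (norm (E t s)) * indicator {0..1} s \<partial>lborel) * indicator {0..1} t
        \<le> (\<integral>\<^sup>+s. ennreal C0 * (ennreal (time_kernel p (t - s)) * (ennreal (f s) * ennreal (f t))) \<partial>lborel)"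
      proof (cases "t \<in> {0..1}")
        case True
        have "(\<integral>\<^sup>+s. ennreal (norm (E t s)) * indicator {0..1} s \<partial>lborel) \<le>
          (\<integral>\<^sup>+s. ennreal C0 * (ennreal (time_kernel p (t - s)) * (ennreal (f s) * ennreal (f t))) \<partial>lborel)"
        proof (rule nn_integral_mono)
          fix s :: real
          show "ennreal (norm (E t s)) * indicator {0..1} s \<le> ennreal C0 * (ennreal (time_kernel p (t - s)) * (ennreal (f s) * ennreal (f t)))"
          proof (cases "s \<in> {0..1}")
            case s: True
            have "kernel_bound (s - t) = kernel_bound (t - s)" using kernel_bound_minus[of "t - s"] by simp
            then have "norm (E t s) \<le> C0 * (time_kernel p (t - s) * (f s * f t))"
              using E_b[of t s] s True by (simp add: time_kernel_def f_def ac_simps)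
            then have "ennreal (norm (E t s)) \<le> ennreal (C0 * (time_kernel p (t - s) * (f s * f t)))"
              by (rule ennreal_leI)
            also have "\<dots> = ennreal C0 * (ennreal (time_kernel p (t - s)) * (ennreal (f s) * ennreal (f t)))"
              using C0 f0[of s] by (simp add: ennreal_mult' time_kernel_def less_imp_le)
            finally show ?thesis using s by simp
          qed simp
        qed
        then show ?thesis using True by simp
      qed simp
      also have "\<dots> = ennreal C0 * (\<integral>\<^sup>+s. ennreal (time_kernel p (t - s)) * (ennreal (f s) * ennreal (f t)) \<partial>lborel)"
        by (rule nn_integral_cmult) measurable
      finally show "(\<integral>\<^sup>+s. ennreal (norm (E t s)) * indicator {0..1} s \<partial>lborel) * indicator {0..1} t \<le> \<dots>" .
    qed
    also have "\<dots> = ennreal C0 * (\<integral>\<^sup>+t. \<integral>\<^sup>+s. ennreal (time_kernel p (t - s)) * (ennreal (f s) * ennreal (f t)) \<partial>lborel \<partial>lborel)"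
      by (rule nn_integral_cmult) measurable
    finally show ?thesis .
  qed
  have fX: "(\<integral>\<^sup>+t. ennreal (f t powr q) \<partial>lborel) = ennreal X"
  proof -
    have "(\<integral>\<^sup>+t. ennreal (f t powr q) \<partial>lborel) = (\<integral>\<^sup>+t. ennreal (V t) * indicator {0..1} t \<partial>lborel)"
      using q1 V0 by (intro nn_integral_cong) (auto simp: f_def powr_powr powr_mult indicator_def)
    also have "\<dots> = (\<integral>\<^sup>+t. ennreal (V t) \<partial>unit_time)"
      by (simp add: nn_integral_restrict_space)
    also have "\<dots> = ennreal X"
      unfolding X_def by (rule nn_integral_eq_integral[OF V_i]) (simp add: V0)
    finally show ?thesis .
  qed
  define C1 where "C1 = 2 * (r / (r - 1) * (p - 1))"
  have C1: "C1 > 0" unfolding C1_def using r1 p2 by simp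
  define W where "W = arc_const * (real L)\<^sup>2"
  have W: "W > 0" unfolding W_def using arc_const_pos L by simp
  \<comment> \<open>X bounds itself: X^2 \<le> A N, and N is at most a multiple of X^(2/q). As X is
    finite and 2 - 2/q = 1/r, the factor X^(2/q) cancels for X > 0, and the r-th power gives the
    claim.\<close>
  have "X \<le> (C0 * C1) powr r * W * A powr r"
  proof (cases "X = 0")
    case True
    then show ?thesis using W by simp
  next
    case False
    then have Xp: "X > 0" using X0 by simp
    have "(\<integral>\<^sup>+t. \<integral>\<^sup>+s. ennreal (time_kernel p (t - s)) * (ennreal (f s) * ennreal (f t)) \<partial>lborel \<partial>lborel)
       \<le> ennreal (C1 * W powr (1 / r) * X powr (2 / q))"
      unfolding C1_def
    proof (rule weak_young_quadratic[OF _ _ r1 W pr q_def _ _ _ Xp f0])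
      show "time_kernel p (- \<tau>) = time_kernel p \<tau>" for \<tau>
        unfolding time_kernel_def kernel_bound_minus by (auto simp: indicator_def)
      show "emeasure lborel {\<tau>. time_kernel p \<tau> > \<kappa>} \<le> ennreal (W * \<kappa> powr - r)" if "\<kappa> > 0" for \<kappa>
        using time_kernel_weak[OF p that] unfolding W_def r_def .
      show "(\<integral>\<^sup>+s. ennreal (f s powr q) \<partial>lborel) \<le> ennreal X" using fX by simp
    qed measurable
    then have "ennreal N \<le> ennreal C0 * ennreal (C1 * W powr (1 / r) * X powr (2 / q))"
      by (intro order_trans[OF N_le] mult_left_mono) auto
    then have "ennreal N \<le> ennreal (C0 * (C1 * W powr (1 / r) * X powr (2 / q)))"
      using C0 by (simp add: ennreal_mult' less_imp_le)
    then have N2: "N \<le> C0 * (C1 * W powr (1 / r) * X powr (2 / q))"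
      using C0 C1 by (subst (asm) ennreal_le_iff) auto
    have "X\<^sup>2 \<le> A * (C0 * (C1 * W powr (1 / r) * X powr (2 / q)))"
      by (rule order_trans[OF XN mult_left_mono[OF N2 A0]])
    moreover have "X\<^sup>2 = X powr (1 / r) * X powr (2 / q)"
    proof -
      have "1 / r + 2 / q = 2" unfolding q_def pr using r1 by (simp add: field_simps)
      then show ?thesis using Xp by (simp add: powr_numeral flip: powr_add)
    qed
    ultimately have "X powr (1 / r) * X powr (2 / q) \<le> (C0 * C1 * W powr (1 / r) * A) * X powr (2 / q)"
      by (simp add: ac_simps)
    then have "X powr (1 / r) \<le> C0 * C1 * W powr (1 / r) * A"
      using Xp by simp
    then have "(X powr (1 / r)) powr r \<le> (C0 * C1 * W powr (1 / r) * A) powr r"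
      using r1 by (intro powr_mono2) auto
    then show ?thesis using Xp r1 C0 C1 W A0 by (simp add: powr_powr powr_mult less_imp_le)
  qed
  moreover have "endpoint_const = (C0 * C1) powr r * arc_const"
    unfolding endpoint_const_def Let_def C0_def C1_def r_def p ..
  ultimately show ?thesis
    unfolding X_def V_def u_def A_def W_def r_def by (simp add: ac_simps)
qed

end

section \<open>All exponents\<close>

text \<open>With N = 2^n every coordinate is below 2N in absolute value, and the cube [-2N, 2N]^d
  has (4N + 1)^d \<le> (5N)^d lattice points.\<close>

lemma finite_low_frequencies:
  assumes S: "S = {k \<in> lattice d. freq_norm d k < 2 * 2 ^ n}"
  shows "finite S" "\<And>k j. k \<in> S \<Longrightarrow> j \<in> {1..d} \<Longrightarrow> \<bar>k j\<bar> \<le> int (2 * 2 ^ n)"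
    "real (card S) \<le> (5 * 2 ^ n) ^ d"
proof -
  let ?L = "2 * 2 ^ n :: int"
  show kj: "\<bar>k j\<bar> \<le> int (2 * 2 ^ n)" if "k \<in> S" "j \<in> {1..d}" for k j
  proof -
    have "(real_of_int (k j))\<^sup>2 \<le> (\<Sum>j\<in>{1..d}. (real_of_int (k j))\<^sup>2)"
      by (rule member_le_sum) (use that in auto)
    then have "sqrt ((real_of_int (k j))\<^sup>2) \<le> freq_norm d k"
      unfolding freq_norm_def by (rule real_sqrt_le_mono)
    then have "\<bar>real_of_int (k j)\<bar> < 2 * 2 ^ n" using that unfolding S by simp
    also have "2 * 2 ^ n = real_of_int ?L" by simp
    finally have "\<bar>k j\<bar> < ?L" unfolding of_int_abs[symmetric] of_int_less_iff .
    then show ?thesis by simp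
  qed
  have sub: "S \<subseteq> PiE {1..d} (\<lambda>_. {- ?L..?L})"
  proof
    fix k assume k: "k \<in> S"
    then have "k \<in> PiE {1..d} (\<lambda>_. UNIV)" unfolding S lattice_def by simp
    moreover have "k j \<in> {- ?L..?L}" if "j \<in> {1..d}" for j
      using kj[OF k that] by (simp add: abs_le_iff)
    ultimately show "k \<in> PiE {1..d} (\<lambda>_. {- ?L..?L})" unfolding PiE_iff by blast
  qed
  have fin: "finite (PiE {1..d} (\<lambda>_. {- ?L..?L}))" by (intro finite_PiE) auto
  show "finite S" by (rule finite_subset[OF sub fin])
  have "card S \<le> card (PiE {1..d} (\<lambda>_. {- ?L..?L}))" by (rule card_mono[OF fin sub])
  also have "\<dots> = (nat (2 * ?L + 1)) ^ d" by (simp add: card_PiE)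
  also have "\<dots> \<le> (5 * 2 ^ n) ^ d"
  proof (rule power_mono)
    have "(1::int) \<le> 2 ^ n" by simp
    then have "2 * ?L + 1 \<le> int (5 * 2 ^ n)" by simp
    then show "nat (2 * ?L + 1) \<le> 5 * 2 ^ n" by linarith
  qed simp
  finally have "real (card S) \<le> real ((5 * 2 ^ n) ^ d)" by (simp only: of_nat_le_iff)
  then show "real (card S) \<le> (5 * 2 ^ n) ^ d" by simp
qed

text \<open>Interpolation at the level of values: below \<open>l\<close> compare with the square,
  above \<open>l\<close> with the q-th power, where the exponent p - q is at most 0.\<close>

lemma powr_split_le:
  fixes a l p q :: real
  assumes "a \<ge> 0" "l > 0" "2 \<le> p" "p \<le> q"
  shows "a powr p \<le> l powr (p - 2) * a powr 2 + l powr (p - q) * a powr q"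
proof (cases "a \<le> l")
  case True
  have "a powr p = a powr (p - 2) * a powr 2" unfolding powr_add[symmetric] by simp
  also have "\<dots> \<le> l powr (p - 2) * a powr 2"
    using assms True by (intro mult_right_mono powr_mono2) auto
  finally show ?thesis using assms by (simp add: add_increasing2)
next
  case False
  then have "a powr p = a powr (p - q) * a powr q" unfolding powr_add[symmetric] by simp
  also have "\<dots> \<le> l powr (p - q) * a powr q"
    using assms False by (intro mult_right_mono powr_mono2') auto
  finally show ?thesis by (simp add: add_increasing)
qed

theorem theorem1p1:
  fixes d v :: nat and \<theta> :: "nat \<Rightarrow> real" and p :: real
  assumes "d \<ge> 2" and "even d" and "v = d div 2"
    and "\<And>j. j \<in> {1..d} \<Longrightarrow> \<theta> j \<in> {0<..1}"
    and "p \<ge> 2"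
  shows "\<exists>C::real. \<forall>n::nat. \<forall>N::real. N = 2 ^ n \<longrightarrow> (\<forall>\<phi> \<in> Lp_space 2 (torus d).
    (\<lambda>(t, x). freq_proj d N (propagator d v \<theta> t \<phi>) x) \<in> Lp_space p (spacetime d) \<and>
    Lp_norm p (spacetime d) (\<lambda>(t, x). freq_proj d N (propagator d v \<theta> t \<phi>) x)
      \<le> C * (N powr (real d / 2 - (real d + 2) / p) + N powr (real d / 4 - real d / (2 * p)))
          * Lp_norm 2 (torus d) \<phi>)"
proof -
  have hyp: "hyperbolic d v \<theta> L" if "L > 0" for L
    by unfold_locales (use assms that in auto)
  define pc where "pc = 2 + 8 / real d"
  \<comment> \<open>The 4 comes from L = 2N, as the endpoint estimate carries the square of
    L.\<close>
  define K where "K = 4 * hyperbolic.endpoint_const d \<theta>"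
  have K0: "K \<ge> 0"
  proof -
    interpret hyperbolic d v \<theta> 1 by (rule hyp) simp
    show ?thesis unfolding K_def endpoint_const_def Let_def using arc_const_pos by simp
  qed
  have pc2: "pc > 2" unfolding pc_def using assms(1) by simp
  then have pc0: "pc \<ge> 0" by simp
  have dpc: "real d * pc = 2 * d + 8" unfolding pc_def using assms(1) by (simp add: field_simps)
  \<comment> \<open>The first summand serves p \<le> pc, the second p > pc; both are nonnegative, so
    one constant covers either case.\<close>
  define C where "C = (1 + K) powr (1 / p) + (5 powr (d * (p - pc) / 2) * K) powr (1 / p)"
  show ?thesis
  proof (rule exI[of _ C], intro allI impI ballI)
    fix n :: nat and N :: real and \<phi>
    assume N: "N = 2 ^ n" and \<phi>: "\<phi> \<in> Lp_space 2 (torus d)"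
    define L :: nat where "L = 2 * 2 ^ n"
    interpret hyperbolic d v \<theta> L by (rule hyp) (simp add: L_def)
    have N1: "N \<ge> 1" and N0: "N > 0" unfolding N by auto
    have LN: "real L = 2 * N" unfolding L_def N by simp
    define S where "S = {k \<in> lattice d. freq_norm d k < 2 * N}"
    note S = finite_low_frequencies[OF S_def[unfolded N], folded N L_def]
    have Slat: "S \<subseteq> lattice d" unfolding S_def by auto
    define c where "c k = fourier_coeff d \<phi> k" for k
    define u where "u t x = trig_poly d S (\<lambda>k. c k * phase t k) x" for t x
    \<comment> \<open>The projection sees the propagator only through its Fourier coefficients, so
      the representatives chosen separately for each t disappear and an explicit trigonometric
      polynomial remains.\<close>
    have u_eq: "freq_proj d N (propagator d v \<theta> t \<phi>) x = u t x" for t x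
      unfolding freq_proj_def u_def trig_poly_def S_def[symmetric]
    proof (intro sum.cong refl)
      fix k assume "k \<in> S"
      then have "k \<in> lattice d" using Slat by blast
      then show "fourier_coeff d (propagator d v \<theta> t \<phi>) k * character d k x = c k * phase t k * character d k x"
        using fourier_coeff_propagator[OF d \<phi>, of k v \<theta> t] unfolding c_def phase_def cis_conv_exp
        by (simp add: mult.commute)
    qed
    define M where "M = Lp_norm 2 (torus d) \<phi>"
    have M0: "M \<ge> 0" unfolding M_def Lp_norm_def by simp
    have \<phi>2: "norm (\<phi> x) powr 2 = (norm (\<phi> x))\<^sup>2" for x by (simp add: powr_numeral)
    have M2: "(LINT x|torus d. (norm (\<phi> x))\<^sup>2) = M powr 2"
      unfolding M_def Lp_norm_def by (simp add: \<phi>2 powr_powr)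
    define A where "A = (\<Sum>k\<in>S. (norm (c k))\<^sup>2)"
    have A0: "A \<ge> 0" unfolding A_def by (simp add: sum_nonneg)
    have bessel: "(2 * pi) ^ d * A \<le> M powr 2"
      unfolding A_def c_def M2[symmetric]
      using \<phi> by (intro bessel_inequality S(1) Slat) (auto simp: Lp_space_def \<phi>2)
    have A_le: "A \<le> M powr 2"
    proof -
      have "1 * A \<le> (2 * pi) ^ d * A"
        using pi_ge_two by (intro mult_right_mono one_le_power A0) auto
      then show ?thesis using bessel by simp
    qed
    \<comment> \<open>The trivial sup bound: Cauchy-Schwarz over at most (5N)^d frequencies.\<close>
    define B where "B = (5 * N) powr (d / 2) * M"
    have B0: "B \<ge> 0" unfolding B_def using M0 by simp
    have ub: "norm (u t x) \<le> B" for t x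
    proof -
      have "norm (u t x) \<le> (\<Sum>k\<in>S. norm (c k))"
        unfolding u_def using norm_trig_poly_le[of d S "\<lambda>k. c k * phase t k" x] by (simp add: norm_mult)
      also have "\<dots> \<le> sqrt (A * (5 * N) ^ d)"
      proof (rule real_le_rsqrt)
        have "(\<Sum>k\<in>S. norm (c k))\<^sup>2 \<le> A * real (card S)"
          using Cauchy_Schwarz_ineq_sum[of "\<lambda>k. norm (c k)" "\<lambda>_. 1" S] by (simp add: A_def)
        also have "\<dots> \<le> A * (5 * N) ^ d" using S(3) by (intro mult_left_mono A0)
        finally show "(\<Sum>k\<in>S. norm (c k))\<^sup>2 \<le> A * (5 * N) ^ d" .
      qed
      also have "\<dots> \<le> sqrt (B\<^sup>2)"
      proof (rule real_sqrt_le_mono)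
        have "B\<^sup>2 = ((5 * N) powr (d / 2))\<^sup>2 * M powr 2"
          unfolding B_def using M0 by (simp add: power_mult_distrib powr_numeral)
        also have "((5 * N) powr (d / 2))\<^sup>2 = (5 * N) ^ d"
          using N0 unfolding power2_eq_square powr_add[symmetric] by (simp add: powr_realpow)
        finally show "A * (5 * N) ^ d \<le> B\<^sup>2"
          using A_le N0 by (simp add: mult.commute mult_left_mono)
      qed
      finally show ?thesis using B0 by simp
    qed
    interpret pair_sigma_finite unit_time "torus d" ..
    interpret st: finite_measure "unit_time \<Otimes>\<^sub>M torus d"
      by (intro finite_measure_pair_measure finite_measure_unit_time finite_measure_torus)
    have phase_m [measurable]: "(\<lambda>t. phase t k) \<in> borel_measurable unit_time" for k
      unfolding phase_def cis_conv_exp by (intro measurable_unit_time) measurable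
    have u_m [measurable]: "(\<lambda>(t, x). u t x) \<in> borel_measurable (unit_time \<Otimes>\<^sub>M torus d)"
      unfolding u_def trig_poly_def by measurable
    have int: "integrable (unit_time \<Otimes>\<^sub>M torus d) (\<lambda>z. norm (case z of (t, x) \<Rightarrow> u t x) powr s)" if "s \<ge> 0" for s
      by (rule st.integrable_const_bound[of _ "B powr s"]) (use that ub in \<open>auto intro!: powr_mono2\<close>)
    define I where "I s = (LINT z|(unit_time \<Otimes>\<^sub>M torus d). norm (case z of (t, x) \<Rightarrow> u t x) powr s)" for s
    have I_iter: "I s = (LINT t|unit_time. LINT x|torus d. norm (u t x) powr s)" if "s \<ge> 0" for s
      unfolding I_def using integral_fst'[OF int[OF that]] by simp
    \<comment> \<open>The phases are unimodular, so the L^2 norm in space is constant in t, and the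
      time interval has length 1.\<close>
    have I2: "I 2 \<le> M powr 2"
    proof -
      have "(LINT x|torus d. norm (u t x) powr 2) = (2 * pi) ^ d * A" for t
      proof -
        have "norm (u t x) powr 2 = (norm (u t x))\<^sup>2" for x by (simp add: powr_numeral)
        then show ?thesis
          unfolding u_def A_def using integral_norm_trig_poly_sq[OF S(1) Slat, of "\<lambda>k. c k * phase t k"]
          by (simp add: norm_mult)
      qed
      then have "I 2 = (2 * pi) ^ d * A * measure unit_time (space unit_time)"
        using I_iter[of 2] by simp
      also have "measure unit_time (space unit_time) = 1"
        by (simp add: measure_restrict_space space_restrict_space)
      finally show ?thesis using bessel by simp
    qed
    have Ipc: "I pc \<le> K * N powr 2 * M powr pc"
    proof -
      have "I pc \<le> endpoint_const * (real L)\<^sup>2 * A powr (pc / 2)"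
        unfolding I_iter[OF pc0] u_def A_def
        by (rule endpoint_estimate[OF S(1) _ pc_def]) (use S(2) Slat in blast)
      also have "\<dots> = K * N powr 2 * A powr (pc / 2)"
        unfolding LN K_def using N0 by (simp add: power_mult_distrib powr_numeral)
      also have "\<dots> \<le> K * N powr 2 * (M powr 2) powr (pc / 2)"
        using A_le A0 K0 pc2 by (intro mult_left_mono powr_mono2) auto
      finally show ?thesis by (simp add: powr_powr)
    qed
    have root: "I p powr (1 / p) \<le> H powr (1 / p) * N powr (e / p) * M"
      if "I p \<le> H * N powr e * M powr p" "H \<ge> 0" for H e
    proof -
      have "I p powr (1 / p) \<le> (H * N powr e * M powr p) powr (1 / p)"
        using that assms(5) by (intro powr_mono2) (auto simp: I_def)
      also have "\<dots> = H powr (1 / p) * N powr (e / p) * M"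
        using that M0 assms(5) by (simp add: powr_mult powr_powr)
      finally show ?thesis .
    qed
    have main: "I p powr (1 / p) \<le> C * (N powr (real d / 2 - (real d + 2) / p) + N powr (real d / 4 - real d / (2 * p))) * M"
    proof (cases "p \<le> pc")
      case True
      have "I p \<le> (1 + K) * N powr (d * (p - 2) / 4) * M powr p"
      proof (cases "M = 0")
        case True
        then have "u t x = 0" for t x using ub[of t x] unfolding B_def by simp
        then have "I p = 0" unfolding I_def by (simp add: case_prod_unfold)
        then show ?thesis using K0 by simp
      next
        case False
        then have Mp: "M > 0" using M0 by simp
        \<comment> \<open>Balances the two terms of \<open>powr_split_le\<close>: they agree when
          l^(pc-2) = N^2 M^(pc-2), and pc - 2 = 8/d turns this into N^(d/4) M.\<close>
        define l where "l = N powr (d / 4) * M"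
        have l: "l > 0" unfolding l_def using Mp N0 by simp
        have "I p \<le> (LINT z|(unit_time \<Otimes>\<^sub>M torus d). l powr (p - 2) * norm (case z of (t, x) \<Rightarrow> u t x) powr 2 +
            l powr (p - pc) * norm (case z of (t, x) \<Rightarrow> u t x) powr pc)"
          unfolding I_def
        proof (rule integral_mono)
          show "integrable (unit_time \<Otimes>\<^sub>M torus d) (\<lambda>z. norm (case z of (t, x) \<Rightarrow> u t x) powr p)"
            by (rule int) (use assms(5) in simp)
          show "integrable (unit_time \<Otimes>\<^sub>M torus d) (\<lambda>z. l powr (p - 2) * norm (case z of (t, x) \<Rightarrow> u t x) powr 2 +
            l powr (p - pc) * norm (case z of (t, x) \<Rightarrow> u t x) powr pc)"
            by (intro Bochner_Integration.integrable_add integrable_mult_right int) (use pc2 in auto)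
          fix z
          show "norm (case z of (t, x) \<Rightarrow> u t x) powr p \<le> l powr (p - 2) * norm (case z of (t, x) \<Rightarrow> u t x) powr 2 +
            l powr (p - pc) * norm (case z of (t, x) \<Rightarrow> u t x) powr pc"
            by (rule powr_split_le) (use l assms(5) True in auto)
        qed
        also have "\<dots> = l powr (p - 2) * I 2 + l powr (p - pc) * I pc"
          unfolding I_def using int[of 2] int[of pc] pc2
          by (subst Bochner_Integration.integral_add) auto
        also have "\<dots> \<le> l powr (p - 2) * M powr 2 + l powr (p - pc) * (K * N powr 2 * M powr pc)"
          by (intro add_mono mult_left_mono I2 Ipc) auto
        also have "\<dots> = (1 + K) * N powr (d * (p - 2) / 4) * M powr p"
        proof -
          have 1: "l powr s = N powr (d * s / 4) * M powr s" for s :: real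
            unfolding l_def using Mp N0 by (simp add: powr_mult powr_powr mult.commute)
          have 2: "M powr (p - s) * M powr s = M powr p" for s
            unfolding powr_add[symmetric] by simp
          have 3: "N powr (d * (p - pc) / 4) * N powr 2 = N powr (d * (p - 2) / 4)"
          proof -
            have "d * (p - pc) / 4 + 2 = d * (p - 2) / 4" using dpc by (simp add: field_simps)
            then show ?thesis by (simp only: powr_add[symmetric])
          qed
          have "l powr (p - 2) * M powr 2 = N powr (d * (p - 2) / 4) * M powr p"
            unfolding 1 by (simp only: mult.assoc 2)
          moreover have "l powr (p - pc) * (K * N powr 2 * M powr pc) =
              K * (N powr (d * (p - pc) / 4) * N powr 2) * (M powr (p - pc) * M powr pc)"
            unfolding 1 by (simp only: ac_simps)
          ultimately show ?thesis unfolding 2 3 by (simp add: algebra_simps)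
        qed
        finally show ?thesis .
      qed
      from root[OF this] have "I p powr (1 / p) \<le> (1 + K) powr (1 / p) * N powr (d * (p - 2) / 4 / p) * M"
        using K0 by simp
      also have "d * (p - 2) / 4 / p = real d / 4 - real d / (2 * p)"
        using assms(5) by (simp add: field_simps)
      also have "(1 + K) powr (1 / p) * N powr (real d / 4 - real d / (2 * p)) * M \<le>
          C * (N powr (real d / 2 - (real d + 2) / p) + N powr (real d / 4 - real d / (2 * p))) * M"
        unfolding C_def by (intro mult_right_mono mult_mono M0) auto
      finally show ?thesis .
    next
      case False
      \<comment> \<open>Above \<open>pc\<close> the surplus power p - pc is absorbed by the sup
        bound \<open>B\<close>.\<close>
      have "I p \<le> (LINT z|(unit_time \<Otimes>\<^sub>M torus d). B powr (p - pc) * norm (case z of (t, x) \<Rightarrow> u t x) powr pc)"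
        unfolding I_def
      proof (rule integral_mono)
        show "integrable (unit_time \<Otimes>\<^sub>M torus d) (\<lambda>z. norm (case z of (t, x) \<Rightarrow> u t x) powr p)"
          by (rule int) (use assms(5) in simp)
        show "integrable (unit_time \<Otimes>\<^sub>M torus d) (\<lambda>z. B powr (p - pc) * norm (case z of (t, x) \<Rightarrow> u t x) powr pc)"
          by (intro integrable_mult_right int) (use pc2 in auto)
        fix z :: "real \<times> (nat \<Rightarrow> real)"
        let ?a = "norm (case z of (t, x) \<Rightarrow> u t x)"
        have "?a powr p = ?a powr (p - pc) * ?a powr pc" unfolding powr_add[symmetric] by simp
        also have "\<dots> \<le> B powr (p - pc) * ?a powr pc"
          using False ub by (intro mult_right_mono powr_mono2) (auto split: prod.split)
        finally show "?a powr p \<le> B powr (p - pc) * ?a powr pc" .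
      qed
      also have "\<dots> = B powr (p - pc) * I pc" unfolding I_def by simp
      also have "\<dots> \<le> B powr (p - pc) * (K * N powr 2 * M powr pc)"
        by (intro mult_left_mono Ipc) simp
      also have "\<dots> = (5 powr (d * (p - pc) / 2) * K) * N powr (d * p / 2 - (d + 2)) * M powr p"
      proof -
        have 1: "B powr s = 5 powr (d * s / 2) * N powr (d * s / 2) * M powr s" for s :: real
          unfolding B_def using M0 N0 by (simp add: powr_mult powr_powr mult.commute)
        have 2: "M powr (p - pc) * M powr pc = M powr p"
          unfolding powr_add[symmetric] by simp
        have 3: "N powr (d * (p - pc) / 2) * N powr 2 = N powr (d * p / 2 - (d + 2))"
        proof -
          have "d * (p - pc) / 2 + 2 = d * p / 2 - (d + 2)" using dpc by (simp add: field_simps)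
          then show ?thesis by (simp only: powr_add[symmetric])
        qed
        have "B powr (p - pc) * (K * N powr 2 * M powr pc) =
            5 powr (d * (p - pc) / 2) * K * (N powr (d * (p - pc) / 2) * N powr 2) * (M powr (p - pc) * M powr pc)"
          unfolding 1 by (simp only: ac_simps)
        then show ?thesis unfolding 2 3 .
      qed
      finally have "I p \<le> (5 powr (d * (p - pc) / 2) * K) * N powr (d * p / 2 - (d + 2)) * M powr p" .
      from root[OF this] have "I p powr (1 / p) \<le>
          (5 powr (d * (p - pc) / 2) * K) powr (1 / p) * N powr ((d * p / 2 - (d + 2)) / p) * M"
        using K0 by simp
      also have "(d * p / 2 - (d + 2)) / p = real d / 2 - (real d + 2) / p"
        using assms(5) by (simp add: field_simps)
      also have "(5 powr (d * (p - pc) / 2) * K) powr (1 / p) * N powr (real d / 2 - (real d + 2) / p) * M \<le>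
          C * (N powr (real d / 2 - (real d + 2) / p) + N powr (real d / 4 - real d / (2 * p))) * M"
        unfolding C_def by (intro mult_right_mono mult_mono M0) auto
      finally show ?thesis .
    qed
    have f_eq: "(\<lambda>(t, x). freq_proj d N (propagator d v \<theta> t \<phi>) x) = (\<lambda>(t, x). u t x)"
      by (simp add: u_eq)
    show "(\<lambda>(t, x). freq_proj d N (propagator d v \<theta> t \<phi>) x) \<in> Lp_space p (spacetime d) \<and>
      Lp_norm p (spacetime d) (\<lambda>(t, x). freq_proj d N (propagator d v \<theta> t \<phi>) x)
        \<le> C * (N powr (real d / 2 - (real d + 2) / p) + N powr (real d / 4 - real d / (2 * p)))
            * Lp_norm 2 (torus d) \<phi>"
      unfolding f_eq Lp_space_def Lp_norm_def[of p] spacetime_def M_def[symmetric] I_def[symmetric]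
      using main u_m int[of p] assms(5) by simp
  qed
qed

end
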